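(* For any odd integer $k\ge 5$, every planar graph of girth $k$ that contains no cycle of length $\ell$ for any $\ell$ with $k+1\le \ell\le\lfloor\frac{22k}{3}\rfloor$ admits a fractional $(k:\frac{k-1}{2})$-coloring.
   Context: For positive integers $a\ge b$, a fractional $(a:b)$-coloring of a graph $G$ assigns to each vertex $v$ a $b$-element subset $\varphi(v)\subseteq\{1,\dots,a\}$ such that $\varphi(u)\cap\varphi(v)=\emptyset$ whenever $uv\in E(G)$. The girth of a graph is the length of its shortest cycle. *)

theory Defs
  imports
    "HOL-Analysis.Analysis"
    "HOL-Library.Extended_Nat"
    "Graph_Theory.Arc_Walk"
begin

text \<open>
  Finite simple undirected graphs are the symmetric digraphs of the locale \<^locale>\<open>graph\<close>:
  every undirected edge is a pair of antiparallel arcs.  The back-and-forth closed walk along one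
  edge is a \<^const>\<open>pre_digraph.cycle\<close> of length 2, so the cycles of the undirected graph are
  those of length at least 3.
\<close>

definition ucycle :: "('a, 'b) pre_digraph \<Rightarrow> 'b awalk \<Rightarrow> bool" where
  "ucycle G c \<longleftrightarrow> pre_digraph.cycle G c \<and> 3 \<le> length c"

text \<open>The girth of a forest is \<open>\<infinity>\<close>.\<close>

definition girth :: "('a, 'b) pre_digraph \<Rightarrow> enat" where
  "girth G = (INF c\<in>{c. ucycle G c}. enat (length c))"

text \<open>
  In a drawing, both arcs of an undirected edge are drawn as the same simple curve (as a point set),
  and curves of different edges meet only in common end points.
\<close>

definition plane_drawing ::
    "('a, 'b) pre_digraph \<Rightarrow> ('a \<Rightarrow> complex) \<Rightarrow> ('b \<Rightarrow> real \<Rightarrow> complex) \<Rightarrow> bool" where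
  "plane_drawing G p \<gamma> \<longleftrightarrow>
     inj_on p (verts G) \<and>
     (\<forall>e\<in>arcs G. arc (\<gamma> e) \<and>
        pathstart (\<gamma> e) = p (tail G e) \<and> pathfinish (\<gamma> e) = p (head G e) \<and>
        path_image (\<gamma> e) \<inter> p ` verts G = {p (tail G e), p (head G e)}) \<and>
     (\<forall>e\<in>arcs G. \<forall>f\<in>arcs G.
        if {tail G e, head G e} = {tail G f, head G f}
        then path_image (\<gamma> e) = path_image (\<gamma> f)
        else path_image (\<gamma> e) \<inter> path_image (\<gamma> f) \<subseteq> p ` verts G)"

definition planar :: "('a, 'b) pre_digraph \<Rightarrow> bool" where
  "planar G \<longleftrightarrow> (\<exists>p \<gamma>. plane_drawing G p \<gamma>)"

definition fractional_coloring ::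
    "('a, 'b) pre_digraph \<Rightarrow> nat \<Rightarrow> nat \<Rightarrow> ('a \<Rightarrow> nat set) \<Rightarrow> bool" where
  "fractional_coloring G a b \<phi> \<longleftrightarrow>
     1 \<le> b \<and> b \<le> a \<and>
     (\<forall>v\<in>verts G. \<phi> v \<subseteq> {1..a} \<and> card (\<phi> v) = b) \<and>
     (\<forall>(u, v)\<in>arcs_ends G. \<phi> u \<inter> \<phi> v = {})"

end

theory Submission
  imports Defs "HOL-Complex_Analysis.Winding_Numbers" "HOL-Library.Disjoint_Sets"
begin

text \<open>
  Write $k = 2t + 1$. For $t$-subsets $A$, $B$ of a $k$-set, a path of length $l$ between vertices
  coloured $A$ and $B$ can be coloured as soon as $|A \setminus B|$ lies in a certain interval
  depending on $l$ only. These intervals are chosen so narrow that they survive a second operation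
  besides suppressing a vertex of degree 2: if a $k$-cycle consists of two paths, the longer path
  can be deleted, since every admissible colouring of the shorter one extends to it. After these
  reductions the minimum degree is 3, every path has length at most $k - 2$, and every $k$-cycle
  carries at least three branch vertices. A $k$-cycle with exactly three branch vertices, all of
  degree 3, is reducible if the three paths leaving it have total length more than $8k/3$.

  On the other side, distinct $k$-cycles are edge-disjoint, because the symmetric difference of two
  that share an edge has even degrees and even size less than $2k$, so that it would be a single
  cycle of odd length $k$. A plane graph with edge set $S$ and vertex set $U$ has at least
  $|S| - |U| + 1$ cycles such that every edge is in at most two of them. All of them have length $k$
  or more than $22k/3$, so that
  $22k(|S| + 1) \le 22k|U| + 6|S| + 19kN$, where $N$ is the number of $k$-cycles in $S$. Giving each
  branch vertex of a reduced network its share of this inequality leaves no room for a network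
  without a reducible $k$-cycle.
\<close>

section \<open>Set colourings of paths\<close>

text \<open>Planarity is used only for the original graph. Suppressing a vertex of degree 2 may
  create parallel edges and loops, so the induction carries the inequality instead, for all edge
  sets at once: it passes to subsets, and a suppression lowers the numbers of edges and vertices by
  one each. The cycles in that inequality cannot be read off as face boundaries, since a face of a
  disconnected or separable plane graph need not be bounded by a cycle. Each bounded face is
  therefore written as a sum modulo 2 of insides of cycles. The corresponding edge sets, decomposed
  into cycles, generate all even edge sets, and comparing \<open>2 ^ n\<close> with the number of
  even sets bounds the number \<open>n\<close> of cycles from below, without Euler's formula. The
  intervals of distances cannot contain everything that is colourable: between two equal sets a path
  of length 2 can be coloured, but one of length \<open>k - 2\<close> cannot, since the graph of
  disjoint \<open>t\<close>-subsets has no closed walk of odd length below \<open>k\<close>.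
  Deleting the longer path of a \<open>k\<close>-cycle would then fail.\<close>

text \<open>
  Let $|A \setminus B| = m$ for $t$-subsets of a $(2t + 1)$-set. For $m$ at the upper end (even $l$) or
  at the lower end (odd $l$) of the interval below, a path of length $l \le 2t + 1$ can be coloured
  such that its edges miss pairwise different colours, as on a $(2t + 1)$-cycle; for $l \le t$ this
  is the only admitted value, and for $l \ge 2t$ all values $m \le t$ are admitted.
\<close>

definition dist_ok :: "nat \<Rightarrow> nat \<Rightarrow> nat \<Rightarrow> bool" where
  "dist_ok t l m \<longleftrightarrow> (if even l then min (l div 2) (t - l div 2) \<le> m \<and> m \<le> l div 2
     else t - l div 2 \<le> m \<and> m \<le> max (t - l div 2) (l div 2 + 1))"

lemma dist_ok_even [simp]: "dist_ok t (2 * s) m \<longleftrightarrow> min s (t - s) \<le> m \<and> m \<le> s"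
  by (simp add: dist_ok_def)

lemma dist_ok_odd [simp]: "dist_ok t (Suc (2 * s)) m \<longleftrightarrow> t - s \<le> m \<and> m \<le> max (t - s) (s + 1)"
  by (simp add: dist_ok_def)

text \<open>\<open>m1\<close> is the least value in its interval that leaves room for a partner in
  the second one, and \<open>m2\<close> is the least partner, which keeps the perimeter small. The
  bound on the perimeter reflects that for \<open>t\<close>-sets \<open>A\<close>, \<open>B\<close>,
  \<open>Y\<close> a colour lies in at most one of \<open>A - B\<close>, \<open>B - Y\<close>,
  \<open>Y - A\<close>.\<close>

lemma triangle_from_intervals:
  fixes m a1 b1 a2 b2 t :: nat
  assumes "m \<le> t" "a1 \<le> b1" "b1 \<le> t" "a2 \<le> b2" "b2 \<le> t"
    and "m \<le> b1 + b2" "a1 \<le> m + b2" "a2 \<le> m + b1" "m + a1 + a2 \<le> 2 * t + 1"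
  shows "\<exists>m1 m2. a1 \<le> m1 \<and> m1 \<le> b1 \<and> a2 \<le> m2 \<and> m2 \<le> b2 \<and>
    m \<le> m1 + m2 \<and> m1 \<le> m + m2 \<and> m2 \<le> m + m1 \<and> m + m1 + m2 \<le> 2 * t + 1"
proof -
  define m1 where "m1 = max a1 (max (m - b2) (a2 - m))"
  define m2 where "m2 = max a2 (max (m - m1) (m1 - m))"
  have "m1 \<le> b1" "m1 \<le> m + b2" "m1 + m + a2 \<le> 2 * t + 1" "m1 \<le> t"
    using assms unfolding m1_def by linarith+
  moreover have "a1 \<le> m1" "m \<le> m1 + b2" "a2 \<le> m1 + m"
    unfolding m1_def by linarith+
  moreover from calculation have "m2 \<le> b2" "m2 \<le> m + m1" "m + m1 + m2 \<le> 2 * t + 1"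
    using assms unfolding m2_def by linarith+
  moreover have "a2 \<le> m2" "m \<le> m1 + m2" "m1 \<le> m + m2"
    unfolding m2_def by linarith+
  ultimately show ?thesis by blast
qed

lemma dist_ok_split:
  assumes "dist_ok t (l1 + l2) m" "m \<le> t"
  shows "\<exists>m1 m2. dist_ok t l1 m1 \<and> dist_ok t l2 m2 \<and> m1 \<le> t \<and> m2 \<le> t \<and>
    m \<le> m1 + m2 \<and> m1 \<le> m + m2 \<and> m2 \<le> m + m1 \<and> m + m1 + m2 \<le> 2 * t + 1"
proof -
  \<comment> \<open>The intervals of long paths reach beyond \<open>t\<close> while distances do
    not, so the upper ends are cut at \<open>t\<close>. The four parity cases below only compute
    interval ends.\<close>
  have split: ?thesis
    if iv: "dist_ok t l1 = (\<lambda>m. a1 \<le> m \<and> m \<le> b1)" "dist_ok t l2 = (\<lambda>m. a2 \<le> m \<and> m \<le> b2)"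
      "a1 \<le> min t b1" "a2 \<le> min t b2" "m \<le> min t b1 + min t b2"
      "a1 \<le> m + min t b2" "a2 \<le> m + min t b1" "m + a1 + a2 \<le> 2 * t + 1" for a1 b1 a2 b2
  proof -
    obtain m1 m2 where "a1 \<le> m1" "m1 \<le> min t b1" "a2 \<le> m2" "m2 \<le> min t b2"
      "m \<le> m1 + m2 \<and> m1 \<le> m + m2 \<and> m2 \<le> m + m1 \<and> m + m1 + m2 \<le> 2 * t + 1"
      using triangle_from_intervals[OF assms(2) iv(3) _ iv(4) _ iv(5-8)] by auto
    then show ?thesis unfolding iv(1,2) by (rule_tac exI[of _ m1], rule_tac exI[of _ m2]) simp
  qed
  consider s1 s2 where "l1 = 2 * s1" "l2 = 2 * s2" | s1 s2 where "l1 = 2 * s1" "l2 = Suc (2 * s2)"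
    | s1 s2 where "l1 = Suc (2 * s1)" "l2 = 2 * s2" | s1 s2 where "l1 = Suc (2 * s1)" "l2 = Suc (2 * s2)"
    by (metis oddE evenE Suc_eq_plus1)
  then show ?thesis
  proof cases
    case 1
    then have "dist_ok t (2 * (s1 + s2)) m" using assms by simp
    then have m: "min (s1 + s2) (t - (s1 + s2)) \<le> m" "m \<le> s1 + s2" by (simp_all only: dist_ok_even)
    show ?thesis
      by (rule split[of "min s1 (t - s1)" s1 "min s2 (t - s2)" s2])
        ((subst 1, simp add: fun_eq_iff), (subst 1, simp add: fun_eq_iff), (use m assms(2) in linarith)+)
  next
    case 2
    then have "dist_ok t (Suc (2 * (s1 + s2))) m" using assms by simp
    then have m: "t - (s1 + s2) \<le> m" "m \<le> max (t - (s1 + s2)) (s1 + s2 + 1)" by (simp_all only: dist_ok_odd)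
    show ?thesis
      by (rule split[of "min s1 (t - s1)" s1 "t - s2" "max (t - s2) (s2 + 1)"])
        ((subst 2, simp add: fun_eq_iff), (subst 2, simp add: fun_eq_iff), (use m assms(2) in linarith)+)
  next
    case 3
    then have "dist_ok t (Suc (2 * (s1 + s2))) m" using assms by simp
    then have m: "t - (s1 + s2) \<le> m" "m \<le> max (t - (s1 + s2)) (s1 + s2 + 1)" by (simp_all only: dist_ok_odd)
    show ?thesis
      by (rule split[of "t - s1" "max (t - s1) (s1 + 1)" "min s2 (t - s2)" s2])
        ((subst 3, simp add: fun_eq_iff), (subst 3, simp add: fun_eq_iff), (use m assms(2) in linarith)+)
  next
    case 4
    then have "dist_ok t (2 * (s1 + s2 + 1)) m" using assms by simp
    then have m: "min (s1 + s2 + 1) (t - (s1 + s2 + 1)) \<le> m" "m \<le> s1 + s2 + 1" by (simp_all only: dist_ok_even)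
    show ?thesis
      by (rule split[of "t - s1" "max (t - s1) (s1 + 1)" "t - s2" "max (t - s2) (s2 + 1)"])
        ((subst 4, simp add: fun_eq_iff), (subst 4, simp add: fun_eq_iff), (use m assms(2) in linarith)+)
  qed
qed

text \<open>A Venn diagram in numbers: \<open>x\<close> is the number of common colours of
  \<open>A\<close> and \<open>B\<close>, and \<open>p\<close>, \<open>q\<close>, \<open>r\<close>,
  \<open>w\<close> count the colours of the new set in both, in \<open>A\<close> only, in
  \<open>B\<close> only and in neither. All are determined by \<open>p\<close>, which is taken least
  subject to \<open>q \<le> t - x\<close>, \<open>r \<le> t - x\<close> and
  \<open>0 \<le> w\<close>; the hypotheses keep it below the other bounds.\<close>

lemma obtain_parts:
  fixes m1 m2 t x :: nat
  assumes "m1 \<le> t" "m2 \<le> t" "x \<le> t" "t \<le> x + m1 + m2" "m1 + x \<le> t + m2" "m2 + x \<le> t + m1" "m1 + m2 \<le> t + x + 1"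
  shows "\<exists>p q r w. p \<le> x \<and> q \<le> t - x \<and> r \<le> t - x \<and> w \<le> x + 1 \<and> p + q + r + w = t \<and>
    p + q + m1 = t \<and> p + r + m2 = t"
proof -
  define y1 y2 where "y1 = t - m1" and "y2 = t - m2"
  define p where "p = max (y1 + y2 - t) (max (x + y1 - t) (x + y2 - t))"
  have y: "y1 + m1 = t" "y2 + m2 = t" using assms by (simp_all add: y1_def y2_def)
  then have "p \<le> x" "p \<le> y1" "p \<le> y2" "p + t \<le> x + 1 + y1 + y2"
    using assms unfolding p_def by linarith+
  moreover have "y1 + y2 \<le> t + p" "x + y1 \<le> t + p" "x + y2 \<le> t + p"
    unfolding p_def by linarith+
  ultimately show ?thesis
    using y assms(3)
    by (rule_tac exI[of _ p], rule_tac exI[of _ "y1 - p"], rule_tac exI[of _ "y2 - p"], rule_tac exI[of _ "t + p - y1 - y2"])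
      (simp, linarith)
qed

text \<open>The triangle inequalities and the bound on the perimeter are the only obstructions to a
  third \<open>t\<close>-set. With \<open>B = A\<close> and \<open>m1 = m2\<close> this also yields
  a set at a prescribed distance from \<open>A\<close> alone.\<close>

lemma obtain_at_distances:
  fixes A B :: "'a set"
  assumes fin: "finite S" and S: "card S = 2 * t + 1" and A: "A \<subseteq> S" "card A = t" and B: "B \<subseteq> S" "card B = t"
    and m: "m1 \<le> t" "m2 \<le> t" "card (A - B) \<le> m1 + m2" "m1 \<le> card (A - B) + m2" "m2 \<le> card (A - B) + m1"
      "card (A - B) + m1 + m2 \<le> 2 * t + 1"
  shows "\<exists>Y \<subseteq> S. card Y = t \<and> card (A - Y) = m1 \<and> card (Y - B) = m2"
proof -
  define x where "x = card (A \<inter> B)"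
  have finA: "finite A" "finite B" using finite_subset[OF A(1) fin] finite_subset[OF B(1) fin] by simp_all
  have cAB: "card (A - B) = t - x" and xt: "x \<le> t"
    using A finA card_mono[of A "A \<inter> B"] by (simp_all add: x_def card_Diff_subset_Int)
  have cBA: "card (B - A) = t - x" using B finA by (simp add: x_def card_Diff_subset_Int Int_commute)
  have cN: "card (S - (A \<union> B)) = x + 1"
  proof -
    have "card (A \<union> B) = t + (t - x)"
      using card_Un_disjoint[of A "B - A"] finA cBA A by auto
    then show ?thesis using fin A B S xt by (simp add: card_Diff_subset finA)
  qed
  have arith: "m1 \<le> t" "m2 \<le> t" "x \<le> t" "t \<le> x + m1 + m2" "m1 + x \<le> t + m2" "m2 + x \<le> t + m1" "m1 + m2 \<le> t + x + 1"
    using m xt unfolding cAB by linarith+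
  obtain p q r w where p: "p \<le> x" "q \<le> t - x" "r \<le> t - x" "w \<le> x + 1" "p + q + r + w = t"
      "p + q + m1 = t" "p + r + m2 = t"
    using obtain_parts[of m1 t m2 x] arith by blast
  obtain P where P: "P \<subseteq> A \<inter> B" "card P = p" using p(1) unfolding x_def by (rule obtain_subset_with_card_n)
  obtain Q where Q: "Q \<subseteq> A - B" "card Q = q" using p(2) unfolding cAB[symmetric] by (rule obtain_subset_with_card_n)
  obtain R where R: "R \<subseteq> B - A" "card R = r" using p(3) unfolding cBA[symmetric] by (rule obtain_subset_with_card_n)
  obtain W where W: "W \<subseteq> S - (A \<union> B)" "card W = w" using p(4) unfolding cN[symmetric] by (rule obtain_subset_with_card_n)
  have fs: "finite P" "finite Q" "finite R" "finite W" 
    using finite_subset[OF P(1)] finite_subset[OF Q(1)] finite_subset[OF R(1)] finite_subset[OF W(1)] finA fin by simp_all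
  define Y where "Y = P \<union> Q \<union> R \<union> W"
  have "P \<inter> Q = {}" "(P \<union> Q) \<inter> R = {}" "(P \<union> Q \<union> R) \<inter> W = {}"
    using P Q R W by auto
  then have cY: "card Y = t" using fs p(5) P(2) Q(2) R(2) W(2) by (simp add: Y_def card_Un_disjoint)
  have "A \<inter> Y = P \<union> Q" "B \<inter> Y = P \<union> R" using P Q R W by (auto simp: Y_def)
  moreover have "P \<inter> Q = {}" "P \<inter> R = {}" using P Q R by auto
  ultimately have "card (A \<inter> Y) = p + q" "card (B \<inter> Y) = p + r" using fs P(2) Q(2) R(2) by (simp_all add: card_Un_disjoint)
  moreover have "finite Y" using fs by (simp add: Y_def)
  ultimately have "card (A - Y) = t - (p + q)" "card (Y - B) = t - (p + r)"
    using A B finA cY by (simp_all add: card_Diff_subset_Int Int_commute)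
  moreover have "p + q = t - m1" "p + r = t - m2" using p(6,7) by simp_all
  moreover have "Y \<subseteq> S" using P(1) Q(1) R(1) W(1) A(1) B(1) by (auto simp: Y_def)
  ultimately show ?thesis using m(1,2) cY by (intro exI[of _ Y]) simp
qed


lemma dist_ok_exists: "\<exists>m \<le> t. dist_ok t l m"
proof (cases "even l")
  case True
  then obtain s where "l = 2 * s" by (elim evenE)
  then show ?thesis by (intro exI[of _ "min s t"]) auto
next
  case False
  then obtain s where "l = Suc (2 * s)" by (metis oddE Suc_eq_plus1)
  then show ?thesis by (intro exI[of _ "t - s"]) auto
qed

lemma dist_ok_long:
  assumes "2 * t \<le> l" "m \<le> t"
  shows "dist_ok t l m"
  using assms by (auto simp: dist_ok_def)

text \<open>This range is invariant under exchanging \<open>m\<close> and \<open>t - m\<close> and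
  ignores the parity of \<open>l\<close>. It only asks for \<open>t - l div 2\<close> colours in
  which the sets differ and as many that they share, which a permutation of the colours can arrange
  for several sets at once.\<close>

lemma dist_ok_central:
  assumes "t - l div 2 \<le> m" "m + (t - l div 2) \<le> t"
  shows "dist_ok t l m"
  using assms by (auto simp: dist_ok_def)

text \<open>A length \<open>h \<le> t\<close> admits a single distance, the one its ends have on a
  \<open>(2 * t + 1)\<close>-cycle whose edges miss distinct colours. The rest of that cycle joins
  the same ends, so its length admits this distance too.\<close>

lemma dist_ok_complement:
  assumes "h \<le> t" "dist_ok t h m" "m \<le> t"
  shows "dist_ok t (2 * t + 1 - h) m"
proof (cases "even h")
  case True
  then obtain s where s: "h = 2 * s" by (elim evenE)
  then have "2 * t + 1 - h = Suc (2 * (t - s))" using assms by simp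
  then show ?thesis using assms s by (simp, linarith)
next
  case False
  then obtain s where s: "h = Suc (2 * s)" by (metis oddE Suc_eq_plus1)
  then have "2 * t + 1 - h = 2 * (t - s)" using assms by simp
  then show ?thesis using assms s by (simp, linarith)
qed

lemma card_Diff_commute:
  assumes "finite A" "finite B" "card A = card B"
  shows "card (A - B) = card (B - A)"
  using assms by (simp add: card_Diff_subset_Int Int_commute)

lemma link_split:
  assumes "finite S" "card S = 2 * t + 1" "A \<subseteq> S" "card A = t" "B \<subseteq> S" "card B = t"
    and "dist_ok t (l1 + l2) (card (A - B))"
  shows "\<exists>Y \<subseteq> S. card Y = t \<and> dist_ok t l1 (card (A - Y)) \<and> dist_ok t l2 (card (Y - B))"
proof -
  have "card (A - B) \<le> t"
    using assms by (metis card_mono finite_subset Diff_subset)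
  from dist_ok_split[OF assms(7) this] obtain m1 m2
    where "dist_ok t l1 m1" "dist_ok t l2 m2" "m1 \<le> t" "m2 \<le> t"
    "card (A - B) \<le> m1 + m2" "m1 \<le> card (A - B) + m2" "m2 \<le> card (A - B) + m1" "card (A - B) + m1 + m2 \<le> 2 * t + 1" by blast
  then show ?thesis
    using obtain_at_distances[OF assms(1-6)] by metis
qed

lemma link_exists:
  assumes "finite S" "card S = 2 * t + 1" "A \<subseteq> S" "card A = t"
  shows "\<exists>Y \<subseteq> S. card Y = t \<and> dist_ok t l (card (A - Y))"
proof -
  obtain m where "m \<le> t" "dist_ok t l m" using dist_ok_exists by blast
  then show ?thesis
    using obtain_at_distances[OF assms(1-4) assms(3,4), of m m] by auto
qed

section \<open>Moving a coloured triangle into position by a permutation of the colours\<close>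

lemma disjoint_subfamily:
  assumes "finite I" "\<And>i. i \<in> I \<Longrightarrow> finite (B i)" "\<And>i. i \<in> I \<Longrightarrow> sum n I \<le> card (B i)"
  shows "\<exists>R. (\<forall>i\<in>I. R i \<subseteq> B i \<and> card (R i) = n i) \<and> disjoint_family_on R I"
  using assms
proof (induction I rule: finite_induct)
  case empty
  then show ?case by (auto simp: disjoint_family_on_def)
next
  case (insert x I)
  have "sum n I \<le> card (B i)" if "i \<in> I" for i
    using insert.prems(2)[of i] insert.hyps that by simp
  then obtain R where R: "\<forall>i\<in>I. R i \<subseteq> B i \<and> card (R i) = n i" "disjoint_family_on R I"
    using insert.IH insert.prems(1) by auto
  define U where "U = (\<Union>i\<in>I. R i)"
  have "finite U" using R insert.prems insert.hyps by (auto simp: U_def intro: finite_subset)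
  moreover have "card U \<le> sum n I"
    using card_UN_le[OF insert.hyps(1), of R] R by (simp add: U_def)
  \<comment> \<open>Greedy choice: each set has room for the demands of all indices together, so
    what the others have used never exhausts it.\<close>
  ultimately have "n x \<le> card (B x - U)"
    using insert.prems(2)[of x] insert.hyps diff_card_le_card_Diff[of U "B x"] by simp
  then obtain T where T: "T \<subseteq> B x - U" "card T = n x"
    using obtain_subset_with_card_n by metis
  show ?case
    by (rule exI[of _ "R(x := T)"]) (use R T insert.hyps in \<open>auto simp: disjoint_family_on_def U_def\<close>)
qed

lemma extend_bij:
  assumes "finite S" "disjoint_family_on Q I" "disjoint_family_on T I"
    and "\<And>i. i \<in> I \<Longrightarrow> Q i \<subseteq> S" "\<And>i. i \<in> I \<Longrightarrow> T i \<subseteq> S" "\<And>i. i \<in> I \<Longrightarrow> card (Q i) = card (T i)" "finite I"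
  shows "\<exists>f. bij_betw f S S \<and> (\<forall>i\<in>I. f ` Q i = T i)"
proof -
  have "\<exists>g. bij_betw g (Q i) (T i)" if "i \<in> I" for i
    using assms(4-6)[OF that] finite_subset[OF _ assms(1)] by (intro finite_same_card_bij) auto
  then obtain g where g: "\<And>i. i \<in> I \<Longrightarrow> bij_betw (g i) (Q i) (T i)" by metis
  define Q' T' where "Q' = (\<Union>i\<in>I. Q i)" and "T' = (\<Union>i\<in>I. T i)"
  define h where "h x = g (THE i. i \<in> I \<and> x \<in> Q i) x" for x
  have h: "h x = g i x" if "i \<in> I" "x \<in> Q i" for i x
  proof -
    have "(THE i. i \<in> I \<and> x \<in> Q i) = i"
      using that assms(2) by (intro the_equality) (auto simp: disjoint_family_on_def)
    then show ?thesis by (simp add: h_def)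
  qed
  have hb: "bij_betw h (Q i) (T i)" if "i \<in> I" for i
    using g[OF that] h[OF that] bij_betw_cong[of "Q i" h "g i" "T i"] by simp
  have hQ: "bij_betw h Q' T'"
    unfolding Q'_def T'_def using assms(3) hb by (rule bij_betw_UNION_disjoint)
  have sub: "Q' \<subseteq> S" "T' \<subseteq> S" using assms by (auto simp: Q'_def T'_def)
  have "card (S - Q') = card (S - T')"
    using sub assms(1) bij_betw_same_card[OF hQ] by (simp add: card_Diff_subset finite_subset)
  then obtain h2 where h2: "bij_betw h2 (S - Q') (S - T')"
    using assms(1) finite_same_card_bij[of "S - Q'" "S - T'"] by auto
  define f where "f x = (if x \<in> Q' then h x else h2 x)" for x
  have "bij_betw f Q' T'" using hQ bij_betw_cong[of Q' f h] by (simp add: f_def)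
  moreover have "bij_betw f (S - Q') (S - T')" using h2 bij_betw_cong[of "S - Q'" f h2] by (simp add: f_def)
  ultimately have "bij_betw f (Q' \<union> (S - Q')) (T' \<union> (S - T'))"
    by (rule bij_betw_combine) auto
  moreover have "Q' \<union> (S - Q') = S" "T' \<union> (S - T') = S" using sub by auto
  ultimately have "bij_betw f S S" by simp
  moreover have "f ` Q i = T i" if "i \<in> I" for i
  proof -
    have "f ` Q i = h ` Q i" using that by (intro image_cong) (auto simp: f_def Q'_def)
    then show ?thesis using hb[OF that] by (simp add: bij_betw_def)
  qed
  ultimately show ?thesis by blast
qed

text \<open>For each \<open>i\<close> reserve \<open>r i\<close> colours inside \<open>A i\<close>
  and \<open>r i\<close> outside, mark \<open>2 * r i\<close> colours of \<open>P i\<close>, and let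
  the permutation carry marked colours to reserved ones. The choices can be made disjoint because
  they number at most \<open>t\<close> in total, while \<open>A i\<close>, its complement and
  \<open>P i\<close> have at least \<open>t\<close> elements each.\<close>

lemma permute_into_position:
  fixes A P :: "nat \<Rightarrow> 'a set"
  assumes S: "finite S" "card S = 2 * t + 1"
    and A: "\<And>i. i < n \<Longrightarrow> A i \<subseteq> S \<and> card (A i) = t" and P: "\<And>i. i < n \<Longrightarrow> P i \<subseteq> S \<and> card (P i) = t"
    and r: "(\<Sum>i<n. 2 * r i) \<le> t"
  shows "\<exists>f. bij_betw f S S \<and> (\<forall>i<n. r i \<le> card (A i \<inter> f ` P i) \<and> r i \<le> card (f ` P i - A i))"
proof -
  define I where "I = {..<n} \<times> (UNIV :: bool set)"
  define n' where "n' = (\<lambda>(i, b :: bool). r i)"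
  define B where "B = (\<lambda>(i, b). if b then A i else S - A i)"
  have sumI: "sum n' I = (\<Sum>i<n. 2 * r i)"
    by (simp add: I_def n'_def sum.cartesian_product[symmetric] UNIV_bool mult_2)
  have finA: "finite (A i)" if "i < n" for i using finite_subset[OF conjunct1[OF A[OF that]] S(1)] .
  have cB: "sum n' I \<le> card (B j)" "finite (B j)" if "j \<in> I" for j
    using that A S r finA unfolding sumI by (auto simp: B_def I_def card_Diff_subset)
  have finI: "finite I" by (simp add: I_def)
  obtain R where R: "\<forall>j\<in>I. R j \<subseteq> B j \<and> card (R j) = n' j" "disjoint_family_on R I"
    using disjoint_subfamily[of I B n', OF finI cB(2) cB(1)] by blast
  have cP: "sum n' I \<le> card (P (fst j))" "finite (P (fst j))" if "j \<in> I" for j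
    using that P S r finite_subset[OF conjunct1[OF P] S(1)] unfolding sumI by (auto simp: I_def)
  obtain Q where Q: "\<forall>j\<in>I. Q j \<subseteq> P (fst j) \<and> card (Q j) = n' j" "disjoint_family_on Q I"
    using disjoint_subfamily[of I "\<lambda>j. P (fst j)" n', OF finI cP(2) cP(1)] by blast
  have "\<exists>f. bij_betw f S S \<and> (\<forall>j\<in>I. f ` Q j = R j)"
  proof (rule extend_bij[OF S(1) Q(2) R(2) _ _ _ finI])
    show "Q j \<subseteq> S" if "j \<in> I" for j using Q P that by (fastforce simp: I_def)
    show "R j \<subseteq> S" if "j \<in> I" for j using R A that by (fastforce simp: I_def B_def split: if_splits)
    show "card (Q j) = card (R j)" if "j \<in> I" for j using that Q R by auto
  qed
  then obtain f where f: "bij_betw f S S" "\<And>j. j \<in> I \<Longrightarrow> f ` Q j = R j" by blast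
  have "r i \<le> card (A i \<inter> f ` P i) \<and> r i \<le> card (f ` P i - A i)" if "i < n" for i
  proof -
    have j: "(i, True) \<in> I" "(i, False) \<in> I" using that by (auto simp: I_def)
    have fP: "finite (f ` P i)" using cP(2)[OF j(1)] by simp
    have "R (i, b) \<subseteq> f ` P i" for b
      using f(2)[of "(i, b)"] Q(1) j by (cases b) force+
    moreover have "R (i, True) \<subseteq> A i" "R (i, False) \<subseteq> S - A i"
      using R(1) j by (force simp: B_def)+
    ultimately have "R (i, True) \<subseteq> A i \<inter> f ` P i" "R (i, False) \<subseteq> f ` P i - A i" by auto
    moreover have "card (R (i, b)) = r i" for b
      using R(1) j by (cases b) (auto simp: n'_def)
    ultimately show ?thesis using fP by (metis card_mono finite_Diff finite_Int)
  qed
  with f show ?thesis by blast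
qed

text \<open>\<open>d l\<close> is the distance spanned by \<open>l\<close> consecutive edges of a
  \<open>(2 * t + 1)\<close>-cycle with distinct missing colours. As \<open>x + y + z\<close> is
  odd, either one length is odd and its distance is the sum of the other two, or all are odd and the
  perimeter is exactly \<open>2 * t + 1\<close>.\<close>

lemma triangle_positions:
  assumes S: "finite S" "card S = 2 * t + 1" and xyz: "x + y + z = 2 * t + 1"
  shows "\<exists>P. (\<forall>i<3. P i \<subseteq> S \<and> card (P i) = t) \<and> dist_ok t x (card (P 0 - P 1)) \<and>
    dist_ok t y (card (P 1 - P 2)) \<and> dist_ok t z (card (P 2 - P (0::nat)))"
proof -
  define d where "d l = (if even l then l div 2 else t - l div 2)" for l
  have dok: "dist_ok t l (d l)" if "l \<le> 2 * t + 1" for l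
    using that by (cases "even l"; elim evenE oddE) (simp_all add: d_def)
  have d: "d x \<le> t" "d y \<le> t" "d z \<le> t" "d x \<le> d y + d z" "d y \<le> d x + d z" "d z \<le> d x + d y" "d x + d y + d z \<le> 2 * t + 1"
  proof -
    have d2: "2 * d l = (if even l then l else 2 * t + 1 - l)" if "l \<le> 2 * t + 1" for l
      using that by (cases "even l"; elim evenE oddE) (simp_all add: d_def)
    have "even z \<longleftrightarrow> even x \<noteq> even y"
      using arg_cong[OF xyz, of even] by simp
    then show "d x \<le> t" "d y \<le> t" "d z \<le> t" "d x \<le> d y + d z" "d y \<le> d x + d z" "d z \<le> d x + d y" "d x + d y + d z \<le> 2 * t + 1"
      using xyz d2[of x] d2[of y] d2[of z] by (auto split: if_splits)
  qed
  obtain P0 where P0: "P0 \<subseteq> S" "card P0 = t" using S obtain_subset_with_card_n[of t S] by auto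
  obtain P2 where P2: "P2 \<subseteq> S" "card P2 = t" "card (P0 - P2) = d z"
    using obtain_at_distances[OF S P0 P0, of "d z" "d z"] d by auto
  obtain P1 where P1: "P1 \<subseteq> S" "card P1 = t" "card (P0 - P1) = d x" "card (P1 - P2) = d y"
    using obtain_at_distances[OF S P0 P2(1,2), of "d x" "d y"] d P2(3) by auto
  have "card (P2 - P0) = d z" using P2 P0 S by (metis card_Diff_commute finite_subset)
  then show ?thesis using P0 P1 P2 dok xyz
    by (intro exI[of _ "\<lambda>i. if i = 0 then P0 else if i = 1 then P1 else P2"]) auto
qed

text \<open>A permutation of the colours keeps the distances between the three positions, so it can
  be spent on the distances to the outer sets \<open>A i\<close>. The condition on \<open>l\<close>
  is the room that \<open>permute_into_position\<close> asks for.\<close>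

lemma triangle_extend:
  fixes A :: "nat \<Rightarrow> 'a set"
  assumes S: "finite S" "card S = 2 * t + 1" and xyz: "x + y + z = 2 * t + 1"
    and A: "\<And>i. i < 3 \<Longrightarrow> A i \<subseteq> S \<and> card (A i) = t"
    and l: "(\<Sum>i<3. 2 * (t - l i div 2)) \<le> t"
  shows "\<exists>Y. (\<forall>i<3. Y i \<subseteq> S \<and> card (Y i) = t \<and> dist_ok t (l i) (card (A i - Y i))) \<and>
    dist_ok t x (card (Y 0 - Y 1)) \<and> dist_ok t y (card (Y 1 - Y 2)) \<and> dist_ok t z (card (Y 2 - Y (0::nat)))"
proof -
  obtain P :: "nat \<Rightarrow> 'a set" where P: "\<And>i. i < 3 \<Longrightarrow> P i \<subseteq> S \<and> card (P i) = t" "dist_ok t x (card (P 0 - P 1))"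
    "dist_ok t y (card (P 1 - P 2))" "dist_ok t z (card (P 2 - P 0))"
    using triangle_positions[OF S xyz] by blast
  obtain f where f: "bij_betw f S S"
    "\<And>i. i < 3 \<Longrightarrow> t - l i div 2 \<le> card (A i \<inter> f ` P i) \<and> t - l i div 2 \<le> card (f ` P i - A i)"
    using permute_into_position[of S t 3 A P "\<lambda>i. t - l i div 2"] S A P(1) l by blast
  have inj: "inj_on f S" using f by (simp add: bij_betw_def)
  have dist: "card (f ` P i - f ` P j) = card (P i - P j)" if "i < 3" "j < 3" for i j
    using inj_on_image_set_diff[OF inj, of "P i" "P j"] P(1)[OF that(1)] P(1)[OF that(2)]
    by (metis Diff_subset card_image inj inj_on_subset subset_trans)
  have Y: "f ` P i \<subseteq> S \<and> card (f ` P i) = t" if "i < 3" for i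
    using P(1)[OF that] f(1) inj by (metis bij_betw_def card_image image_mono inj_on_subset)
  have "dist_ok t (l i) (card (A i - f ` P i))" if i: "i < 3" for i
  proof (rule dist_ok_central)
    have fin: "finite (A i)" "finite (f ` P i)" using finite_subset[OF conjunct1[OF A[OF i]] S(1)] finite_subset[OF conjunct1[OF Y[OF i]] S(1)] by simp_all
    have "card (A i - f ` P i) = card (f ` P i - A i)"
      using card_Diff_commute fin A[OF i] Y[OF i] by metis
    then show "t - l i div 2 \<le> card (A i - f ` P i)" using f(2)[OF i] by simp
    have "card (A i - f ` P i) + card (A i \<inter> f ` P i) = t"
      using A[OF i] fin card_Int_Diff[of "A i" "f ` P i"] by simp
    then show "card (A i - f ` P i) + (t - l i div 2) \<le> t" using f(2)[OF i] by simp
  qed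
  then show ?thesis using Y dist P
    by (intro exI[of _ "\<lambda>i. f ` P i"]) auto
qed

section \<open>Sparse networks\<close>

definition incid :: "('e \<Rightarrow> 'a \<times> 'a) \<Rightarrow> 'e \<Rightarrow> 'a \<Rightarrow> nat" where
  "incid ep e w = of_bool (fst (ep e) = w) + of_bool (snd (ep e) = w)"

definition degree_in :: "('e \<Rightarrow> 'a \<times> 'a) \<Rightarrow> 'e set \<Rightarrow> 'a \<Rightarrow> nat" where
  "degree_in ep K w = (\<Sum>e\<in>K. incid ep e w)"

definition joins :: "('e \<Rightarrow> 'a \<times> 'a) \<Rightarrow> 'e \<Rightarrow> 'a \<Rightarrow> 'a \<Rightarrow> bool" where
  "joins ep e a b \<longleftrightarrow> ep e = (a, b) \<or> ep e = (b, a)"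

lemma incid_joins: "joins ep e a b \<Longrightarrow> incid ep e w = of_bool (a = w) + of_bool (b = w)"
  unfolding joins_def incid_def by (elim disjE) simp_all

lemma joins_incid: "incid ep e a \<noteq> 0 \<Longrightarrow> incid ep e b \<noteq> 0 \<Longrightarrow> a \<noteq> b \<Longrightarrow> joins ep e a b"
  unfolding joins_def incid_def prod_eq_iff by (auto split: if_splits)

lemma exists_other_end:
  assumes "incid ep e w = 1"
  shows "\<exists>u. joins ep e u w \<and> u \<noteq> w"
  using assms by (cases "fst (ep e) = w"; cases "snd (ep e) = w") (auto simp: joins_def incid_def prod_eq_iff)

text \<open>
  The edges of a network stand for paths of length \<open>L e\<close>. The set \<open>KK\<close> collects the cycles of
  total length \<open>k\<close>; once loops are excluded, 2-regularity determines the shape of those with at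
  most three edges, so connectedness need not be recorded.
\<close>

locale sparse_network =
  fixes k :: nat and V :: "'a set" and E :: "'e set" and ep :: "'e \<Rightarrow> 'a \<times> 'a" and L :: "'e \<Rightarrow> nat" and KK :: "'e set set"
  assumes finV: "finite V" and finE: "finite E" and ends: "\<And>e. e \<in> E \<Longrightarrow> fst (ep e) \<in> V \<and> snd (ep e) \<in> V"
    and KK_sub: "\<And>K. K \<in> KK \<Longrightarrow> K \<subseteq> E" and KK_ne: "\<And>K. K \<in> KK \<Longrightarrow> K \<noteq> {}"
    and KK_sum: "\<And>K. K \<in> KK \<Longrightarrow> sum L K = k" and KK_deg: "\<And>K w. K \<in> KK \<Longrightarrow> degree_in ep K w \<in> {0, 2}"
    and KK_disj: "\<And>K K'. K \<in> KK \<Longrightarrow> K' \<in> KK \<Longrightarrow> K \<noteq> K' \<Longrightarrow> K \<inter> K' = {}"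
    and density: "\<And>S U. S \<subseteq> E \<Longrightarrow> U \<subseteq> V \<Longrightarrow> U \<noteq> {} \<Longrightarrow> (\<And>e. e \<in> S \<Longrightarrow> fst (ep e) \<in> U \<and> snd (ep e) \<in> U) \<Longrightarrow>
      22 * k * (card S + 1) \<le> 22 * k * card U + 6 * sum L S + 19 * k * card {K \<in> KK. K \<subseteq> S}"
begin

lemma subnetwork:
  assumes "V' \<subseteq> V" "E' \<subseteq> E" "\<And>e. e \<in> E' \<Longrightarrow> fst (ep e) \<in> V' \<and> snd (ep e) \<in> V'"
  shows "sparse_network k V' E' ep L {K \<in> KK. K \<subseteq> E'}"
proof
  show "22 * k * (card S + 1) \<le> 22 * k * card U + 6 * sum L S + 19 * k * card {K \<in> {K \<in> KK. K \<subseteq> E'}. K \<subseteq> S}"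
    if "S \<subseteq> E'" "U \<subseteq> V'" "U \<noteq> {}" "\<And>e. e \<in> S \<Longrightarrow> fst (ep e) \<in> U \<and> snd (ep e) \<in> U" for S U
  proof -
    have "{K \<in> {K \<in> KK. K \<subseteq> E'}. K \<subseteq> S} = {K \<in> KK. K \<subseteq> S}" using that(1) by auto
    then show ?thesis using density[of S U] that assms by auto
  qed
qed (use assms finV finE KK_ne KK_sum KK_deg KK_disj in \<open>auto intro: finite_subset\<close>)

lemma finKK: "finite KK"
  using KK_sub finE by (meson finite_Pow_iff finite_subset PowI subsetI)

lemma finK: "K \<in> KK \<Longrightarrow> finite K"
  using KK_sub finE finite_subset by blast

lemma no_loop:
  assumes "e \<in> E" "L e < k"
  shows "fst (ep e) \<noteq> snd (ep e)"
proof
  assume eq: "fst (ep e) = snd (ep e)"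
  \<comment> \<open>One edge on one vertex: as \<open>{e}\<close> contains no
    \<open>k\<close>-cycle, \<open>density\<close> would give
    \<open>22 * k \<le> 6 * L e\<close>.\<close>
  have "{K \<in> KK. K \<subseteq> {e}} = {}"
    using KK_ne KK_sum assms(2) by (force simp: subset_singleton_iff)
  with density[of "{e}" "{fst (ep e)}"] assms eq ends[OF assms(1)]
  show False by simp
qed

lemma sum_incid:
  assumes "e \<in> E"
  shows "(\<Sum>w\<in>V. incid ep e w) = 2"
  using ends[OF assms] finV by (simp add: incid_def sum.distrib of_bool_def)

lemma sum_weighted_incid:
  assumes "S \<subseteq> E"
  shows "(\<Sum>w\<in>V. \<Sum>e\<in>S. g e * incid ep e w) = 2 * (\<Sum>e\<in>S. g e)"
proof -
  have "(\<Sum>w\<in>V. \<Sum>e\<in>S. g e * incid ep e w) = (\<Sum>e\<in>S. \<Sum>w\<in>V. g e * incid ep e w)"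
    by (rule sum.swap)
  also have "\<dots> = (\<Sum>e\<in>S. g e * 2)"
    using assms sum_incid by (intro sum.cong) (auto simp: sum_distrib_left[symmetric])
  finally show ?thesis by (simp add: mult.commute flip: sum_distrib_right)
qed

lemma sum_degree_in:
  assumes "S \<subseteq> E"
  shows "(\<Sum>w\<in>V. degree_in ep S w) = 2 * card S"
  using sum_weighted_incid[OF assms, of "\<lambda>_. 1"] by (simp add: degree_in_def)

lemma card_cycle_vertices:
  assumes "K \<in> KK"
  shows "card {w \<in> V. degree_in ep K w = 2} = card K"
proof -
  have "2 * card K = (\<Sum>w\<in>V. degree_in ep K w)"
    using sum_degree_in[OF KK_sub[OF assms]] by simp
  also have "\<dots> = (\<Sum>w\<in>V. if degree_in ep K w = 2 then 2 else 0)"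
    using KK_deg[OF assms] by (intro sum.cong) fastforce+
  also have "\<dots> = 2 * card {w \<in> V. degree_in ep K w = 2}"
    using finV by (simp add: sum.If_cases Int_def)
  finally show ?thesis by simp
qed

lemma degree_in_Union:
  "degree_in ep E w = degree_in ep (E - \<Union>KK) w + 2 * card {K \<in> KK. degree_in ep K w = 2}"
proof -
  have U: "\<Union>KK \<subseteq> E" using KK_sub by auto
  have "degree_in ep E w = degree_in ep (E - \<Union>KK) w + degree_in ep (\<Union>KK) w"
    unfolding degree_in_def using sum.subset_diff[OF U finE] by simp
  moreover have "degree_in ep (\<Union>KK) w = (\<Sum>K\<in>KK. degree_in ep K w)"
    unfolding degree_in_def using finK KK_disj by (subst sum.Union_disjoint) auto
  moreover have "\<dots> = (\<Sum>K\<in>KK. if degree_in ep K w = 2 then 2 else 0)"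
    using KK_deg by (intro sum.cong) fastforce+
  moreover have "\<dots> = 2 * card {K \<in> KK. degree_in ep K w = 2}"
    using finKK by (simp add: sum.If_cases Int_def)
  ultimately show ?thesis by simp
qed

lemma degree_in_eq_0_iff:
  assumes "S \<subseteq> E"
  shows "degree_in ep S w = 0 \<longleftrightarrow> (\<forall>e\<in>S. fst (ep e) \<noteq> w \<and> snd (ep e) \<noteq> w)"
  using finite_subset[OF assms finE] by (auto simp: degree_in_def incid_def sum_eq_0_iff of_bool_def)

lemma cycle_ends:
  assumes "K \<in> KK" "e \<in> K"
  shows "degree_in ep K (fst (ep e)) = 2" "degree_in ep K (snd (ep e)) = 2"
  using degree_in_eq_0_iff[OF KK_sub[OF assms(1)]] assms(2) KK_deg[OF assms(1)] by blast+

abbreviation "outer w \<equiv> (\<Sum>e\<in>E - \<Union>KK. L e * incid ep e w)"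

text \<open>
  Discharging: the vertex \<open>w\<close> has the weight \<open>om w\<close>, and gives \<open>s w\<close> to each of the \<open>c w\<close> cycles
  through it, each of which needs \<open>25 * k\<close>.
\<close>

lemma exists_reducible_triangle:
  assumes ne: "V \<noteq> {}" and k: "k > 0" and L: "\<And>e. e \<in> E \<Longrightarrow> L e \<le> k" and deg: "\<And>w. w \<in> V \<Longrightarrow> 3 \<le> degree_in ep E w"
    and K3: "\<And>K. K \<in> KK \<Longrightarrow> 3 \<le> card K"
  shows "\<exists>K\<in>KK. card K = 3 \<and> (\<forall>w\<in>V. degree_in ep K w = 2 \<longrightarrow> degree_in ep E w = 3) \<and>
    8 * k < 3 * (\<Sum>w | w \<in> V \<and> degree_in ep K w = 2. outer w)"
proof (rule ccontr)
  assume "\<not> ?thesis"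
  then have nobad: "3 * (\<Sum>w | w \<in> V \<and> degree_in ep K w = 2. outer w) \<le> 8 * k"
    if "K \<in> KK" "card K = 3" "\<And>w. w \<in> V \<Longrightarrow> degree_in ep K w = 2 \<Longrightarrow> degree_in ep E w = 3" for K
    using that by (meson not_le)
  \<comment> \<open>At degree 3 with one cycle through \<open>w\<close> this is all of
    \<open>om w\<close>. There \<open>outer w\<close> is at most \<open>k\<close>, so every corner
    gives at least \<open>8 * k\<close>; four corners, or three of which one has larger degree, then
    give more than \<open>25 * k\<close>.\<close>
  define s where "s w = (if degree_in ep E w = 3 then 11 * int k - 3 * int (outer w) else 11 * int k)" for w
  \<comment> \<open>Every edge has two ends, so the sum over \<open>V\<close> is
    \<open>22 * k * (card E - card V)\<close> less six times the length outside the
    \<open>k\<close>-cycles. By \<open>density\<close> this is less than \<open>25 * k\<close> per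
    cycle: 19 from the last term of the inequality and 6 from the length \<open>k\<close> of the
    cycle itself.\<close>
  define om where "om w = 11 * int k * int (degree_in ep E w) - 22 * int k - 3 * int (outer w)" for w
  define c where "c w = card {K \<in> KK. degree_in ep K w = 2}" for w
  have outer_le: "outer w \<le> k * degree_in ep (E - \<Union>KK) w" for w
    unfolding degree_in_def sum_distrib_left using L by (intro sum_mono mult_right_mono) auto
  have omc: "int (c w) * s w \<le> om w" if w: "w \<in> V" for w
  proof -
    define D where "D = degree_in ep (E - \<Union>KK) w"
    have D: "degree_in ep E w = D + 2 * c w" using degree_in_Union by (simp add: D_def c_def)
    have oD: "int (outer w) \<le> int k * int D" using outer_le[of w] unfolding D_def of_nat_mult[symmetric] of_nat_le_iff .
    have "3 \<le> D + 2 * c w" using deg[OF w] D by simp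
    show ?thesis
    proof (cases "D + 2 * c w = 3")
      case True
      then consider (0) "c w = 0" | (1) "c w = 1" by linarith
      then show ?thesis
      proof cases
        case 0
        then have "D = 3" using True by simp
        then show ?thesis using oD 0 by (simp add: om_def s_def D)
      next
        case 1
        then have "D = 1" using True by simp
        then show ?thesis using oD 1 by (simp add: om_def s_def D)
      qed
    next
      case False
      then have "4 \<le> D + 2 * c w" using \<open>3 \<le> D + 2 * c w\<close> by simp
      moreover consider "c w = 0" | "c w = 1" | "2 \<le> c w" by linarith
      \<comment> \<open>What the claim becomes after \<open>outer w \<le> k * D\<close>. Equality
        holds at a vertex of degree 4 on two \<open>k\<close>-cycles.\<close>
      ultimately have "22 \<le> 8 * D + 11 * c w" by cases simp_all
      then have "int k * 22 \<le> int k * (8 * int D + 11 * int (c w))" by (intro mult_left_mono) linarith+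
      then show ?thesis using oD False by (simp add: om_def s_def D algebra_simps)
    qed
  qed
  have s8: "8 * int k \<le> s w" if w: "w \<in> V" "K \<in> KK" "degree_in ep K w = 2" for w K
  proof (cases "degree_in ep E w = 3")
    case True
    have "c w \<noteq> 0" using that finKK by (auto simp: c_def card_eq_0_iff)
    then have "degree_in ep (E - \<Union>KK) w \<le> 1" using degree_in_Union[of w] True by (simp add: c_def)
    then have "outer w \<le> k" using outer_le[of w] by (metis mult.right_neutral mult_le_mono2 order_trans)
    then have "int (outer w) \<le> int k" by (simp only: of_nat_le_iff)
    then show ?thesis using True by (simp add: s_def)
  qed (simp add: s_def)
  have sK: "25 * int k \<le> (\<Sum>w | w \<in> V \<and> degree_in ep K w = 2. s w)" if K: "K \<in> KK" for K
  proof -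
    define W where "W = {w \<in> V. degree_in ep K w = 2}"
    have W: "finite W" "card W = card K" using finV card_cycle_vertices[OF K] by (auto simp: W_def)
    have s8W: "8 * int k \<le> s w" if "w \<in> W" for w using s8 K that by (auto simp: W_def)
    have "25 * int k \<le> sum s W"
    proof (cases "4 \<le> card K")
      case True
      have "32 * int k \<le> int (card W) * (8 * int k)" using True W mult_right_mono[of 4 "int (card K)" "8 * int k"] by simp
      also have "\<dots> \<le> sum s W" using sum_bounded_below[of W "8 * int k" s] s8W by simp
      finally show ?thesis by simp
    next
      case False
      then have c3: "card K = 3" using K3[OF K] by simp
      show ?thesis
      proof (cases "\<forall>w\<in>W. degree_in ep E w = 3")
        case True
        then have "sum s W = (\<Sum>w\<in>W. 11 * int k - 3 * int (outer w))" by (intro sum.cong) (auto simp: s_def)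
        \<comment> \<open>With three corners of degree 3, total outer length at most
          \<open>8 * k / 3\<close> leaves exactly \<open>25 * k\<close>; this is the origin of the
          threshold for reducibility.\<close>
        also have "\<dots> = 33 * int k - 3 * int (\<Sum>w\<in>W. outer w)" using W c3 by (simp add: sum_subtractf sum_distrib_left)
        finally have eq: "sum s W = 33 * int k - 3 * int (\<Sum>w\<in>W. outer w)" .
        have "3 * (\<Sum>w\<in>W. outer w) \<le> 8 * k" using nobad[OF K c3] True by (auto simp: W_def)
        then have "3 * int (\<Sum>w\<in>W. outer w) \<le> 8 * int k" by linarith
        then show ?thesis unfolding eq by linarith
      next
        case False
        then obtain w where w: "w \<in> W" "degree_in ep E w \<noteq> 3" by auto
        have "16 * int k \<le> int (card (W - {w})) * (8 * int k)" using w W c3 by simp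
        also have "\<dots> \<le> sum s (W - {w})" using sum_bounded_below[of "W - {w}" "8 * int k" s] s8W by simp
        finally show ?thesis using sum.remove[OF W(1) w(1), of s] w by (simp add: s_def)
      qed
    qed
    then show ?thesis by (simp add: W_def)
  qed
  have "25 * int k * int (card KK) \<le> (\<Sum>K\<in>KK. \<Sum>w | w \<in> V \<and> degree_in ep K w = 2. s w)"
    using sum_bounded_below[of KK "25 * int k" "\<lambda>K. \<Sum>w | w \<in> V \<and> degree_in ep K w = 2. s w"] sK by (simp add: mult.commute)
  also have "\<dots> = (\<Sum>w\<in>V. \<Sum>K | K \<in> KK \<and> degree_in ep K w = 2. s w)"
    using finKK finV by (rule sum.swap_restrict)
  also have "\<dots> = (\<Sum>w\<in>V. int (c w) * s w)" by (simp add: c_def)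
  also have "\<dots> \<le> sum om V" using omc by (rule sum_mono)
  also have "sum om V = 11 * int k * int (2 * card E) - 22 * int k * int (card V) - 3 * int (2 * sum L (E - \<Union>KK))"
    using sum_degree_in[OF order_refl] sum_weighted_incid[of "E - \<Union>KK" L]
    by (simp add: om_def sum_subtractf flip: sum_distrib_left of_nat_sum)
  finally have main: "25 * int k * int (card KK) + 22 * int k * int (card V) + 6 * int (sum L (E - \<Union>KK)) \<le> 22 * int k * int (card E)" by simp
  have U: "\<Union>KK \<subseteq> E" using KK_sub by auto
  have "sum L (\<Union>KK) = (\<Sum>K\<in>KK. sum L K)"
    using finK KK_disj by (subst sum.Union_disjoint) auto
  then have "sum L E = sum L (E - \<Union>KK) + k * card KK"
    using sum.subset_diff[OF U finE, of L] KK_sum by simp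
  moreover have "{K \<in> KK. K \<subseteq> E} = KK" using KK_sub by auto
  ultimately have "22 * k * (card E + 1) \<le> 22 * k * card V + 6 * (sum L (E - \<Union>KK) + k * card KK) + 19 * k * card KK"
    using density[of E V] ne ends by simp
  then have "int (22 * k * (card E + 1)) \<le> int (22 * k * card V + 6 * (sum L (E - \<Union>KK) + k * card KK) + 19 * k * card KK)"
    by (rule of_nat_mono)
  then have "22 * int k * (int (card E) + 1) \<le> 22 * int k * int (card V) + 6 * (int (sum L (E - \<Union>KK)) + int k * int (card KK)) + 19 * int k * int (card KK)"
    by (simp only: of_nat_mult of_nat_add of_nat_1 of_nat_numeral)
  with main k show False by (simp add: algebra_simps)
qed


section \<open>The shape of \<open>k\<close>-cycles with three branch vertices\<close>

lemma incident_edges_unique: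
  assumes "S \<subseteq> E" "degree_in ep S w = 1"
  shows "\<exists>e\<in>S. incid ep e w = 1 \<and> (\<forall>e'\<in>S. e' \<noteq> e \<longrightarrow> incid ep e' w = 0)"
proof -
  have fin: "finite S" using finite_subset[OF assms(1) finE] .
  have "\<exists>e\<in>S. incid ep e w \<noteq> 0"
    using assms(2) by (metis degree_in_def sum.neutral zero_neq_one)
  then obtain e where e: "e \<in> S" "incid ep e w \<noteq> 0" by blast
  have sum1: "incid ep e w + (\<Sum>e'\<in>S - {e}. incid ep e' w) = 1"
    using assms(2) sum.remove[OF fin e(1), of "\<lambda>e. incid ep e w"] by (simp add: degree_in_def)
  then have "incid ep e w = 1" "(\<Sum>e'\<in>S - {e}. incid ep e' w) = 0" using e(2) by linarith+
  then show ?thesis using e(1) fin by (intro bexI[of _ e]) auto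
qed

text \<open>Degrees alone give the triangle: the vertex missed by \<open>e0\<close> lies on both
  other edges, and each end of \<open>e0\<close> takes exactly one of them.\<close>

lemma triangle_structure:
  assumes K: "K \<in> KK" "card K = 3" and nl: "\<And>e. e \<in> K \<Longrightarrow> fst (ep e) \<noteq> snd (ep e)"
  obtains v0 v1 v2 e0 e1 e2 where "{w \<in> V. degree_in ep K w = 2} = {v0, v1, v2}" "K = {e0, e1, e2}"
    "distinct [v0, v1, v2]" "distinct [e0, e1, e2]" "joins ep e0 v0 v1" "joins ep e1 v1 v2" "joins ep e2 v2 v0"
proof -
  define W where "W = {w \<in> V. degree_in ep K w = 2}"
  have cW: "card W = 3" using card_cycle_vertices[OF K(1)] K(2) by (simp add: W_def)
  obtain e0 f g where efg: "K = {e0, f, g}" "e0 \<noteq> f" "e0 \<noteq> g" "f \<noteq> g" using K(2) by (auto simp: card_3_iff)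
  have deg: "degree_in ep K w = incid ep e0 w + incid ep f w + incid ep g w" for w
    using efg by (simp add: degree_in_def)
  have le1: "incid ep e w \<le> 1" if "e \<in> K" for e w using nl[OF that] by (auto simp: incid_def)
  have inW: "fst (ep e) \<in> W \<and> snd (ep e) \<in> W" if "e \<in> K" for e
  proof -
    show ?thesis using cycle_ends[OF K(1) that] ends[of e] KK_sub[OF K(1)] that by (auto simp: W_def)
  qed
  define v0 v1 where "v0 = fst (ep e0)" and "v1 = snd (ep e0)"
  have v01: "v0 \<noteq> v1" "v0 \<in> W" "v1 \<in> W" using nl inW efg by (auto simp: v0_def v1_def)
  have "card (W - {v0, v1}) = 1" using cW v01 by (simp add: card_Diff_subset)
  then obtain v2 where "W - {v0, v1} = {v2}" by (auto simp: card_1_singleton_iff)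
  then have v2: "W = {v0, v1, v2}" "v2 \<noteq> v0" "v2 \<noteq> v1" using v01 by auto
  have "incid ep e0 v2 = 0" using v2 by (auto simp: incid_def v0_def v1_def)
  moreover have "degree_in ep K v2 = 2" "degree_in ep K v0 = 2" "degree_in ep K v1 = 2" using v2 by (auto simp: W_def)
  moreover have "incid ep e0 v0 = 1" "incid ep e0 v1 = 1" using v01 by (auto simp: incid_def v0_def v1_def)
  ultimately have i: "incid ep f v2 = 1" "incid ep g v2 = 1" "incid ep f v0 + incid ep g v0 = 1" "incid ep f v1 + incid ep g v1 = 1"
    using deg[of v0] deg[of v1] deg[of v2] le1[of f v2] le1[of g v2] efg by auto
  have other: "joins ep e v2 v0 \<or> joins ep e v1 v2" if "e \<in> {f, g}" for e
  proof -
    have "incid ep e v2 = 1" "e \<in> K" using i that efg by auto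
    then show ?thesis using inW[of e] nl[of e] v2 v01 by (cases "ep e") (auto simp: incid_def joins_def of_bool_def split: if_splits)
  qed
  have j0: "incid ep e v0 = 1" "incid ep e v1 = 0" if "joins ep e v2 v0" for e
    using that v01 v2 by (simp_all add: incid_joins)
  have j1: "incid ep e v1 = 1" "incid ep e v0 = 0" if "joins ep e v1 v2" for e
    using that v01 v2 by (simp_all add: incid_joins)
  have je0: "joins ep e0 v0 v1" by (simp add: joins_def v0_def v1_def)
  have "joins ep f v1 v2 \<and> joins ep g v2 v0 \<or> joins ep g v1 v2 \<and> joins ep f v2 v0"
    using other[of f] other[of g] j0[of f] j0[of g] j1[of f] j1[of g] i by force
  then show thesis
  proof
    assume "joins ep f v1 v2 \<and> joins ep g v2 v0"
    then show thesis using that[of v0 v1 v2 e0 f g] v2 v01 efg je0 by (auto simp: W_def)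
  next
    assume "joins ep g v1 v2 \<and> joins ep f v2 v0"
    then show thesis using that[of v0 v1 v2 e0 g f] v2 v01 efg je0 by (auto simp: W_def insert_commute)
  qed
qed

text \<open>Four edges on three vertices would need
  \<open>110 * k \<le> 66 * k + 12 * k + 19 * k\<close>. Hence an edge that is on no
  \<open>k\<close>-cycle and leaves a corner of the triangle ends at a vertex that is still coloured
  when the triangle has been removed.\<close>

lemma no_chord:
  assumes K: "K \<in> KK" "card K = 3" and f: "f \<in> E - \<Union>KK" "L f \<le> k" and k: "0 < k"
    and ends_f: "degree_in ep K (fst (ep f)) = 2" "degree_in ep K (snd (ep f)) = 2"
  shows False
proof -
  define W where "W = {w \<in> V. degree_in ep K w = 2}"
  have cW: "card W = 3" using card_cycle_vertices[OF K(1)] K(2) by (simp add: W_def)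
  have inW: "fst (ep e) \<in> W \<and> snd (ep e) \<in> W" if "e \<in> insert f K" for e
  proof (cases "e = f")
    case True
    then show ?thesis using ends_f ends f by (auto simp: W_def)
  next
    case False
    then have "e \<in> K" using that by simp
    show ?thesis using cycle_ends[OF K(1) \<open>e \<in> K\<close>] ends[of e] KK_sub[OF K(1)] \<open>e \<in> K\<close> by (auto simp: W_def)
  qed
  have fK: "f \<notin> K" using f K by auto
  have "{K' \<in> KK. K' \<subseteq> insert f K} \<subseteq> {K}"
  proof clarify
    fix K' assume K': "K' \<in> KK" "K' \<subseteq> insert f K"
    then have "K' \<subseteq> K" using f by auto
    then show "K' = K" using KK_disj[OF K'(1) K(1)] KK_ne[OF K'(1)] by auto
  qed
  then have "card {K' \<in> KK. K' \<subseteq> insert f K} \<le> 1" by (metis card_mono card.empty card_insert_disjoint empty_iff finite.emptyI finite.insertI One_nat_def)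
  then have c1: "k * card {K' \<in> KK. K' \<subseteq> insert f K} \<le> k * 1" by (rule mult_le_mono2)
  have "card (insert f K) = 4" "sum L (insert f K) \<le> 2 * k"
    using fK K f finK[OF K(1)] KK_sum[OF K(1)] by auto
  moreover have "22 * k * (card (insert f K) + 1) \<le> 22 * k * card W + 6 * sum L (insert f K) + 19 * k * card {K' \<in> KK. K' \<subseteq> insert f K}"
    using inW f KK_sub[OF K(1)] cW by (intro density) (auto simp: W_def)
  ultimately show False using c1 cW k by simp
qed

end

section \<open>Colourings of networks and the reductions\<close>

text \<open>Only the vertices of the network carry sets. The inner vertices of the paths come back
  when the suppressions are undone one at a time, in \<open>merge_coloring\<close>.\<close>

definition link_coloring :: "nat \<Rightarrow> 'a set \<Rightarrow> 'e set \<Rightarrow> ('e \<Rightarrow> 'a \<times> 'a) \<Rightarrow> ('e \<Rightarrow> nat) \<Rightarrow> ('a \<Rightarrow> nat set) \<Rightarrow> bool" where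
  "link_coloring t V E ep L \<phi> \<longleftrightarrow> (\<forall>w\<in>V. \<phi> w \<subseteq> {1..2 * t + 1} \<and> card (\<phi> w) = t) \<and>
    (\<forall>e\<in>E. dist_ok t (L e) (card (\<phi> (fst (ep e)) - \<phi> (snd (ep e)))))"

lemma link_coloring_vertex:
  assumes "link_coloring t V E ep L \<phi>" "w \<in> V"
  shows "\<phi> w \<subseteq> {1..2 * t + 1}" "card (\<phi> w) = t" "finite (\<phi> w)"
  using assms finite_subset by (auto simp: link_coloring_def)

lemma link_coloring_joins:
  assumes "link_coloring t V E ep L \<phi>" "e \<in> E" "joins ep e a b" "a \<in> V" "b \<in> V"
  shows "dist_ok t (L e) (card (\<phi> a - \<phi> b))"
proof -
  have "card (\<phi> a - \<phi> b) = card (\<phi> b - \<phi> a)"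
    using link_coloring_vertex[OF assms(1)] assms(4,5) by (intro card_Diff_commute) auto
  then show ?thesis using assms by (auto simp: link_coloring_def joins_def)
qed

lemma joins_dist_ok:
  assumes "joins ep e a b" "dist_ok t l (card (\<phi> a - \<phi> b))" "finite (\<phi> a)" "finite (\<phi> b)" "card (\<phi> a) = card (\<phi> b)"
  shows "dist_ok t l (card (\<phi> (fst (ep e)) - \<phi> (snd (ep e))))"
  using assms card_Diff_commute[OF assms(3-5)] by (auto simp: joins_def)


context sparse_network
begin

text \<open>Each member of \<open>KK\<close> uses both edges at \<open>x\<close> or neither, so
  dropping \<open>e2\<close> loses no cycle and no length. For \<open>density\<close>, an edge set
  with \<open>e1\<close> is lifted by adding \<open>e2\<close> and \<open>x\<close>, which raises
  both counts by one and cancels. The case \<open>a = b\<close> is permitted: by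
  \<open>no_loop\<close> the new loop has length at least \<open>k\<close>, and it is later removed
  as a long edge.\<close>

lemma merge:
  assumes e: "e1 \<in> E" "e2 \<in> E" "e1 \<noteq> e2" and x: "joins ep e1 a x" "joins ep e2 x b" "a \<noteq> x" "b \<noteq> x"
    and only: "\<And>e. e \<in> E \<Longrightarrow> fst (ep e) = x \<or> snd (ep e) = x \<Longrightarrow> e = e1 \<or> e = e2"
  shows "sparse_network k (V - {x}) (E - {e2}) (ep(e1 := (a, b))) (L(e1 := L e1 + L e2)) ((\<lambda>K. K - {e2}) ` KK)"
proof -
  let ?ep = "ep(e1 := (a, b))" and ?L = "L(e1 := L e1 + L e2)"
  have abV: "a \<in> V" "b \<in> V" "x \<in> V" using ends[OF e(1)] ends[OF e(2)] x by (auto simp: joins_def)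
  have iff: "e1 \<in> K \<longleftrightarrow> e2 \<in> K" if K: "K \<in> KK" for K
  proof -
    have "incid ep e1 x = 1" "incid ep e2 x = 1" using x by (simp_all add: incid_joins)
    then have "incid ep e x = of_bool (e = e1) + of_bool (e = e2)" if "e \<in> K" for e
      using only[of e] that KK_sub[OF K] e(3) by (cases "e = e1 \<or> e = e2") (auto simp: incid_def)
    then have "degree_in ep K x = (\<Sum>e\<in>K. of_bool (e = e1) + of_bool (e = e2))"
      unfolding degree_in_def by (intro sum.cong) auto
    also have "\<dots> = of_bool (e1 \<in> K) + of_bool (e2 \<in> K)"
      using finK[OF K] by (simp add: sum.distrib of_bool_def)
    finally have "degree_in ep K x = of_bool (e1 \<in> K) + of_bool (e2 \<in> K)" .
    then show ?thesis using KK_deg[OF K, of x] by (cases "e1 \<in> K"; cases "e2 \<in> K") auto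
  qed
  have sumL: "sum ?L S' = sum L (S' \<union> (if e1 \<in> S' then {e2} else {}))" if S': "S' \<subseteq> E - {e2}" for S'
  proof (cases "e1 \<in> S'")
    case True
    have fin: "finite S'" using finite_subset[OF S'] finE by simp
    have "sum ?L S' = ?L e1 + sum ?L (S' - {e1})" by (rule sum.remove[OF fin True])
    also have "sum ?L (S' - {e1}) = sum L (S' - {e1})" by (intro sum.cong) auto
    also have "?L e1 + sum L (S' - {e1}) = L e1 + L e2 + sum L (S' - {e1})" by simp
    also have "\<dots> = sum L S' + L e2" using sum.remove[OF fin True, of L] by simp
    finally have "sum ?L S' = sum L S' + L e2" .
    moreover have "e2 \<notin> S'" using S' by blast
    ultimately show ?thesis using True fin by simp
  next
    case False
    then show ?thesis by (auto intro!: sum.cong)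
  qed
  have K'_cases: "K - {e2} \<union> (if e1 \<in> K - {e2} then {e2} else {}) = K" if "K \<in> KK" for K
    using iff[OF that] e(3) by auto
  have sub: "K - {e2} \<subseteq> S' \<longleftrightarrow> K \<subseteq> S' \<union> (if e1 \<in> S' then {e2} else {})" if "K \<in> KK" "S' \<subseteq> E - {e2}" for K S'
    using iff[OF that(1)] that(2) e(3) by auto
  have ne': "K - {e2} \<noteq> {}" if "K \<in> KK" for K
    using iff[OF that] KK_ne[OF that] e(3) by auto
  \<comment> \<open>Distinct cycles are disjoint and remain nonempty without \<open>e2\<close>, so
    they stay distinct and the number of cycles in the inequality is kept.\<close>
  have inj: "inj_on (\<lambda>K. K - {e2}) KK"
    using ne' KK_disj by (intro inj_onI) (metis Diff_subset Int_greatest subset_empty)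
  show ?thesis
  proof
    show "finite (V - {x})" "finite (E - {e2})" using finV finE by auto
    show "fst (?ep e) \<in> V - {x} \<and> snd (?ep e) \<in> V - {x}" if "e \<in> E - {e2}" for e
      using that ends[of e] only[of e] abV x by auto
    fix K' assume "K' \<in> (\<lambda>K. K - {e2}) ` KK"
    then obtain K where K: "K \<in> KK" "K' = K - {e2}" by auto
    show "K' \<subseteq> E - {e2}" "K' \<noteq> {}" using K KK_sub ne' by auto
    then show "sum ?L K' = k" using sumL[of K'] K'_cases[OF K(1)] KK_sum[OF K(1)] K(2) by simp
    show "degree_in ?ep K' w \<in> {0, 2}" for w
    proof (cases "w = x")
      case True
      have "incid ?ep e x = 0" if "e \<in> K'" for e
        using that only[of e] KK_sub[OF K(1)] K(2) x by (auto simp: incid_def)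
      then show ?thesis by (simp add: degree_in_def True)
    next
      case False
      have "degree_in ?ep K' w = degree_in ep K w"
      proof (cases "e1 \<in> K")
        case True
        then have "e2 \<in> K" using iff K by simp
        have fin: "finite K'" "finite K" using finK[OF K(1)] K(2) by auto
        have "incid ?ep e1 w = incid ep e1 w + incid ep e2 w"
          using x False by (simp add: incid_joins[OF x(1)] incid_joins[OF x(2)]) (simp add: incid_def)
        moreover have "(\<Sum>e\<in>K' - {e1}. incid ?ep e w) = (\<Sum>e\<in>K' - {e1}. incid ep e w)"
          by (intro sum.cong) (auto simp: incid_def)
        ultimately have "degree_in ?ep K' w = incid ep e1 w + incid ep e2 w + (\<Sum>e\<in>K' - {e1}. incid ep e w)"
          using sum.remove[OF fin(1), of e1 "\<lambda>e. incid ?ep e w"] True K(2) e(3)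
          by (simp only: degree_in_def) simp
        also have "\<dots> = degree_in ep K w"
          using sum.remove[OF fin(2) \<open>e2 \<in> K\<close>, of "\<lambda>e. incid ep e w"] sum.remove[OF fin(1), of e1 "\<lambda>e. incid ep e w"] True K(2) e(3)
          by (simp add: degree_in_def)
        finally show ?thesis .
      next
        case False
        then have "K' = K" using iff K by auto
        then show ?thesis using False by (auto simp: degree_in_def incid_def intro!: sum.cong)
      qed
      then show ?thesis using KK_deg[OF K(1)] by simp
    qed
  next
    fix K1 K2 assume "K1 \<in> (\<lambda>K. K - {e2}) ` KK" "K2 \<in> (\<lambda>K. K - {e2}) ` KK" "K1 \<noteq> K2"
    then show "K1 \<inter> K2 = {}" using KK_disj by blast
  next
    fix S' U' assume S': "S' \<subseteq> E - {e2}" and U': "U' \<subseteq> V - {x}" "U' \<noteq> {}"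
      and ends': "\<And>e. e \<in> S' \<Longrightarrow> fst (?ep e) \<in> U' \<and> snd (?ep e) \<in> U'"
    define S where "S = S' \<union> (if e1 \<in> S' then {e2} else {})"
    define U where "U = U' \<union> (if e1 \<in> S' then {x} else {})"
    have fin: "finite S'" "finite U'" using finite_subset[OF S'] finite_subset[OF U'(1)] finE finV by simp_all
    have "{K' \<in> (\<lambda>K. K - {e2}) ` KK. K' \<subseteq> S'} = (\<lambda>K. K - {e2}) ` {K \<in> KK. K \<subseteq> S}"
      using sub[OF _ S'] by (auto simp: S_def)
    then have cKK: "card {K' \<in> (\<lambda>K. K - {e2}) ` KK. K' \<subseteq> S'} = card {K \<in> KK. K \<subseteq> S}"
      using card_image[of "\<lambda>K. K - {e2}" "{K \<in> KK. K \<subseteq> S}"] inj by (simp add: inj_on_def)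
    have ab: "a \<in> U' \<and> b \<in> U'" if "e1 \<in> S'" using ends'[OF that] by simp
    have "22 * k * (card S + 1) \<le> 22 * k * card U + 6 * sum L S + 19 * k * card {K \<in> KK. K \<subseteq> S}"
    proof (rule density)
      show "S \<subseteq> E" "U \<subseteq> V" "U \<noteq> {}" using S' U' e abV by (auto simp: S_def U_def split: if_splits)
      show "fst (ep e) \<in> U \<and> snd (ep e) \<in> U" if "e \<in> S" for e
      proof (cases "e \<in> {e1, e2}")
        case True
        then have "e1 \<in> S'" using that S' by (auto simp: S_def split: if_splits)
        then show ?thesis using True ab x by (auto simp: U_def joins_def)
      next
        case False
        then show ?thesis using that ends'[of e] by (auto simp: U_def S_def split: if_splits)
      qed
    qed
    moreover have "sum ?L S' = sum L S" using sumL[OF S'] by (simp add: S_def)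
    moreover have "card S = card S' + of_bool (e1 \<in> S')" "card U = card U' + of_bool (e1 \<in> S')"
      using fin S' U' by (auto simp: S_def U_def card_insert_if)
    ultimately show "22 * k * (card S' + 1) \<le> 22 * k * card U' + 6 * sum ?L S' + 19 * k * card {K' \<in> (\<lambda>K. K - {e2}) ` KK. K' \<subseteq> S'}"
      by (simp only: cKK, cases "e1 \<in> S'") (simp_all add: algebra_simps)
  qed
qed

lemma merge_coloring:
  assumes e: "e1 \<in> E" "e2 \<in> E" "e1 \<noteq> e2" and x: "joins ep e1 a x" "joins ep e2 x b" "a \<noteq> x" "b \<noteq> x"
    and only: "\<And>e. e \<in> E \<Longrightarrow> fst (ep e) = x \<or> snd (ep e) = x \<Longrightarrow> e = e1 \<or> e = e2"
    and col: "link_coloring t (V - {x}) (E - {e2}) (ep(e1 := (a, b))) (L(e1 := L e1 + L e2)) \<phi>"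
  shows "\<exists>\<psi>. link_coloring t V E ep L \<psi>"
proof -
  have abV: "a \<in> V - {x}" "b \<in> V - {x}" using ends[OF e(1)] ends[OF e(2)] x by (auto simp: joins_def)
  note va = link_coloring_vertex[OF col abV(1)] and vb = link_coloring_vertex[OF col abV(2)]
  have "e1 \<in> E - {e2}" using e by simp
  then have dok: "dist_ok t (L e1 + L e2) (card (\<phi> a - \<phi> b))" using col by (force simp: link_coloring_def)
  have "finite {1..2 * t + 1}" "card {1..2 * t + 1} = 2 * t + 1" by simp_all
  from link_split[OF this va(1,2) vb(1,2) dok] obtain Y where Y: "Y \<subseteq> {1..2 * t + 1}" "card Y = t" "dist_ok t (L e1) (card (\<phi> a - Y))" "dist_ok t (L e2) (card (Y - \<phi> b))" by blast
  have finY: "finite Y" using finite_subset[OF Y(1)] by simp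
  let ?\<psi> = "\<phi>(x := Y)"
  have "dist_ok t (L e) (card (?\<psi> (fst (ep e)) - ?\<psi> (snd (ep e))))" if eE: "e \<in> E" for e
  proof -
    consider "e = e1" | "e = e2" | "e \<noteq> e1" "e \<noteq> e2" by blast
    then show ?thesis
    proof cases
      case 1
      then show ?thesis using joins_dist_ok[OF x(1), of t "L e1" ?\<psi>] Y va finY x by simp
    next
      case 2
      then show ?thesis using joins_dist_ok[OF x(2), of t "L e2" ?\<psi>] Y vb finY x by simp
    next
      case 3
      then have "fst (ep e) \<noteq> x" "snd (ep e) \<noteq> x" using only[OF eE] by auto
      moreover have "e \<in> E - {e2}" using 3 eE by simp
      then have "dist_ok t (L e) (card (\<phi> (fst (ep e)) - \<phi> (snd (ep e))))" using col 3 by (force simp: link_coloring_def)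
      ultimately show ?thesis by simp
    qed
  qed
  moreover have "?\<psi> w \<subseteq> {1..2 * t + 1} \<and> card (?\<psi> w) = t" if "w \<in> V" for w
    using that col Y by (auto simp: link_coloring_def)
  ultimately show ?thesis unfolding link_coloring_def by blast
qed


lemma two_incident_edges:
  assumes "w \<in> V" "degree_in ep E w = 2" and nl: "\<And>e. e \<in> E \<Longrightarrow> fst (ep e) \<noteq> snd (ep e)"
  obtains e1 e2 a b where "e1 \<in> E" "e2 \<in> E" "e1 \<noteq> e2" "joins ep e1 a w" "joins ep e2 w b" "a \<noteq> w" "b \<noteq> w"
    "\<And>e. e \<in> E \<Longrightarrow> fst (ep e) = w \<or> snd (ep e) = w \<Longrightarrow> e = e1 \<or> e = e2"
proof -
  have "\<exists>e\<in>E. incid ep e w \<noteq> 0" using assms(2) by (metis degree_in_def sum.neutral zero_neq_numeral)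
  then obtain e1 where e1: "e1 \<in> E" "incid ep e1 w \<noteq> 0" by blast
  then have i1: "incid ep e1 w = 1" using nl[OF e1(1)] by (auto simp: incid_def)
  have "degree_in ep (E - {e1}) w = 1"
    using sum.remove[OF finE e1(1), of "\<lambda>e. incid ep e w"] i1 assms(2) by (simp add: degree_in_def)
  from incident_edges_unique[OF _ this] obtain e2 where e2: "e2 \<in> E - {e1}" "incid ep e2 w = 1"
    "\<And>e. e \<in> E - {e1} \<Longrightarrow> e \<noteq> e2 \<Longrightarrow> incid ep e w = 0" by blast
  obtain a b where "joins ep e1 a w" "a \<noteq> w" "joins ep e2 b w" "b \<noteq> w"
    using exists_other_end[OF i1] exists_other_end[OF e2(2)] by blast
  moreover have "e = e1 \<or> e = e2" if "e \<in> E" "fst (ep e) = w \<or> snd (ep e) = w" for e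
    using e2(3)[of e] that by (auto simp: incid_def)
  ultimately show thesis using that[of e1 e2 a b] e1 e2 by (auto simp: joins_def)
qed

text \<open>Without loops, 2-regularity forces two edges with the same ends. Their total length is
  odd, so exactly one has length at most \<open>t\<close>, the range that
  \<open>dist_ok_complement\<close> covers.\<close>

lemma parallel_pair:
  assumes K: "K \<in> KK" "card K = 2" and nl: "\<And>e. e \<in> E \<Longrightarrow> fst (ep e) \<noteq> snd (ep e)" and k: "k = 2 * t + 1"
  obtains e f where "e \<in> E" "f \<in> E" "e \<noteq> f" "L e \<le> t" "L f = 2 * t + 1 - L e"
    "joins ep f (fst (ep e)) (snd (ep e))"
proof -
  obtain x y where xy: "K = {x, y}" "x \<noteq> y" using K(2) by (meson card_2_iff)
  have sum: "L x + L y = 2 * t + 1" using KK_sum[OF K(1)] xy k by simp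
  have E: "x \<in> E" "y \<in> E" using KK_sub[OF K(1)] xy by auto
  have j: "joins ep f (fst (ep e)) (snd (ep e))" if "K = {e, f}" "e \<noteq> f" for e f
  proof -
    have "f \<in> E" "e \<in> E" using that(1) E xy by auto
    then have le: "fst (ep e) \<noteq> snd (ep e)" "fst (ep f) \<noteq> snd (ep f)" using nl by auto
    have "degree_in ep K w = incid ep e w + incid ep f w" for w using that by (simp add: degree_in_def)
    then have "incid ep f (fst (ep e)) = 1" "incid ep f (snd (ep e)) = 1"
      using cycle_ends[OF K(1), of e] that le by (auto simp: incid_def)
    then show ?thesis using le by (intro joins_incid) simp_all
  qed
  show thesis
  proof (cases "L x \<le> t")
    case True
    then have "L y = 2 * t + 1 - L x" using sum by linarith
    then show thesis using that[of x y] True E xy j[of x y] by simp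
  next
    case False
    then have "L y \<le> t" "L x = 2 * t + 1 - L y" using sum by linarith+
    then show thesis using that[of y x] E xy j[of y x] by (simp add: insert_commute)
  qed
qed

end

lemma card_Diff_le:
  assumes "link_coloring t V E ep L \<phi>" "a \<in> V"
  shows "card (\<phi> a - B) \<le> t"
  using link_coloring_vertex[OF assms] by (metis card_mono Diff_subset)

context sparse_network
begin

text \<open>A cycle takes two of the three edge ends at \<open>w\<close>, so \<open>K\<close> is the
  only \<open>k\<close>-cycle through \<open>w\<close> and a single edge is left. By
  \<open>no_chord\<close> its other end is off \<open>K\<close>.\<close>

lemma cubic_cycle_vertex:
  assumes K: "K \<in> KK" "card K = 3" and w: "w \<in> V" "degree_in ep K w = 2" "degree_in ep E w = 3"
    and nl: "\<And>e. e \<in> E \<Longrightarrow> fst (ep e) \<noteq> snd (ep e)" and Lk: "\<And>e. e \<in> E \<Longrightarrow> L e \<le> k" and k: "0 < k"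
  shows "\<exists>f u. f \<in> E \<and> joins ep f u w \<and> u \<in> V \<and> degree_in ep K u \<noteq> 2 \<and> outer w = L f \<and>
    (\<forall>e\<in>E. e \<notin> K \<longrightarrow> incid ep e w \<noteq> 0 \<longrightarrow> e = f)"
proof -
  define C where "C = {K' \<in> KK. degree_in ep K' w = 2}"
  have finC: "finite C" using finKK by (simp add: C_def)
  have KC: "K \<in> C" using K w by (simp add: C_def)
  then have "card C \<noteq> 0" using finC by auto
  moreover have "degree_in ep (E - \<Union>KK) w + 2 * card C = 3"
    using degree_in_Union[of w] w(3) by (simp add: C_def)
  ultimately have cC: "card C = 1" by linarith
  have D: "degree_in ep (E - \<Union>KK) w = 1"
    using degree_in_Union[of w] w(3) cC by (simp add: C_def)
  have C: "C = {K}" using KC cC by (auto simp: card_1_singleton_iff)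
  from incident_edges_unique[OF _ D] obtain f where f: "f \<in> E - \<Union>KK" "incid ep f w = 1"
    "\<And>e. e \<in> E - \<Union>KK \<Longrightarrow> e \<noteq> f \<Longrightarrow> incid ep e w = 0" by blast
  obtain u where u: "joins ep f u w" "u \<noteq> w"
    using exists_other_end[OF f(2)] by blast
  have uV: "u \<in> V" using u ends[of f] f by (auto simp: joins_def)
  have "degree_in ep K u \<noteq> 2"
  proof
    assume "degree_in ep K u = 2"
    then have "degree_in ep K (fst (ep f)) = 2" "degree_in ep K (snd (ep f)) = 2" using u w(2) by (auto simp: joins_def)
    then show False using no_chord[OF K f(1) _ k] Lk f by auto
  qed
  moreover have "outer w = L f"
  proof -
    have "outer w = (\<Sum>e\<in>E - \<Union>KK. if e = f then L f else 0)"
      using f by (intro sum.cong) auto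
    then show ?thesis using f(1) finE by simp
  qed
  moreover have "e = f" if e: "e \<in> E" "e \<notin> K" "incid ep e w \<noteq> 0" for e
  proof (rule ccontr)
    assume "e \<noteq> f"
    then obtain K' where K': "K' \<in> KK" "e \<in> K'" using f(3)[of e] e by auto
    have "w = fst (ep e) \<or> w = snd (ep e)" using e(3) by (auto simp: incid_def)
    then have "K' \<in> C" using cycle_ends[OF K'] K' by (auto simp: C_def)
    then show False using C K' e by auto
  qed
  ultimately show ?thesis using f u uV by blast
qed

text \<open>The assumption \<open>sub\<close> is the induction hypothesis for proper subnetworks. It
  colours what remains without the three corners, which \<open>triangle_extend\<close> then puts
  back simultaneously.\<close>

lemma triangle_reducible:
  assumes K: "K \<in> KK" "card K = 3" "\<And>w. w \<in> V \<Longrightarrow> degree_in ep K w = 2 \<Longrightarrow> degree_in ep E w = 3"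
      "8 * k < 3 * (\<Sum>w | w \<in> V \<and> degree_in ep K w = 2. outer w)"
    and nl: "\<And>e. e \<in> E \<Longrightarrow> fst (ep e) \<noteq> snd (ep e)" and short: "\<And>e. e \<in> E \<Longrightarrow> L e < 2 * t" and k: "k = 2 * t + 1"
    and sub: "\<And>V' E'. V' \<subseteq> V \<Longrightarrow> E' \<subseteq> E \<Longrightarrow> (\<And>e. e \<in> E' \<Longrightarrow> fst (ep e) \<in> V' \<and> snd (ep e) \<in> V') \<Longrightarrow>
      V' \<noteq> V \<or> E' \<noteq> E \<Longrightarrow> \<exists>\<phi>. link_coloring t V' E' ep L \<phi>"
  shows "\<exists>\<phi>. link_coloring t V E ep L \<phi>"
proof -
  let ?C = "{1..2 * t + 1}"
  have C: "finite ?C" "card ?C = 2 * t + 1" by auto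
  have Lk: "L e \<le> k" if "e \<in> E" for e using short[OF that] k by simp
  define W where "W = {w \<in> V. degree_in ep K w = 2}"
  have nlK: "\<And>e. e \<in> K \<Longrightarrow> fst (ep e) \<noteq> snd (ep e)" using nl KK_sub[OF K(1)] by blast
  obtain v0 v1 v2 e0 e1 e2 where "{w \<in> V. degree_in ep K w = 2} = {v0, v1, v2}" and Ke: "K = {e0, e1, e2}"
    and d: "distinct [v0, v1, v2]" "distinct [e0, e1, e2]"
    and j: "joins ep e0 v0 v1" "joins ep e1 v1 v2" "joins ep e2 v2 v0"
    by (rule triangle_structure[OF K(1,2) nlK])
  then have W: "W = {v0, v1, v2}" by (simp add: W_def)
  have "\<forall>w\<in>W. \<exists>f u. f \<in> E \<and> joins ep f u w \<and> u \<in> V \<and> degree_in ep K u \<noteq> 2 \<and> outer w = L f \<and>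
    (\<forall>e\<in>E. e \<notin> K \<longrightarrow> incid ep e w \<noteq> 0 \<longrightarrow> e = f)"
    using cubic_cycle_vertex[OF K(1,2) _ _ K(3) nl Lk] k by (auto simp: W_def)
  from bchoice[OF this] obtain f where "\<forall>w\<in>W. \<exists>u. f w \<in> E \<and> joins ep (f w) u w \<and> u \<in> V \<and> degree_in ep K u \<noteq> 2 \<and>
    outer w = L (f w) \<and> (\<forall>e\<in>E. e \<notin> K \<longrightarrow> incid ep e w \<noteq> 0 \<longrightarrow> e = f w)" ..
  from bchoice[OF this] obtain u where fu': "\<forall>w\<in>W. f w \<in> E \<and> joins ep (f w) (u w) w \<and> u w \<in> V \<and> degree_in ep K (u w) \<noteq> 2 \<and>
    outer w = L (f w) \<and> (\<forall>e\<in>E. e \<notin> K \<longrightarrow> incid ep e w \<noteq> 0 \<longrightarrow> e = f w)" ..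
  have fu: "\<And>w. w \<in> W \<Longrightarrow> f w \<in> E" "\<And>w. w \<in> W \<Longrightarrow> joins ep (f w) (u w) w"
    "\<And>w. w \<in> W \<Longrightarrow> u w \<in> V - W" "\<And>w. w \<in> W \<Longrightarrow> outer w = L (f w)"
    "\<And>w e. w \<in> W \<Longrightarrow> e \<in> E \<Longrightarrow> e \<notin> K \<Longrightarrow> incid ep e w \<noteq> 0 \<Longrightarrow> e = f w"
    using fu' by (blast, blast, simp add: W_def, blast, blast)
  define E' where "E' = {e \<in> E. fst (ep e) \<notin> W \<and> snd (ep e) \<notin> W}"
  have WV: "W \<subseteq> V" by (auto simp: W_def)
  have "V - W \<noteq> V" using W WV by auto
  then obtain \<phi> where \<phi>: "link_coloring t (V - W) E' ep L \<phi>"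
    using sub[of "V - W" E'] ends by (auto simp: E'_def)
  define v where "v i = (if i = 0 then v0 else if i = 1 then v1 else v2)" for i :: nat
  have vW: "v i \<in> W" for i by (simp add: v_def W)
  have Wv: "\<exists>i<3. w = v i" if "w \<in> W" for w
  proof -
    have "v 0 = v0" "v 1 = v1" "v 2 = v2" by (simp_all add: v_def)
    moreover have "w = v0 \<or> w = v1 \<or> w = v2" using that W by blast
    ultimately show ?thesis by (elim disjE) (rule exI[of _ 0], simp, rule exI[of _ 1], simp, rule exI[of _ 2], simp)
  qed
  define A where "A i = \<phi> (u (v i))" for i
  define l where "l i = L (f (v i))" for i
  have vA: "A i \<subseteq> ?C \<and> card (A i) = t" "finite (A i)" for i
    using link_coloring_vertex[OF \<phi> fu(3)[OF vW]] by (auto simp: A_def)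
  have lt: "l i < 2 * t" for i using short fu(1)[OF vW] by (simp add: l_def)
  have "(\<Sum>w\<in>W. outer w) = l 0 + l 1 + l 2"
    using d(1) fu(4) by (simp add: W l_def v_def)
  then have big: "8 * k < 3 * (l 0 + l 1 + l 2)" using K(4) by (simp add: W_def)
  have lsum: "(\<Sum>i<3. 2 * (t - l i div 2)) \<le> t"
  proof -
    \<comment> \<open>Each summand is at most \<open>k - l i\<close>, so the sum is below
      \<open>3 * k - 8 * k / 3 = k / 3\<close>. Since \<open>t - l i div 2\<close> is truncated, the
      bound on \<open>l i\<close> matters.\<close>
    have "2 * (t - l i div 2) + l i \<le> 2 * t + 1" for i using lt[of i] by linarith
    moreover have "a + b + c \<le> t" if "a + l 0 \<le> 2 * t + 1" "b + l 1 \<le> 2 * t + 1" "c + l 2 \<le> 2 * t + 1" for a b c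
    proof -
      have "3 * (a + b + c) < 2 * t + 1" using that big k by (simp add: algebra_simps)
      then show ?thesis by simp
    qed
    ultimately have "2 * (t - l 0 div 2) + 2 * (t - l 1 div 2) + 2 * (t - l 2 div 2) \<le> t" by blast
    then show ?thesis by (simp add: numeral_3_eq_3 numeral_2_eq_2)
  qed
  have xyz: "L e0 + L e1 + L e2 = 2 * t + 1" using KK_sum[OF K(1)] Ke d(2) k by simp
  obtain Y where Y: "\<And>i. i < 3 \<Longrightarrow> Y i \<subseteq> ?C \<and> card (Y i) = t \<and> dist_ok t (l i) (card (A i - Y i))"
    "dist_ok t (L e0) (card (Y 0 - Y 1))" "dist_ok t (L e1) (card (Y 1 - Y 2))" "dist_ok t (L e2) (card (Y 2 - Y (0::nat)))"
    using triangle_extend[of ?C t "L e0" "L e1" "L e2" A l] C xyz vA(1) lsum by blast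
  define \<psi> where "\<psi> w = (if w = v0 then Y 0 else if w = v1 then Y 1 else if w = v2 then Y 2 else \<phi> w)" for w
  have \<psi>v: "\<psi> (v i) = Y i" if "i < 3" for i
  proof -
    have "i = 0 \<or> i = 1 \<or> i = 2" using that by linarith
    then show ?thesis using d(1) by (elim disjE) (auto simp: \<psi>_def v_def)
  qed
  have \<psi>3: "\<psi> v0 = Y 0" "\<psi> v1 = Y 1" "\<psi> v2 = Y 2" using d(1) by (auto simp: \<psi>_def)
  have \<psi>o: "\<psi> w = \<phi> w" if "w \<notin> W" for w using that W by (auto simp: \<psi>_def)
  have vert: "\<psi> w \<subseteq> ?C \<and> card (\<psi> w) = t" if "w \<in> V" for w
  proof (cases "w \<in> W")
    case True
    then show ?thesis using Wv Y(1) \<psi>v by metis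
  next
    case False
    then show ?thesis using that \<phi> \<psi>o by (auto simp: link_coloring_def)
  qed
  have fin: "finite (\<psi> w)" if "w \<in> V" for w using finite_subset[OF conjunct1[OF vert[OF that]]] by simp
  have "dist_ok t (L e) (card (\<psi> (fst (ep e)) - \<psi> (snd (ep e))))" if e: "e \<in> E" for e
  proof -
    have J: "dist_ok t (L e) (card (\<psi> (fst (ep e)) - \<psi> (snd (ep e))))"
      if "joins ep e a b" "dist_ok t (L e) (card (\<psi> a - \<psi> b))" "a \<in> V" "b \<in> V" for a b
      using joins_dist_ok[OF that(1,2)] fin vert that(3,4) by metis
    consider "e \<in> E'" | "e \<in> K" | i where "i < 3" "e \<notin> K" "incid ep e (v i) \<noteq> 0"
      using e Wv by (fastforce simp: E'_def incid_def)
    then show ?thesis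
    proof cases
      case 1
      then show ?thesis using \<phi> \<psi>o by (auto simp: link_coloring_def E'_def)
    next
      case 2
      then show ?thesis using J j Y(2-4) \<psi>3 W WV unfolding Ke by auto
    next
      case 3
      then have ef: "e = f (v i)" using fu(5)[OF vW e] by blast
      have "\<psi> (u (v i)) = A i" using \<psi>o fu(3)[OF vW] by (auto simp: A_def)
      then have "dist_ok t (L e) (card (\<psi> (u (v i)) - \<psi> (v i)))"
        using Y(1)[OF 3(1)] \<psi>v[OF 3(1)] ef by (simp add: l_def)
      then show ?thesis using J[of "u (v i)" "v i"] fu(2)[OF vW] fu(3)[OF vW] vW WV ef by blast
    qed
  qed
  then show ?thesis using vert unfolding link_coloring_def by blast
qed

end

text \<open>The order of the reductions matters. An edge of length at least \<open>k - 1\<close>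
  admits every distance; once these are gone there are no loops, as suppression and the reduction of
  parallel pairs presuppose. Minimum degree 3 and three vertices on each \<open>k\<close>-cycle are
  in turn what the discharging presupposes.\<close>

theorem network_colorable:
  assumes "sparse_network (2 * t + 1) V E ep L KK" and t: "1 \<le> t"
  shows "\<exists>\<phi>. link_coloring t V E ep L \<phi>"
  using assms(1)
proof (induction "card V + card E" arbitrary: V E ep L KK rule: less_induct)
  case less
  define k where "k = 2 * t + 1"
  interpret sparse_network k V E ep L KK using less.prems by (simp add: k_def)
  let ?C = "{1..2 * t + 1}"
  have C: "finite ?C" "card ?C = 2 * t + 1" by auto
  have sub: "\<exists>\<phi>. link_coloring t V' E' ep L \<phi>"
    if "V' \<subseteq> V" "E' \<subseteq> E" "\<And>e. e \<in> E' \<Longrightarrow> fst (ep e) \<in> V' \<and> snd (ep e) \<in> V'" "V' \<noteq> V \<or> E' \<noteq> E" for V' E'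
  proof -
    have "card V' \<le> card V" "card E' \<le> card E" using that finV finE by (auto intro: card_mono)
    moreover have "card V' < card V \<or> card E' < card E"
      using that finV finE by (metis psubsetI psubset_card_mono)
    ultimately have "card V' + card E' < card V + card E" by linarith
    then show ?thesis using less.hyps subnetwork[OF that(1-3)] unfolding k_def by blast
  qed
  show ?case
  proof (cases "\<exists>e\<in>E. 2 * t \<le> L e")
    case True
    then obtain e where e: "e \<in> E" "2 * t \<le> L e" by auto
    obtain \<phi> where \<phi>: "link_coloring t V (E - {e}) ep L \<phi>"
      using sub[of V "E - {e}"] ends e by auto
    have "dist_ok t (L e) (card (\<phi> (fst (ep e)) - \<phi> (snd (ep e))))"
      using e(2) card_Diff_le[OF \<phi>] ends[OF e(1)] by (intro dist_ok_long) auto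
    then have "link_coloring t V E ep L \<phi>" using \<phi> by (auto simp: link_coloring_def)
    then show ?thesis by blast
  next
    case False
    then have short: "L e < 2 * t" if "e \<in> E" for e using that by (meson not_le)
    then have nl: "fst (ep e) \<noteq> snd (ep e)" if "e \<in> E" for e using no_loop[OF that] that by (force simp: k_def)
    show ?thesis
    proof (cases "\<exists>w\<in>V. degree_in ep E w \<le> 2")
      case True
      then obtain w where w: "w \<in> V" "degree_in ep E w \<le> 2" by auto
      define E' where "E' = {e \<in> E. fst (ep e) \<noteq> w \<and> snd (ep e) \<noteq> w}"
      obtain \<phi> where \<phi>: "link_coloring t (V - {w}) E' ep L \<phi>"
        using sub[of "V - {w}" E'] ends w by (auto simp: E'_def)
      consider "degree_in ep E w = 0" | "degree_in ep E w = 1" | "degree_in ep E w = 2" using w(2) by linarith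
      then show ?thesis
      proof cases
        case 1
        have "t \<le> card ?C" by simp
        then obtain Y where Y: "Y \<subseteq> ?C" "card Y = t" "finite Y" by (rule obtain_subset_with_card_n)
        have no_w: "fst (ep e) \<noteq> w" "snd (ep e) \<noteq> w" if "e \<in> E" for e
          using bspec[OF iffD1[OF degree_in_eq_0_iff[OF order_refl] 1] that] by simp_all
        then have "E' = E" unfolding E'_def by blast
        have "dist_ok t (L e) (card ((\<phi>(w := Y)) (fst (ep e)) - (\<phi>(w := Y)) (snd (ep e))))" if "e \<in> E" for e
          using \<phi> no_w[OF that] that unfolding link_coloring_def \<open>E' = E\<close> by simp
        moreover have "(\<phi>(w := Y)) v \<subseteq> ?C \<and> card ((\<phi>(w := Y)) v) = t" if "v \<in> V" for v
          using \<phi> Y that by (auto simp: link_coloring_def)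
        ultimately have "link_coloring t V E ep L (\<phi>(w := Y))" unfolding link_coloring_def by blast
        then show ?thesis by blast
      next
        case 2
        from incident_edges_unique[OF order_refl 2] obtain e where e: "e \<in> E" "incid ep e w = 1"
          "\<And>e'. e' \<in> E \<Longrightarrow> e' \<noteq> e \<Longrightarrow> incid ep e' w = 0" by blast
        obtain u where u: "joins ep e u w" "u \<noteq> w"
          using exists_other_end[OF e(2)] by blast
        have uV: "u \<in> V - {w}" using u ends[OF e(1)] by (auto simp: joins_def)
        note vu = link_coloring_vertex[OF \<phi> uV]
        obtain Y where Y: "Y \<subseteq> ?C" "card Y = t" "dist_ok t (L e) (card (\<phi> u - Y))"
          using link_exists[OF C vu(1,2)] by blast
        have "finite Y" using finite_subset[OF Y(1)] by simp
        have "dist_ok t (L f) (card ((\<phi>(w := Y)) (fst (ep f)) - (\<phi>(w := Y)) (snd (ep f))))" if "f \<in> E" for f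
        proof (cases "f = e")
          case True
          then show ?thesis using joins_dist_ok[OF u(1), of t "L e" "\<phi>(w := Y)"] Y vu u(2) \<open>finite Y\<close> by simp
        next
          case False
          then have "f \<in> E'" using e(3)[OF that] that by (auto simp: E'_def incid_def)
          then show ?thesis using \<phi> by (auto simp: link_coloring_def E'_def)
        qed
        moreover have "(\<phi>(w := Y)) v \<subseteq> ?C \<and> card ((\<phi>(w := Y)) v) = t" if "v \<in> V" for v
          using \<phi> Y that by (auto simp: link_coloring_def)
        ultimately show ?thesis unfolding link_coloring_def by blast
      next
        case 3
        from two_incident_edges[OF w(1) 3 nl] obtain e1 e2 a b where *:
          "e1 \<in> E" "e2 \<in> E" "e1 \<noteq> e2" "joins ep e1 a w" "joins ep e2 w b" "a \<noteq> w" "b \<noteq> w"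
          "\<And>e. e \<in> E \<Longrightarrow> fst (ep e) = w \<or> snd (ep e) = w \<Longrightarrow> e = e1 \<or> e = e2" by blast
        have "card (V - {w}) + card (E - {e2}) < card V + card E"
          using card_Diff1_less[OF finV w(1)] card_Diff1_less[OF finE *(2)] by linarith
        from less.hyps[OF this merge[OF *, unfolded k_def]] show ?thesis using merge_coloring[OF *] by blast
      qed
    next
      case False
      then have deg3: "3 \<le> degree_in ep E w" if "w \<in> V" for w using that by force
      show ?thesis
      proof (cases "\<exists>K\<in>KK. card K \<le> 2")
        case True
        then obtain K where K: "K \<in> KK" "card K \<le> 2" by auto
        have "card K \<noteq> 0" using finK[OF K(1)] KK_ne[OF K(1)] by auto
        moreover have "card K \<noteq> 1"
        proof
          assume "card K = 1"
          then obtain e where "K = {e}" by (auto simp: card_1_singleton_iff)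
          then show False using KK_sum[OF K(1)] short KK_sub[OF K(1)] by (fastforce simp: k_def)
        qed
        ultimately have "card K = 2" using K by linarith
        from parallel_pair[OF K(1) this nl k_def] obtain e f where ef: "e \<in> E" "f \<in> E" "e \<noteq> f" "L e \<le> t" "L f = 2 * t + 1 - L e"
          "joins ep f (fst (ep e)) (snd (ep e))" by blast
        obtain \<phi> where \<phi>: "link_coloring t V (E - {f}) ep L \<phi>"
          using sub[of V "E - {f}"] ends ef by auto
        have "dist_ok t (L e) (card (\<phi> (fst (ep e)) - \<phi> (snd (ep e))))" using \<phi> ef by (auto simp: link_coloring_def)
        then have "dist_ok t (L f) (card (\<phi> (fst (ep e)) - \<phi> (snd (ep e))))"
          unfolding ef(5) using ef(4) card_Diff_le[OF \<phi>] ends[OF ef(1)] by (intro dist_ok_complement) auto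
        then have "dist_ok t (L f) (card (\<phi> (fst (ep f)) - \<phi> (snd (ep f))))"
          using joins_dist_ok[OF ef(6)] link_coloring_vertex[OF \<phi>] ends[OF ef(1)] by metis
        then have "link_coloring t V E ep L \<phi>" using \<phi> by (auto simp: link_coloring_def)
        then show ?thesis by blast
      next
        case False
        then have K3: "3 \<le> card K" if "K \<in> KK" for K using that by force
        show ?thesis
        proof (cases "V = {}")
          case True
          then have "E = {}" using ends by auto
          then show ?thesis using True by (auto simp: link_coloring_def)
        next
          case False
          have k0: "0 < k" by (simp add: k_def)
          have Lk: "L e \<le> k" if "e \<in> E" for e using short[OF that] by (simp add: k_def)
          obtain K where K: "K \<in> KK" "card K = 3" "\<And>w. w \<in> V \<Longrightarrow> degree_in ep K w = 2 \<Longrightarrow> degree_in ep E w = 3"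
            "8 * k < 3 * (\<Sum>w | w \<in> V \<and> degree_in ep K w = 2. outer w)"
            using exists_reducible_triangle[OF False k0 Lk deg3 K3] by blast
          show ?thesis
            using triangle_reducible[OF K nl short k_def sub] by blast
        qed
      qed
    qed
  qed
qed

section \<open>Cycles and sets of edges with even degrees\<close>

fun path_edges :: "'a list \<Rightarrow> 'a set set" where
  "path_edges (x # y # zs) = insert {x, y} (path_edges (y # zs))"
| "path_edges _ = {}"

definition cycle_edges :: "'a list \<Rightarrow> 'a set set" where
  "cycle_edges xs = insert {last xs, hd xs} (path_edges xs)"

text \<open>An edge set has neither a starting point nor a direction, so cycles can be compared,
  counted and added modulo 2.\<close>

definition is_cycle :: "'a set set \<Rightarrow> bool" where
  "is_cycle C \<longleftrightarrow> (\<exists>xs. distinct xs \<and> 3 \<le> length xs \<and> C = cycle_edges xs)"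

text \<open>The cycle space over the field with two elements, with \<open>sym_diff\<close> as
  addition.\<close>

definition even_degrees :: "'a set set \<Rightarrow> bool" where
  "even_degrees B \<longleftrightarrow> (\<forall>v. even (card {e \<in> B. v \<in> e}))"

lemma path_edges_Cons: "xs \<noteq> [] \<Longrightarrow> path_edges (x # xs) = insert {x, hd xs} (path_edges xs)"
  by (cases xs) auto

lemma path_edges_append:
  "xs \<noteq> [] \<Longrightarrow> ys \<noteq> [] \<Longrightarrow> path_edges (xs @ ys) = insert {last xs, hd ys} (path_edges xs \<union> path_edges ys)"
  by (induction xs rule: path_edges.induct) (auto simp: path_edges_Cons)

lemma path_edges_rev: "path_edges (rev xs) = path_edges xs"
proof (induction xs)
  case (Cons x xs)
  then show ?case
    by (cases "xs = []") (auto simp: path_edges_append path_edges_Cons last_rev insert_commute)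
qed simp

lemma cycle_edges_rotate:
  "xs \<noteq> [] \<Longrightarrow> ys \<noteq> [] \<Longrightarrow> cycle_edges (xs @ ys) = cycle_edges (ys @ xs)"
  by (auto simp: cycle_edges_def path_edges_append)

lemma cycle_edges_rev: "xs \<noteq> [] \<Longrightarrow> cycle_edges (rev xs) = cycle_edges xs"
  by (simp add: cycle_edges_def path_edges_rev hd_rev last_rev insert_commute)

lemma path_edges_subset: "e \<in> path_edges xs \<Longrightarrow> e \<subseteq> set xs"
  by (induction xs rule: path_edges.induct) auto

lemma finite_path_edges [simp]: "finite (path_edges xs)"
  by (induction xs rule: path_edges.induct) auto

lemma path_edges_split:
  "e \<in> path_edges xs \<Longrightarrow> \<exists>ys zs. ys \<noteq> [] \<and> zs \<noteq> [] \<and> xs = ys @ zs \<and> e = {last ys, hd zs}"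
proof (induction xs rule: path_edges.induct)
  case (1 x y zs)
  show ?case
  proof (cases "e = {x, y}")
    case True
    then show ?thesis by (intro exI[of _ "[x]"] exI[of _ "y # zs"]) simp
  next
    case False
    then obtain as bs where "as \<noteq> []" "bs \<noteq> []" "y # zs = as @ bs" "e = {last as, hd bs}" using 1 by auto
    then show ?thesis by (intro exI[of _ "x # as"] exI[of _ bs]) simp
  qed
qed simp_all

lemma Union_path_edges: "2 \<le> length xs \<Longrightarrow> \<Union>(path_edges xs) = set xs"
proof (induction xs rule: path_edges.induct)
  case (1 x y zs)
  then show ?case by (cases zs) auto
qed auto

lemma card_path_edges: "distinct xs \<Longrightarrow> card (path_edges xs) = length xs - 1"
proof (induction xs rule: path_edges.induct)
  case (1 x y zs)
  have "{x, y} \<notin> path_edges (y # zs)" using 1(2) path_edges_subset[of "{x, y}" "y # zs"] by auto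
  then show ?case using 1 by simp
qed simp_all

lemma closing_edge_notin:
  assumes "distinct xs" "3 \<le> length xs"
  shows "{last xs, hd xs} \<notin> path_edges xs"
proof
  assume "{last xs, hd xs} \<in> path_edges xs"
  moreover obtain x y zs where xs: "xs = x # y # zs" "zs \<noteq> []" using assms(2) by (cases xs rule: path_edges.cases) (auto simp: Suc_le_length_iff)
  moreover have "last zs \<noteq> x" "last zs \<noteq> y" using assms(1) xs last_in_set[of zs] by auto
  ultimately have "{last zs, x} \<in> path_edges (y # zs)" by (auto simp: doubleton_eq_iff)
  then show False using path_edges_subset[of "{last zs, x}" "y # zs"] assms(1) xs by auto
qed

lemma card_cycle_edges:
  assumes "distinct xs" "3 \<le> length xs"
  shows "card (cycle_edges xs) = length xs"
  using assms closing_edge_notin[OF assms] by (simp add: cycle_edges_def card_path_edges)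

lemma is_cycle_finite: "is_cycle C \<Longrightarrow> finite C"
  by (auto simp: is_cycle_def cycle_edges_def)

lemma is_cycle_through:
  assumes "is_cycle C" "{a, b} \<in> C" "a \<noteq> b"
  shows "\<exists>xs. distinct xs \<and> 3 \<le> length xs \<and> C = cycle_edges xs \<and> last xs = a \<and> hd xs = b"
proof -
  obtain xs where xs: "distinct xs" "3 \<le> length xs" "C = cycle_edges xs" using assms(1) by (auto simp: is_cycle_def)
  have "\<exists>ys. distinct ys \<and> 3 \<le> length ys \<and> C = cycle_edges ys \<and> {a, b} = {last ys, hd ys}"
  proof (cases "{a, b} = {last xs, hd xs}")
    case True
    then show ?thesis using xs by blast
  next
    case False
    then obtain us vs where uv: "us \<noteq> []" "vs \<noteq> []" "xs = us @ vs" "{a, b} = {last us, hd vs}"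
      using assms(2) xs path_edges_split[of "{a, b}" xs] by (auto simp: cycle_edges_def)
    then show ?thesis using xs cycle_edges_rotate[OF uv(1,2)] by (intro exI[of _ "vs @ us"]) auto
  qed
  then obtain ys where ys: "distinct ys" "3 \<le> length ys" "C = cycle_edges ys" "{a, b} = {last ys, hd ys}" by blast
  then consider "last ys = a" "hd ys = b" | "last ys = b" "hd ys = a" using assms(3) by (auto simp: doubleton_eq_iff)
  then show ?thesis
  proof cases
    case 2
    have "ys \<noteq> []" using ys(2) by auto
    then show ?thesis using ys 2 by (intro exI[of _ "rev ys"]) (auto simp: cycle_edges_rev hd_rev last_rev)
  qed (use ys in blast)
qed

lemma card_even_sym_diff:
  assumes "finite A" "finite B"
  shows "even (card (sym_diff A B)) \<longleftrightarrow> (even (card A) \<longleftrightarrow> even (card B))"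
proof -
  have "card (sym_diff A B) = card (A - B) + card (B - A)" using assms by (intro card_Un_disjoint) auto
  moreover have "card A = card (A \<inter> B) + card (A - B)" "card B = card (A \<inter> B) + card (B - A)"
    using card_Int_Diff[OF assms(1), of B] card_Int_Diff[OF assms(2), of A] by (simp_all add: Int_commute)
  ultimately show ?thesis by auto
qed

lemma even_degrees_sym_diff:
  assumes "finite A" "finite B" "even_degrees A" "even_degrees B"
  shows "even_degrees (sym_diff A B)"
proof -
  have "{e \<in> sym_diff A B. v \<in> e} = sym_diff {e \<in> A. v \<in> e} {e \<in> B. v \<in> e}" for v by auto
  then show ?thesis using assms by (simp only: even_degrees_def card_even_sym_diff finite_Collect_conjI simp_thms) (simp add: card_even_sym_diff)
qed

lemma cycle_degree:
  assumes "is_cycle C"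
  shows "card {e \<in> C. v \<in> e} \<in> {0, 2}"
proof -
  obtain xs where xs: "distinct xs" "3 \<le> length xs" "C = cycle_edges xs" using assms by (auto simp: is_cycle_def)
  show ?thesis
  proof (cases "v \<in> set xs")
    case True
    then obtain us ws where "xs = us @ v # ws" by (meson split_list)
    then obtain zs where zs: "distinct (v # zs)" "3 \<le> length (v # zs)" "C = cycle_edges (v # zs)"
      using xs cycle_edges_rotate[of us "v # ws"] that[of "ws @ us"] by (cases "us = []") auto
    have "{e \<in> C. v \<in> e} = {{last zs, v}, {v, hd zs}}"
      using zs path_edges_subset[of _ zs] by (auto simp: cycle_edges_def path_edges_Cons)
    moreover have "last zs \<noteq> hd zs" "v \<noteq> hd zs" "v \<noteq> last zs"
      using zs by (cases zs rule: path_edges.cases; auto)+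
    ultimately show ?thesis by (auto simp: doubleton_eq_iff)
  next
    case False
    have "xs \<noteq> []" using xs by auto
    then have "{e \<in> C. v \<in> e} = {}" using False xs path_edges_subset[of _ xs] by (auto simp: cycle_edges_def)
    then have "card {e \<in> C. v \<in> e} = 0" by (simp only: card.empty)
    then show ?thesis by simp
  qed
qed

lemma even_degrees_cycle: "is_cycle C \<Longrightarrow> even_degrees C"
  unfolding even_degrees_def
proof
  fix v assume "is_cycle C"
  from cycle_degree[OF this, of v] show "even (card {e \<in> C. v \<in> e})" by (elim insertE emptyE) (simp_all only: even_zero even_numeral)
qed

text \<open>At the first vertex of a longest path in \<open>B\<close>, even degree provides a second
  edge. By maximality its other end lies on the path, and this closes a cycle.\<close>

lemma even_degrees_contains_cycle:
  assumes fin: "finite B" and ne: "B \<noteq> {}" and two: "\<And>e. e \<in> B \<Longrightarrow> card e = 2" and ev: "even_degrees B"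
  shows "\<exists>C\<subseteq>B. is_cycle C"
proof -
  define P where "P xs \<longleftrightarrow> distinct xs \<and> 2 \<le> length xs \<and> path_edges xs \<subseteq> B" for xs
  have finU: "finite (\<Union>B)" using fin two by (metis card.infinite finite_Union zero_neq_numeral)
  obtain e where e: "e \<in> B" using ne by auto
  obtain a b where "e = {a, b}" "a \<noteq> b" using two[OF e] by (meson card_2_iff)
  then have "P [a, b]" using e by (simp add: P_def)
  moreover have "length xs \<le> card (\<Union>B)" if "P xs" for xs
  proof -
    have "set xs \<subseteq> \<Union>B" using that Union_path_edges[of xs] by (auto simp: P_def)
    then show ?thesis using that finU by (metis P_def card_mono distinct_card)
  qed
  ultimately obtain xs where xs: "P xs" "\<And>ys. P ys \<Longrightarrow> length ys \<le> length xs"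
    using ex_has_greatest_nat[of P "[a, b]" length "Suc (card (\<Union>B))"] le_imp_less_Suc by blast
  obtain v y zs where vy: "xs = v # y # zs" using xs(1) by (cases xs rule: path_edges.cases) (auto simp: P_def)
  let ?D = "{e \<in> B. v \<in> e}"
  have vyB: "{v, y} \<in> ?D" using xs vy by (auto simp: P_def)
  have "finite ?D" using fin by simp
  have "\<not> ?D \<subseteq> {{v, y}}"
  proof
    assume "?D \<subseteq> {{v, y}}"
    then have "?D = {{v, y}}" using vyB by auto
    then have "card ?D = 1" by simp
    then show False using ev unfolding even_degrees_def by (metis odd_one)
  qed
  then obtain f where f: "f \<in> B" "v \<in> f" "f \<noteq> {v, y}" by auto
  obtain w where w: "f = {v, w}" "w \<noteq> v" using two[OF f(1)] f(2) by (auto simp: card_2_iff)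
  have "w \<in> set xs"
  proof (rule ccontr)
    assume "w \<notin> set xs"
    then have "P (w # xs)" using xs(1) w f vy by (auto simp: P_def insert_commute)
    then show False using xs(2) by fastforce
  qed
  then have "w \<in> set zs" using w f vy by auto
  then obtain as bs where ab: "zs = as @ w # bs" by (meson split_list)
  define c where "c = v # y # as @ [w]"
  have "xs = c @ bs" by (simp add: c_def vy ab)
  moreover have "c \<noteq> []" by (simp add: c_def)
  ultimately have "path_edges c \<subseteq> path_edges xs" using path_edges_append[of c bs] by (cases "bs = []") auto
  then have "path_edges c \<subseteq> B" using xs(1) by (auto simp: P_def)
  moreover have "distinct c" "3 \<le> length c" using xs(1) vy ab by (auto simp: P_def c_def)
  moreover have "{last c, hd c} \<in> B" using w f by (simp add: c_def insert_commute)
  ultimately show ?thesis by (auto simp: is_cycle_def cycle_edges_def intro!: exI[of _ "cycle_edges c"])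
qed

lemma even_degrees_decompose:
  assumes "finite B" "\<And>e. e \<in> B \<Longrightarrow> card e = 2" "even_degrees B"
  shows "\<exists>D. (\<forall>C\<in>D. is_cycle C) \<and> \<Union>D = B \<and> disjoint D"
  using assms
proof (induction B rule: finite_psubset_induct)
  case (psubset B)
  show ?case
  proof (cases "B = {}")
    case True
    then show ?thesis by (intro exI[of _ "{}"]) auto
  next
    case False
    then obtain C where C: "C \<subseteq> B" "is_cycle C" using even_degrees_contains_cycle[OF psubset(1) False psubset.prems] by blast
    have "C \<noteq> {}" using C by (auto simp: is_cycle_def cycle_edges_def)
    have "sym_diff B C = B - C" using C by auto
    then have "even_degrees (B - C)"
      using even_degrees_sym_diff[of B C] psubset C even_degrees_cycle is_cycle_finite by metis
    moreover have "B - C \<subset> B" using C \<open>C \<noteq> {}\<close> by auto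
    ultimately obtain D where D: "\<forall>C\<in>D. is_cycle C" "\<Union>D = B - C" "disjoint D"
      using psubset.IH[of "B - C"] psubset.prems by blast
    have "disjoint (insert C D)" using D by (auto simp: disjoint_def)
    then show ?thesis using D C by (intro exI[of _ "insert C D"]) auto
  qed
qed

text \<open>
  The sets of odd-degree vertices take at most \<open>2 ^ (card U - 1)\<close> values by the handshake lemma, and each
  nonempty fibre is a translate of the family of even sets.
\<close>

lemma even_degrees_count:
  assumes finS: "finite S" and two: "\<And>e. e \<in> S \<Longrightarrow> card e = 2" and U: "finite U" "\<Union>S \<subseteq> U" "U \<noteq> {}"
  shows "2 ^ (card S + 1) \<le> 2 ^ card U * card {B. B \<subseteq> S \<and> even_degrees B}"
proof -
  obtain u where u: "u \<in> U" using U by auto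
  \<comment> \<open>The parity at one vertex \<open>u\<close> is determined by the others, so it is
    left out; this saves the factor 2 that becomes the \<open>+ 1\<close> in the count.\<close>
  define od where "od B = {v \<in> U - {u}. odd (card {e \<in> B. v \<in> e})}" for B
  define Ev where "Ev = {B. B \<subseteq> S \<and> even_degrees B}"
  have finEv: "finite Ev" using finS by (simp add: Ev_def)
  have evI: "even_degrees B" if B: "B \<subseteq> S" "od B = {}" for B
  proof -
    have finB: "finite B" using finite_subset[OF B(1) finS] .
    have e: "even (card {e \<in> B. v \<in> e})" if "v \<noteq> u" for v
    proof (cases "v \<in> U")
      case True
      then show ?thesis using B that by (auto simp: od_def)
    next
      case False
      then have "{e \<in> B. v \<in> e} = {}" using B U by auto
      then show ?thesis by (simp only: card.empty even_zero)
    qed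
    have "(\<Sum>v\<in>U. card {e \<in> B. v \<in> e}) = (\<Sum>e\<in>B. card {v \<in> U. v \<in> e})"
      using sum.swap_restrict[OF U(1) finB, of "\<lambda>_ _. 1 :: nat" "\<lambda>v e. v \<in> e"] by simp
    also have "\<dots> = (\<Sum>e\<in>B. 2)"
    proof (rule sum.cong)
      fix e assume "e \<in> B"
      then have "{v \<in> U. v \<in> e} = e" "card e = 2" using B U two by auto
      then show "card {v \<in> U. v \<in> e} = 2" by simp
    qed simp
    finally have "even (card {e \<in> B. u \<in> e} + (\<Sum>v\<in>U - {u}. card {e \<in> B. v \<in> e}))"
      using sum.remove[OF U(1) u, of "\<lambda>v. card {e \<in> B. v \<in> e}"] by simp
    moreover have "even (\<Sum>v\<in>U - {u}. card {e \<in> B. v \<in> e})" using e by (intro dvd_sum) auto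
    ultimately have "even (card {e \<in> B. u \<in> e})" by simp
    then have "even (card {e \<in> B. v \<in> e})" for v using e by (cases "v = u") simp_all
    then show ?thesis by (simp add: even_degrees_def)
  qed
  have fiber: "card {B \<in> Pow S. od B = T} \<le> card Ev" for T
  proof (cases "{B \<in> Pow S. od B = T} = {}")
    case False
    then obtain B0 where B0: "B0 \<subseteq> S" "od B0 = T" by auto
    have "inj_on (\<lambda>B. sym_diff B B0) {B \<in> Pow S. od B = T}" by (intro inj_onI) auto
    moreover have "(\<lambda>B. sym_diff B B0) ` {B \<in> Pow S. od B = T} \<subseteq> Ev"
    proof clarify
      fix B assume B: "B \<subseteq> S" "T = od B"
      have fin: "finite B" "finite B0" using finite_subset[OF B(1) finS] finite_subset[OF B0(1) finS] by simp_all
      have "{e \<in> sym_diff B B0. v \<in> e} = sym_diff {e \<in> B. v \<in> e} {e \<in> B0. v \<in> e}" for v by auto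
      then have "even (card {e \<in> sym_diff B B0. v \<in> e}) \<longleftrightarrow> (even (card {e \<in> B. v \<in> e}) \<longleftrightarrow> even (card {e \<in> B0. v \<in> e}))" for v
        using card_even_sym_diff[of "{e \<in> B. v \<in> e}" "{e \<in> B0. v \<in> e}"] fin by simp
      then have "v \<in> od (sym_diff B B0) \<longleftrightarrow> (v \<in> od B) \<noteq> (v \<in> od B0)" for v
        unfolding od_def mem_Collect_eq by meson
      then have "od (sym_diff B B0) = {}" using B B0 by blast
      moreover have "sym_diff B B0 \<subseteq> S" using B B0 by auto
      ultimately show "sym_diff B B0 \<in> Ev" using evI unfolding Ev_def by blast
    qed
    ultimately show ?thesis using finEv by (rule card_inj_on_le)
  qed (simp only: card.empty zero_le)
  have "2 ^ card S = card (Pow S)" using finS by (simp add: card_Pow)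
  also have "Pow S = (\<Union>T\<in>Pow (U - {u}). {B \<in> Pow S. od B = T})" by (auto simp: od_def)
  also have "card \<dots> \<le> (\<Sum>T\<in>Pow (U - {u}). card {B \<in> Pow S. od B = T})"
    using U by (intro card_UN_le) auto
  also have "\<dots> \<le> (\<Sum>T\<in>Pow (U - {u}). card Ev)" using fiber by (intro sum_mono) auto
  also have "\<dots> = 2 ^ (card U - 1) * card Ev" using U u by (simp add: card_Pow)
  finally have "2 * 2 ^ card S \<le> 2 * 2 ^ (card U - 1) * card Ev" by simp
  moreover have "(2::nat) * 2 ^ (card U - 1) = 2 ^ card U" using U by (metis card_gt_0_iff power_minus_mult mult.commute)
  ultimately have "2 * 2 ^ card S \<le> 2 ^ card U * card Ev" by (simp only:)
  then show ?thesis by (simp add: Ev_def)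
qed

section \<open>Paths within an edge set\<close>

definition joined_by :: "'a set set \<Rightarrow> 'a list \<Rightarrow> 'a \<Rightarrow> 'a \<Rightarrow> bool" where
  "joined_by H xs u v \<longleftrightarrow> xs \<noteq> [] \<and> distinct xs \<and> path_edges xs \<subseteq> H \<and> hd xs = u \<and> last xs = v"

lemma joined_by_refl: "joined_by H [u] u u"
  by (simp add: joined_by_def)

text \<open>If the new vertex already lies on the path, the path is cut there: it has to stay simple
  to be drawn as an arc and closed to a cycle.\<close>

lemma joined_by_step:
  assumes "joined_by H xs u w" "{w, w'} \<in> H"
  shows "\<exists>ys. joined_by H ys u w'"
proof (cases "w' \<in> set xs")
  case True
  then obtain as bs where ab: "xs = as @ w' # bs" by (meson split_list)
  then have "path_edges (as @ [w']) \<subseteq> path_edges xs"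
    using path_edges_append[of "as @ [w']" bs] by (cases "bs = []") auto
  then show ?thesis using assms ab by (intro exI[of _ "as @ [w']"]) (cases as; auto simp: joined_by_def)
next
  case False
  then show ?thesis using assms by (intro exI[of _ "xs @ [w']"]) (auto simp: joined_by_def path_edges_append)
qed

lemma cycle_closing_path:
  assumes "joined_by H xs u v" "{u, v} \<notin> H" "u \<noteq> v"
  shows "3 \<le> length xs"
  using assms by (cases xs rule: path_edges.cases) (auto simp: joined_by_def Suc_le_length_iff neq_Nil_conv split: if_splits)


section \<open>Faces of plane graphs\<close>

text \<open>The point set of an edge is fixed, while a parametrization is only asserted to exist,
  for either order of the two ends; thus no orientation is chosen.\<close>

locale plane_graph =
  fixes E :: "'a set set" and p :: "'a \<Rightarrow> complex" and im :: "'a set \<Rightarrow> complex set"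
  assumes finE: "finite E" and two: "\<And>e. e \<in> E \<Longrightarrow> card e = 2"
    and inj_p: "inj_on p (\<Union>E)"
    and edge_arc: "\<And>u v. {u, v} \<in> E \<Longrightarrow> u \<noteq> v \<Longrightarrow> \<exists>g. arc g \<and> pathstart g = p u \<and> pathfinish g = p v \<and> path_image g = im {u, v}"
    and im_vertices: "\<And>e. e \<in> E \<Longrightarrow> im e \<inter> p ` \<Union>E = p ` e"
    and im_Int: "\<And>e f. e \<in> E \<Longrightarrow> f \<in> E \<Longrightarrow> e \<noteq> f \<Longrightarrow> im e \<inter> im f \<subseteq> p ` \<Union>E"
begin

abbreviation img :: "'a set set \<Rightarrow> complex set" where
  "img H \<equiv> \<Union>(im ` H)"

lemma im_Int_subset:
  assumes "e \<in> E" "f \<in> E" "e \<noteq> f"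
  shows "im e \<inter> im f \<subseteq> p ` (e \<inter> f)"
proof -
  have "im e \<inter> im f \<subseteq> p ` e \<inter> p ` f" using im_Int[OF assms] im_vertices[OF assms(1)] im_vertices[OF assms(2)] by blast
  also have "\<dots> = p ` (e \<inter> f)" using inj_on_image_Int[OF inj_p, of e f] assms by blast
  finally show ?thesis .
qed

lemma edge_obtain:
  assumes "e \<in> E"
  obtains u v g where "e = {u, v}" "u \<noteq> v" "arc g" "pathstart g = p u" "pathfinish g = p v" "path_image g = im e"
proof -
  obtain u v where "e = {u, v}" "u \<noteq> v" using two[OF assms] by (meson card_2_iff)
  then show thesis using edge_arc[of u v] assms that by blast
qed

lemma compact_im: "e \<in> E \<Longrightarrow> compact (im e)"
  by (metis edge_obtain compact_arc_image)

lemma compact_img: "H \<subseteq> E \<Longrightarrow> compact (img H)"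
  using finE compact_im by (intro compact_UN) (auto intro: finite_subset)

lemma arc_of_path:
  assumes "distinct xs" "2 \<le> length xs" "path_edges xs \<subseteq> E"
  shows "\<exists>g. arc g \<and> pathstart g = p (hd xs) \<and> pathfinish g = p (last xs) \<and> path_image g = img (path_edges xs)"
  using assms
proof (induction xs rule: path_edges.induct)
  case (1 x y zs)
  then obtain h where h: "arc h" "pathstart h = p x" "pathfinish h = p y" "path_image h = im {x, y}"
    using edge_arc[of x y] by auto
  show ?case
  proof (cases "zs = []")
    case True
    then show ?thesis using h by auto
  next
    case False
    then have "2 \<le> length (y # zs)" by (cases zs) auto
    then obtain g where g: "arc g" "pathstart g = p y" "pathfinish g = p (last zs)" "path_image g = img (path_edges (y # zs))"
      using 1 False by auto
    have "path_image h \<inter> path_image g \<subseteq> {pathstart g}"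
    proof -
      have "im {x, y} \<inter> im f \<subseteq> {p y}" if f: "f \<in> path_edges (y # zs)" for f
      proof -
        have "x \<notin> f" using path_edges_subset[OF f] 1(2) by auto
        then have "im {x, y} \<inter> im f \<subseteq> p ` ({x, y} \<inter> f)" using f 1(4) by (intro im_Int_subset) auto
        then show ?thesis using \<open>x \<notin> f\<close> by blast
      qed
      then show ?thesis using h g by auto
    qed
    then have "arc (h +++ g)" using h g by (intro arc_join) auto
    then show ?thesis using h g False by (intro exI[of _ "h +++ g"]) (auto simp: path_image_join)
  qed
qed simp_all

text \<open>The arc \<open>h\<close> of one edge is kept as a separate first piece, so that it
  cancels when the winding numbers of two cycles through this edge are subtracted.\<close>

lemma cycle_as_loop:
  assumes C: "is_cycle C" "C \<subseteq> E" "{a, b} \<in> C" "a \<noteq> b"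
    and h: "arc h" "pathstart h = p a" "pathfinish h = p b" "path_image h = im {a, b}"
  shows "\<exists>g. arc g \<and> pathstart g = p b \<and> pathfinish g = p a \<and> path_image g = img (C - {{a, b}}) \<and> simple_path (h +++ g)"
proof -
  obtain xs where xs: "distinct xs" "3 \<le> length xs" "C = cycle_edges xs" "last xs = a" "hd xs = b"
    using is_cycle_through[OF C(1,3,4)] by blast
  have C': "C - {{a, b}} = path_edges xs" using closing_edge_notin[OF xs(1,2)] xs by (auto simp: cycle_edges_def)
  obtain g where g: "arc g" "pathstart g = p b" "pathfinish g = p a" "path_image g = img (path_edges xs)"
    using arc_of_path[of xs] xs C by (auto simp: cycle_edges_def)
  have "path_image h \<inter> path_image g \<subseteq> {pathstart h, pathstart g}"
  proof -
    have "im {a, b} \<inter> im f \<subseteq> {p a, p b}" if f: "f \<in> C - {{a, b}}" for f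
    proof -
      have "im {a, b} \<inter> im f \<subseteq> p ` ({a, b} \<inter> f)" using f C by (intro im_Int_subset) auto
      then show ?thesis by blast
    qed
    then show ?thesis using h g C' by auto
  qed
  then have "simple_path (h +++ g)" using h g by (intro simple_path_join_loop) auto
  then show ?thesis using g C' by auto
qed

lemma cycle_loop:
  assumes "is_cycle C" "C \<subseteq> E"
  shows "\<exists>c. simple_path c \<and> pathfinish c = pathstart c \<and> path_image c = img C"
proof -
  obtain e where e: "e \<in> C" using assms by (auto simp: is_cycle_def cycle_edges_def)
  then obtain a b h where h: "e = {a, b}" "a \<noteq> b" "arc h" "pathstart h = p a" "pathfinish h = p b" "path_image h = im e"
    using assms edge_obtain[of e] by blast
  obtain g where g: "arc g" "pathstart g = p b" "pathfinish g = p a" "path_image g = img (C - {{a, b}})" "simple_path (h +++ g)"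
    using cycle_as_loop[OF assms, of a b h] h e by auto
  have "img C = im {a, b} \<union> img (C - {{a, b}})" using e h by auto
  then show ?thesis using g h by (intro exI[of _ "h +++ g"]) (auto simp: path_image_join)
qed

lemma Jordan_cycle:
  assumes "is_cycle C" "C \<subseteq> E"
  shows "connected (inside (img C))" "connected (outside (img C))" "bounded (inside (img C))"
    "frontier (inside (img C)) = img C" "frontier (outside (img C)) = img C"
  using cycle_loop[OF assms] Jordan_inside_outside by metis+

text \<open>
  The second component records the points enclosed an odd number of times, so that no orientation
  of the edges is needed.
\<close>

inductive_set cycle_span :: "'a set set \<Rightarrow> ('a set set \<times> complex set) set" for H where
  empty: "({}, {}) \<in> cycle_span H"
| add: "(Z, I) \<in> cycle_span H \<Longrightarrow> is_cycle C \<Longrightarrow> C \<subseteq> H \<Longrightarrow> (sym_diff Z C, sym_diff I (inside (img C))) \<in> cycle_span H"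

lemma sym_diff_assoc: "sym_diff (sym_diff A B) C = sym_diff A (sym_diff B C)"
  by auto

lemma cycle_span_sym_diff:
  assumes "(Z, I) \<in> cycle_span H" "(Z', I') \<in> cycle_span H"
  shows "(sym_diff Z Z', sym_diff I I') \<in> cycle_span H"
  using assms(2)
proof (induction rule: cycle_span.induct)
  case empty
  then show ?case using assms(1) by simp
next
  case (add Z' I' C)
  show ?case using cycle_span.add[OF add.IH add.hyps(2,3)] by (simp only: sym_diff_assoc)
qed

lemma cycle_span_cycle: "is_cycle C \<Longrightarrow> C \<subseteq> H \<Longrightarrow> (C, inside (img C)) \<in> cycle_span H"
  using cycle_span.add[OF cycle_span.empty] by simp

lemma cycle_span_mono:
  assumes "(Z, I) \<in> cycle_span H" "H \<subseteq> G"
  shows "(Z, I) \<in> cycle_span G"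
  using assms by (induction rule: cycle_span.induct) (auto intro: cycle_span.intros)

lemma cycle_span_edges:
  assumes "(Z, I) \<in> cycle_span H" "H \<subseteq> E"
  shows "Z \<subseteq> H \<and> finite Z \<and> even_degrees Z \<and> bounded I \<and> (\<forall>e\<in>Z. \<exists>C. is_cycle C \<and> C \<subseteq> H \<and> e \<in> C)"
  using assms(1)
proof (induction rule: cycle_span.induct)
  case empty
  then show ?case by (simp add: even_degrees_def)
next
  case (add Z I C)
  have "bounded (sym_diff I (inside (img C)))"
  proof (rule bounded_subset)
    show "bounded (I \<union> inside (img C))"
      using add.IH Jordan_cycle(3)[OF add.hyps(2)] add.hyps(3) assms(2) by simp
  qed auto
  moreover have "finite C" "even_degrees C" using add.hyps is_cycle_finite even_degrees_cycle by auto
  then have "even_degrees (sym_diff Z C)" using add.IH even_degrees_sym_diff[of Z C] by blast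
  moreover have "sym_diff Z C \<subseteq> H" "finite (sym_diff Z C)" using add \<open>finite C\<close> by auto
  moreover have "\<forall>e\<in>sym_diff Z C. \<exists>C. is_cycle C \<and> C \<subseteq> H \<and> e \<in> C" using add by blast
  ultimately show ?case by blast
qed

text \<open>Being inside a cycle changes only across its drawn edges; hence off \<open>img H\<close>
  the set \<open>I\<close> is a union of faces.\<close>

lemma cycle_span_component:
  assumes "(Z, I) \<in> cycle_span H" "connected_component (- img H) y z"
  shows "y \<in> I \<longleftrightarrow> z \<in> I"
  using assms(1)
proof (induction rule: cycle_span.induct)
  case (add Z I C)
  have "connected_component (- img C) y z"
    using assms(2) by (rule connected_component_of_subset) (use add.hyps in auto)
  then have "y \<in> inside (img C) \<longleftrightarrow> z \<in> inside (img C)"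
    using inside_same_component connected_component_sym by metis
  then show ?case using add.IH by auto
qed simp

lemma even_degrees_in_span:
  assumes "Z \<subseteq> H" "H \<subseteq> E" "even_degrees Z"
  shows "\<exists>I. (Z, I) \<in> cycle_span H"
proof -
  have finZ: "finite Z" using finite_subset[of Z E] assms finE by blast
  obtain D where D: "\<forall>C\<in>D. is_cycle C" "\<Union>D = Z" "disjoint D"
    using even_degrees_decompose[OF finZ _ assms(3)] assms two by blast
  have "finite D" using finZ D by (metis finite_UnionD)
  then have "\<exists>I. (\<Union>D, I) \<in> cycle_span H"
    using D assms(1)
  proof (induction D arbitrary: Z rule: finite_induct)
    case empty
    then show ?case using cycle_span.empty by auto
  next
    case (insert C D)
    have "disjoint D" "\<Union>D \<subseteq> H" using insert.prems by (auto simp: disjoint_def)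
    then obtain I where "(\<Union>D, I) \<in> cycle_span H" using insert.IH[of "\<Union>D"] insert.prems(1) by blast
    then have "(sym_diff (\<Union>D) C, sym_diff I (inside (img C))) \<in> cycle_span H"
      using insert by (intro cycle_span.add) auto
    moreover have "\<Union>D \<inter> C = {}" using insert by (auto simp: disjoint_def)
    then have "sym_diff (\<Union>D) C = \<Union>(insert C D)" by auto
    ultimately show ?case by metis
  qed
  then show ?thesis using D by simp
qed


text \<open>
  Two points close to the middle of \<open>e\<close>, on both sides of a cycle through \<open>e\<close>, are separated by every
  cycle through \<open>e\<close>: the difference of the winding numbers of two such cycles is the winding number
  of a closed path avoiding \<open>e\<close>, hence constant near \<open>e\<close>.
\<close>

lemma jump:
  assumes C0: "is_cycle C0" "C0 \<subseteq> E" "e \<in> C0"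
  shows "\<exists>z1 z2. z1 \<notin> img E \<and> z2 \<notin> img E \<and> (\<forall>Z I. (Z, I) \<in> cycle_span E \<longrightarrow> (e \<in> Z \<longleftrightarrow> (z1 \<in> I) \<noteq> (z2 \<in> I)))"
proof -
  have eE: "e \<in> E" using C0 by auto
  obtain a b h where ab: "e = {a, b}" "a \<noteq> b" and h: "arc h" "pathstart h = p a" "pathfinish h = p b" "path_image h = im e"
    using edge_obtain[OF eE] by blast
  define q where "q = h (1 / 2)"
  have q: "q \<in> im e" "q \<noteq> p a" "q \<noteq> p b"
  proof -
    show "q \<in> im e" unfolding h(4)[symmetric] q_def path_image_def by auto
    have "inj_on h {0..1}" using h(1) by (simp add: arc_def)
    then show "q \<noteq> p a" "q \<noteq> p b"
      unfolding q_def h(2)[symmetric] h(3)[symmetric] pathstart_def pathfinish_def by (force dest: inj_onD)+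
  qed
  have "q \<notin> img (E - {e})"
  proof
    assume "q \<in> img (E - {e})"
    then obtain f where "f \<in> E" "f \<noteq> e" "q \<in> im f" by auto
    then have "q \<in> p ` (e \<inter> f)" using im_Int_subset[OF eE] q by blast
    then show False using q ab by auto
  qed
  moreover have "open (- img (E - {e}))"
    by (intro open_Compl compact_imp_closed compact_img) auto
  ultimately obtain r where r: "0 < r" "ball q r \<subseteq> - img (E - {e})"
    using open_contains_ball by (metis ComplI)
  let ?B = "ball q r"
  have qC: "q \<in> img C0" using q C0 by auto
  \<comment> \<open>By the Jordan curve theorem \<open>q\<close> is on the frontier of both sides of
    \<open>C0\<close>, so every ball around it meets both.\<close>
  have "?B \<inter> inside (img C0) \<noteq> {}" "?B \<inter> outside (img C0) \<noteq> {}"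
    using Jordan_cycle(4,5)[OF C0(1,2)] qC r(1) frontier_straddle[of q "inside (img C0)"] frontier_straddle[of q "outside (img C0)"]
    by (auto simp: set_eq_iff dist_commute)
  then obtain z1 z2 where z: "z1 \<in> ?B" "z1 \<in> inside (img C0)" "z2 \<in> ?B" "z2 \<in> outside (img C0)" by blast
  have zE: "z \<notin> img E" if "z \<in> ?B" "z \<notin> im e" for z using that r(2) by auto
  have ze: "z1 \<notin> im e" "z2 \<notin> im e"
    using z C0 inside_no_overlap[of "img C0"] outside_no_overlap[of "img C0"] by blast+
  obtain g0 where g0: "arc g0" "pathstart g0 = p b" "pathfinish g0 = p a" "path_image g0 = img (C0 - {e})" "simple_path (h +++ g0)"
    using cycle_as_loop[OF C0(1,2), of a b h] C0(3) ab h by auto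
  have cycle_jump: "e \<in> C \<longleftrightarrow> (z1 \<in> inside (img C)) \<noteq> (z2 \<in> inside (img C))" if C: "is_cycle C" "C \<subseteq> E" for C
  proof (cases "e \<in> C")
    case False
    then have "?B \<subseteq> - img C" using r(2) C by blast
    then have "connected_component (- img C) z1 z2"
      using z unfolding connected_component_def by (intro exI[of _ ?B]) auto
    then show ?thesis using False inside_same_component connected_component_sym by metis
  next
    case True
    obtain g where g: "arc g" "pathstart g = p b" "pathfinish g = p a" "path_image g = img (C - {e})" "simple_path (h +++ g)"
      using cycle_as_loop[OF C, of a b h] True ab h by auto
    have imgs: "path_image (h +++ g) = img C" "path_image (h +++ g0) = img C0"
      using g g0 h True C0(3) by (auto simp: path_image_join)
    have nB: "?B \<inter> path_image g = {}" "?B \<inter> path_image g0 = {}"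
      using r(2) C C0 unfolding g(4) g0(4) by blast+
    have wn: "winding_number (h +++ g0) z - winding_number (h +++ g) z = winding_number (g0 +++ reversepath g) z"
      if "z \<in> ?B" "z \<notin> im e" for z
      using that nB g g0 h by (simp add: winding_number_join winding_number_reversepath arc_imp_path disjoint_iff)
    \<comment> \<open>With \<open>h\<close> cancelled, the remaining closed path avoids
      \<open>?B\<close> and winds equally often around both points.\<close>
    have "winding_number (g0 +++ reversepath g) z1 = winding_number (g0 +++ reversepath g) z2"
    proof (rule winding_number_eq[where S = ?B])
      show "?B \<inter> path_image (g0 +++ reversepath g) = {}" using nB g g0 by (auto simp: path_image_join)
    qed (use g g0 z in \<open>auto intro: arc_imp_path\<close>)
    then have eq: "winding_number (h +++ g0) z1 - winding_number (h +++ g) z1 = winding_number (h +++ g0) z2 - winding_number (h +++ g) z2"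
      using wn z ze by simp
    have cl: "pathfinish (h +++ g) = pathstart (h +++ g)" "pathfinish (h +++ g0) = pathstart (h +++ g0)" using g g0 h by auto
    have w0: "winding_number (h +++ g0) z2 = 0" "winding_number (h +++ g) z = 0" if "z \<in> outside (img C)" for z
      using winding_number_zero_in_outside[of "h +++ g0" z2] winding_number_zero_in_outside[of "h +++ g" z] that z g g0 cl imgs
      by (auto simp: simple_path_imp_path)
    have w02: "winding_number (h +++ g0) z2 = 0"
      using winding_number_zero_in_outside[of "h +++ g0" z2] z g0 cl imgs by (auto simp: simple_path_imp_path)
    have w01: "winding_number (h +++ g0) z1 \<noteq> 0"
      using simple_closed_path_norm_winding_number_inside[OF g0(5), of z1] z imgs by auto
    have zC: "z1 \<notin> img C" "z2 \<notin> img C" using zE z ze C by blast+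
    \<comment> \<open>If \<open>C\<close> did not separate \<open>z1\<close> and \<open>z2\<close>,
      the winding number of its loop would agree at both, whereas that of \<open>C0\<close> is
      nonzero at \<open>z1\<close> and zero at \<open>z2\<close>.\<close>
    have "\<not> (z1 \<in> inside (img C) \<and> z2 \<in> inside (img C))"
    proof
      assume "z1 \<in> inside (img C) \<and> z2 \<in> inside (img C)"
      then have "winding_number (h +++ g) z1 = winding_number (h +++ g) z2"
        using simple_closed_path_winding_number_inside[OF g(5)] unfolding imgs by metis
      then show False using eq w01 w02 by simp
    qed
    moreover have "\<not> (z1 \<notin> inside (img C) \<and> z2 \<notin> inside (img C))"
    proof
      assume "z1 \<notin> inside (img C) \<and> z2 \<notin> inside (img C)"
      then have "z1 \<in> outside (img C)" "z2 \<in> outside (img C)" using zC inside_Un_outside[of "img C"] by blast+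
      then show False using eq w01 w0 by simp
    qed
    ultimately show ?thesis using True by blast
  qed
  have "e \<in> Z \<longleftrightarrow> (z1 \<in> I) \<noteq> (z2 \<in> I)" if "(Z, I) \<in> cycle_span E" for Z I
    using that
  proof (induction rule: cycle_span.induct)
    case (add Z I C)
    then show ?case using cycle_jump[OF add.hyps(2,3)] by blast
  qed simp
  then show ?thesis using zE z ze by blast
qed

text \<open>On disjoint sets \<open>sym_diff\<close> is union, so the elements of the span can be
  added up. \<open>Q\<close> is a property stable under this addition: it is trivial in
  \<open>faces_in_span\<close>, and in \<open>facial_cycles\<close> it says that the edge set is a
  sum of facial cycles.\<close>

lemma span_of_union:
  assumes A: "finite A" "disjoint A" and span: "\<And>f. f \<in> A \<Longrightarrow> \<exists>Z I. (Z, I) \<in> cycle_span H \<and> I - N = f \<and> Q Z"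
    and Q: "Q {}" "\<And>Z Z'. Q Z \<Longrightarrow> Q Z' \<Longrightarrow> Q (sym_diff Z Z')"
  shows "\<exists>Z I. (Z, I) \<in> cycle_span H \<and> I - N = \<Union>A \<and> Q Z"
  using A span
proof (induction A rule: finite_induct)
  case empty
  then show ?case using cycle_span.empty Q by (intro exI[of _ "{}"]) auto
next
  case (insert f A)
  have "disjoint A" using insert.prems(1) by (auto simp: disjoint_def)
  then obtain Z I where ZI: "(Z, I) \<in> cycle_span H" "I - N = \<Union>A" "Q Z"
    using insert.IH insert.prems(2) by blast
  obtain Z' I' where ZI': "(Z', I') \<in> cycle_span H" "I' - N = f" "Q Z'" using insert.prems(2) by blast
  have "f \<inter> \<Union>A = {}" using insert by (auto simp: disjoint_def)
  then have "sym_diff (\<Union>A) f = \<Union>(insert f A)" by auto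
  moreover have "sym_diff I I' - N = sym_diff (I - N) (I' - N)" by auto
  ultimately have "sym_diff I I' - N = \<Union>(insert f A)" using ZI(2) ZI'(2) by simp
  then show ?case using cycle_span_sym_diff[OF ZI(1) ZI'(1)] Q(2)[OF ZI(3) ZI'(3)] by blast
qed


section \<open>How the faces change when an edge is added\<close>

lemma arc_complement_component:
  assumes "e \<in> E" "y \<notin> im e" "z \<notin> im e"
  shows "connected_component (- im e) y z"
proof -
  obtain g where "arc g" "path_image g = im e" using edge_obtain[OF assms(1)] by metis
  then have "connected (- im e)" using connected_arc_complement[of g] by simp
  then show ?thesis using assms unfolding connected_component_def by blast
qed

text \<open>
  By Janiszewski's theorem, an edge added to \<open>H\<close> splits no face if it joins two components, and
  splits faces only along a new cycle otherwise.
\<close>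

lemma bridge_faces:
  assumes H: "H \<subseteq> E" "{u, v} \<in> E" and no_path: "\<nexists>xs. joined_by H xs u v"
    and y: "y \<notin> img (insert {u, v} H)" "z \<notin> img (insert {u, v} H)" "connected_component (- img H) y z"
  shows "connected_component (- img (insert {u, v} H)) y z"
proof -
  \<comment> \<open>\<open>H1\<close> is the part of \<open>H\<close> reachable from
    \<open>u\<close>, \<open>H2\<close> the rest. The new edge meets \<open>H1\<close> at most in
    \<open>p u\<close>, and both together meet \<open>H2\<close> at most in \<open>p v\<close>, so
    Janiszewski's theorem applies twice, with connected intersections.\<close>
  define H1 where "H1 = {e \<in> H. \<exists>w\<in>e. \<exists>xs. joined_by H xs u w}"
  define H2 where "H2 = H - H1"
  have reach: "\<exists>xs. joined_by H xs u w" if ew: "e \<in> H1" "w \<in> e" for e w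
  proof -
    obtain w' xs where w': "w' \<in> e" "joined_by H xs u w'" "e \<in> H" using ew(1) by (auto simp: H1_def)
    show ?thesis
    proof (cases "w = w'")
      case False
      then have "{w', w} = e" using two[of e] H w' ew(2) by (auto simp: card_2_iff)
      then show ?thesis using joined_by_step[OF w'(2)] w'(3) by metis
    qed (use w' in blast)
  qed
  have noreach: "\<not> (\<exists>xs. joined_by H xs u w)" if "e \<in> H2" "w \<in> e" for e w
    using that by (auto simp: H2_def H1_def)
  let ?e = "{u, v}"
  have H12: "H1 \<subseteq> E" "H2 \<subseteq> E" "H = H1 \<union> H2" using H by (auto simp: H1_def H2_def)
  have v1: "v \<notin> e" if "e \<in> H1" for e using reach[OF that] no_path by blast
  have u2: "u \<notin> e" if "e \<in> H2" for e using noreach[OF that] joined_by_refl by metis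
  have disj: "e1 \<inter> e2 = {}" if "e1 \<in> H1" "e2 \<in> H2" for e1 e2 using reach[OF that(1)] noreach[OF that(2)] by blast
  have eH: "?e \<notin> H1" "?e \<notin> H2" using v1 u2 by blast+
  have i1: "im ?e \<inter> img H1 \<subseteq> {p u}"
  proof -
    have "im ?e \<inter> im f \<subseteq> {p u}" if "f \<in> H1" for f
    proof -
      have "im ?e \<inter> im f \<subseteq> p ` (?e \<inter> f)" using that H12 H eH by (intro im_Int_subset) auto
      then show ?thesis using v1[OF that] by blast
    qed
    then show ?thesis by blast
  qed
  have i2: "(im ?e \<union> img H1) \<inter> img H2 \<subseteq> {p v}"
  proof -
    have "im ?e \<inter> im f \<subseteq> {p v}" if "f \<in> H2" for f
    proof -
      have "im ?e \<inter> im f \<subseteq> p ` (?e \<inter> f)" using that H12 H eH by (intro im_Int_subset) auto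
      then show ?thesis using u2[OF that] by blast
    qed
    moreover have "im e \<inter> im f = {}" if "e \<in> H1" "f \<in> H2" for e f
    proof -
      have "e \<noteq> f" using that by (auto simp: H2_def)
      then have "im e \<inter> im f \<subseteq> p ` (e \<inter> f)" using that H12 by (intro im_Int_subset) auto
      then show ?thesis using disj[OF that] by blast
    qed
    ultimately show ?thesis by blast
  qed
  have cs: "connected S" if "S \<subseteq> {a}" for S and a :: complex
    using that by (auto simp: subset_singleton_iff)
  have c1: "connected_component (- (im ?e \<union> img H1)) y z"
  proof (rule Janiszewski)
    show "compact (im ?e)" "closed (img H1)" using compact_im H compact_img[OF H12(1)] compact_imp_closed by auto
    show "connected (im ?e \<inter> img H1)" using cs i1 by blast
    show "connected_component (- im ?e) y z" using y H by (intro arc_complement_component) auto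
    show "connected_component (- img H1) y z" using y(3) by (rule connected_component_of_subset) (use H12 in auto)
  qed
  have "connected_component (- ((im ?e \<union> img H1) \<union> img H2)) y z"
  proof (rule Janiszewski)
    show "compact (im ?e \<union> img H1)" "closed (img H2)"
      using compact_im H compact_img[OF H12(1)] compact_img[OF H12(2)] compact_imp_closed by auto
    show "connected ((im ?e \<union> img H1) \<inter> img H2)" using cs i2 by blast
    show "connected_component (- img H2) y z" using y(3) by (rule connected_component_of_subset) (use H12 in auto)
  qed (rule c1)
  moreover have "(im ?e \<union> img H1) \<union> img H2 = img (insert ?e H)" using H12(3) by auto
  ultimately show ?thesis by simp
qed

lemma cycle_component_same_side:
  assumes C: "is_cycle C" "C \<subseteq> E" and yz: "y \<notin> img C" "z \<notin> img C" "y \<in> inside (img C) \<longleftrightarrow> z \<in> inside (img C)"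
  shows "connected_component (- img C) y z"
proof (cases "y \<in> inside (img C)")
  case True
  then show ?thesis using yz Jordan_cycle(1)[OF C] inside_no_overlap[of "img C"] unfolding connected_component_def by blast
next
  case False
  then have "y \<in> outside (img C)" "z \<in> outside (img C)" using yz inside_Un_outside[of "img C"] by blast+
  then show ?thesis using Jordan_cycle(2)[OF C] outside_no_overlap[of "img C"] unfolding connected_component_def by blast
qed

text \<open>The new edge meets \<open>img H\<close> in its two ends, which is not a connected set.
  So the theorem is applied to \<open>img H\<close> and the whole cycle \<open>img C\<close>, which
  meet in the arc of the old path \<open>xs\<close>.\<close>

lemma chord_faces:
  assumes H: "H \<subseteq> E" "{u, v} \<in> E" "{u, v} \<notin> H" "u \<noteq> v" and xs: "joined_by H xs u v"
    and C: "C = insert {u, v} (path_edges xs)"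
    and yz: "y \<notin> img (insert {u, v} H)" "z \<notin> img (insert {u, v} H)" "connected_component (- img H) y z"
      "y \<in> inside (img C) \<longleftrightarrow> z \<in> inside (img C)"
  shows "connected_component (- img (insert {u, v} H)) y z"
proof -
  have len: "3 \<le> length xs" using cycle_closing_path[OF xs H(3,4)] .
  have C': "C = cycle_edges xs" using xs C by (auto simp: cycle_edges_def joined_by_def insert_commute)
  have PH: "path_edges xs \<subseteq> H" using xs by (simp add: joined_by_def)
  have cyc: "is_cycle C" using len xs C' by (auto simp: is_cycle_def joined_by_def)
  have cyc: "is_cycle C" "C \<subseteq> E" using cyc C H PH by auto
  obtain g where g: "arc g" "pathstart g = p u" "pathfinish g = p v" "path_image g = img (path_edges xs)"
    using arc_of_path[of xs] xs len H PH by (auto simp: joined_by_def)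
  have "im {u, v} \<inter> im f \<subseteq> img (path_edges xs)" if "f \<in> H" for f
  proof -
    have "im {u, v} \<inter> im f \<subseteq> p ` ({u, v} \<inter> f)" using that H by (intro im_Int_subset) auto
    also have "\<dots> \<subseteq> {p u, p v}" by blast
    also have "\<dots> \<subseteq> path_image g" using pathstart_in_path_image[of g] pathfinish_in_path_image[of g] g by simp
    finally show ?thesis using g by simp
  qed
  then have "im {u, v} \<inter> img H \<subseteq> img (path_edges xs)" by auto
  moreover have "img C = im {u, v} \<union> img (path_edges xs)" "img (path_edges xs) \<subseteq> img H" using PH C by auto
  ultimately have "img H \<inter> img C = img (path_edges xs)" by auto
  then have conn: "connected (img H \<inter> img C)" using g connected_arc_image by metis
  have "connected_component (- (img H \<union> img C)) y z"
  proof (rule Janiszewski[OF _ _ conn yz(3)])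
    show "compact (img H)" using compact_img H by simp
    show "closed (img C)" using compact_img[OF cyc(2)] compact_imp_closed by blast
    show "connected_component (- img C) y z"
      using yz C PH by (intro cycle_component_same_side[OF cyc]) auto
  qed
  moreover have "img H \<union> img C = img (insert {u, v} H)" using C PH by auto
  ultimately show ?thesis by simp
qed


lemma component_of:
  assumes "f \<in> components S" "z \<in> f"
  shows "f = connected_component_set S z"
  using assms by (metis components_iff connected_component_eq)

text \<open>If the edge closes a cycle \<open>C\<close>, only one old face is divided. Its part
  inside \<open>C\<close> is the inside of \<open>C\<close> plus the other faces inside
  \<open>C\<close>; its part outside is the old face plus the first part. Points on the drawing are
  disregarded, hence the form \<open>I - img H = f\<close>.\<close>

lemma faces_in_span:
  assumes "H \<subseteq> E"
  shows "finite (components (- img H)) \<and>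
    (\<forall>f\<in>components (- img H). bounded f \<longrightarrow> (\<exists>Z I. (Z, I) \<in> cycle_span H \<and> I - img H = f))"
  using finite_subset[OF assms finE] assms
proof (induction H rule: finite_induct)
  case empty
  show ?case using not_bounded_UNIV by simp
next
  case (insert e H)
  have HE: "H \<subseteq> E" "e \<in> E" using insert.prems by auto
  have fin: "finite (components (- img H))"
    and span: "\<And>f. f \<in> components (- img H) \<Longrightarrow> bounded f \<Longrightarrow> \<exists>Z I. (Z, I) \<in> cycle_span H \<and> I - img H = f"
    using insert.IH HE by auto
  let ?G = "insert e H"
  let ?K = "img ?G"
  have KH: "img H \<subseteq> ?K" by auto
  obtain u v h where uv: "e = {u, v}" "u \<noteq> v" and h: "arc h" "pathstart h = p u" "pathfinish h = p v" "path_image h = im e"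
    using edge_obtain[OF HE(2)] by metis
  have parent: "\<exists>f\<in>components (- img H). f' = connected_component_set (- ?K) z \<and> f = connected_component_set (- img H) z \<and> z \<in> f \<and> z \<in> f' \<and> z \<notin> ?K \<and> f' \<subseteq> f"
    if "f' \<in> components (- ?K)" "z \<in> f'" for f' z
  proof -
    have f': "f' = connected_component_set (- ?K) z" using component_of[OF that] .
    have zK: "z \<notin> ?K" using in_components_subset[OF that(1)] that(2) by blast
    have "f' \<subseteq> connected_component_set (- img H) z"
      unfolding f' by (rule connected_component_mono) (use KH in blast)
    moreover have "connected_component_set (- img H) z \<in> components (- img H)"
      unfolding components_def using zK by auto
    ultimately show ?thesis using f' zK that(2) by blast
  qed
  show ?case
  proof (cases "\<exists>xs. joined_by H xs u v")
    case False
    have face: "\<exists>f\<in>components (- img H). f' = f - ?K" if f': "f' \<in> components (- ?K)" for f'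
    proof -
      obtain z where z: "z \<in> f'" using in_components_nonempty[OF f'] by blast
      obtain f where f: "f \<in> components (- img H)" "f' = connected_component_set (- ?K) z" "f = connected_component_set (- img H) z"
        "z \<notin> ?K" "f' \<subseteq> f" using parent[OF f' z] by blast
      have sub: "f - ?K \<subseteq> f'"
      proof
        fix y assume "y \<in> f - ?K"
        then show "y \<in> f'" using bridge_faces[of H u v z y] HE False f uv by auto
      qed
      have "f' = f - ?K"
        using sub f(5) in_components_subset[OF f'] by blast
      with f(1) show ?thesis by blast
    qed
    have "components (- ?K) \<subseteq> (\<lambda>f. f - ?K) ` components (- img H)" using face by blast
    then have "finite (components (- ?K))" using fin finite_surj by blast
    moreover have "\<exists>Z I. (Z, I) \<in> cycle_span ?G \<and> I - ?K = f'" if f': "f' \<in> components (- ?K)" "bounded f'" for f'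
    proof -
      obtain f where f: "f \<in> components (- img H)" "f' = f - ?K" using face[OF f'(1)] by blast
      have "bounded ?K" using HE by (intro compact_imp_bounded compact_img) simp
      then have "bounded (f' \<union> ?K)" using f'(2) by simp
      moreover have "f \<subseteq> f' \<union> ?K" using f(2) by blast
      ultimately have "bounded f" by (rule bounded_subset)
      then obtain Z I where ZI: "(Z, I) \<in> cycle_span H" "I - img H = f" using span f by blast
      have "I - ?K = f'" using ZI(2) f(2) KH by blast
      then show ?thesis using cycle_span_mono[OF ZI(1), of ?G] by blast
    qed
    ultimately show ?thesis by blast
  next
    case True
    then obtain xs where xs: "joined_by H xs u v" by blast
    have eH: "{u, v} \<notin> H" using insert.hyps uv by simp
    have len: "3 \<le> length xs" using cycle_closing_path[OF xs eH uv(2)] .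
    define C where "C = insert {u, v} (path_edges xs)"
    have C': "C = cycle_edges xs" using xs by (auto simp: C_def cycle_edges_def joined_by_def insert_commute)
    have PH: "path_edges xs \<subseteq> H" using xs by (simp add: joined_by_def)
    have cyc: "is_cycle C" using len xs C' by (auto simp: is_cycle_def joined_by_def)
    have CG: "C \<subseteq> ?G" "C \<subseteq> E" using PH HE uv by (auto simp: C_def)
    have imgC: "img C \<subseteq> ?K" "im e \<subseteq> img C" using CG uv by (auto simp: C_def)
    let ?In = "inside (img C)" and ?Out = "outside (img C)"
    have InOut: "?In \<inter> img C = {}" "?Out \<inter> img C = {}" "?In \<inter> ?Out = {}" "?In \<union> ?Out = - img C" by simp_all
    have face: "\<exists>f\<in>components (- img H). f' = f \<inter> ?In \<or> f' = f \<inter> ?Out" if f': "f' \<in> components (- ?K)" for f'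
    proof -
      obtain z where z: "z \<in> f'" using in_components_nonempty[OF f'] by blast
      obtain f where f: "f \<in> components (- img H)" "f' = connected_component_set (- ?K) z" "f = connected_component_set (- img H) z"
        "z \<notin> ?K" "f' \<subseteq> f" using parent[OF f' z] by blast
      have fH: "f \<inter> img H = {}" using in_components_subset[OF f(1)] by blast
      have side: "y \<in> f'" if "y \<in> f" "y \<notin> img C" "z \<in> ?In \<longleftrightarrow> y \<in> ?In" for y
      proof -
        have "y \<notin> ?K" using that fH imgC by auto
        then show ?thesis using chord_faces[of H u v xs C z y] HE eH uv xs C_def that f by auto
      qed
      have same: "z \<in> ?In \<longleftrightarrow> y \<in> ?In" "y \<notin> img C" if "y \<in> f'" for y
      proof -
        have "connected_component (- img C) z y"
          using that unfolding f(2) mem_Collect_eq by (rule connected_component_of_subset) (use imgC in blast)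
        then show "z \<in> ?In \<longleftrightarrow> y \<in> ?In" using inside_same_component connected_component_sym by metis
        show "y \<notin> img C" using that in_components_subset[OF f'] imgC by blast
      qed
      show ?thesis
      proof (cases "z \<in> ?In")
        case True
        then have "f' = f \<inter> ?In" using side same f(5) InOut(1) by blast
        then show ?thesis using f(1) by blast
      next
        case False
        have "f' = f \<inter> ?Out"
        proof (intro equalityI subsetI)
          fix y assume "y \<in> f'"
          then have "y \<in> f" "y \<notin> ?In" "y \<in> - img C" using same[of y] False f(5) by auto
          then show "y \<in> f \<inter> ?Out" unfolding InOut(4)[symmetric] by blast
        next
          fix y assume y: "y \<in> f \<inter> ?Out"
          then have "y \<notin> img C" "y \<notin> ?In" using InOut(2,3) by blast+
          then show "y \<in> f'" using side[of y] y False by blast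
        qed
        then show ?thesis using f(1) by blast
      qed
    qed
    have "components (- ?K) \<subseteq> (\<lambda>f. f \<inter> ?In) ` components (- img H) \<union> (\<lambda>f. f \<inter> ?Out) ` components (- img H)"
      using face by blast
    then have finK: "finite (components (- ?K))" using fin by (meson finite_Un finite_imageI finite_subset)
    have uvH: "p u \<in> img H" "p v \<in> img H"
    proof -
      obtain g where g: "arc g" "pathstart g = p u" "pathfinish g = p v" "path_image g = img (path_edges xs)"
        using arc_of_path[of xs] xs len HE PH by (auto simp: joined_by_def)
      have "p u \<in> img (path_edges xs)" "p v \<in> img (path_edges xs)"
        using pathstart_in_path_image[of g] pathfinish_in_path_image[of g] unfolding g(2-4) .
      then show "p u \<in> img H" "p v \<in> img H" using PH by blast+
    qed
    \<comment> \<open>The open arc of \<open>e\<close> is connected and misses \<open>img H\<close>,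
      so it lies in a single old face \<open>gs\<close>; all other faces keep to one side of
      \<open>C\<close>.\<close>
    define A where "A = im e - {p u, p v}"
    have connA: "connected A" "A \<noteq> {}"
      using connected_simple_path_endless[of h] nonempty_simple_path_endless[of h] h arc_imp_simple_path[of h] by (auto simp: A_def)
    have AH: "A \<subseteq> - img H"
    proof -
      have "im e \<inter> im f \<subseteq> {p u, p v}" if "f \<in> H" for f
      proof -
        have "im e \<inter> im f \<subseteq> p ` (e \<inter> f)" using that HE eH uv by (intro im_Int_subset) auto
        then show ?thesis using uv by blast
      qed
      then show ?thesis by (auto simp: A_def)
    qed
    then obtain gs where gs: "gs \<in> components (- img H)" "A \<subseteq> gs"
      using exists_component_superset[of A "- img H"] connA by blast
    have off: "f \<inter> im e = {}" "f \<subseteq> ?In \<or> f \<subseteq> ?Out" if f: "f \<in> components (- img H)" "f \<noteq> gs" for f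
    proof -
      have "f \<inter> gs = {}" using components_eq[OF f(1) gs(1)] f(2) by blast
      moreover have "f \<inter> img H = {}" using in_components_subset[OF f(1)] by blast
      moreover have "im e \<subseteq> insert (p u) (insert (p v) gs)" using gs(2) unfolding A_def by blast
      moreover have "p u \<notin> f" "p v \<notin> f" using uvH in_components_subset[OF f(1)] by blast+
      ultimately show fe: "f \<inter> im e = {}" by blast
      have "img C \<subseteq> im e \<union> img H" using PH uv by (auto simp: C_def)
      then have fC: "f \<subseteq> - img C" using fe \<open>f \<inter> img H = {}\<close> by blast
      have all_in: "y \<in> ?In" if "x \<in> f" "x \<in> ?In" "y \<in> f" for x y
      proof -
        have "connected_component (- img C) x y"
          unfolding connected_component_def using that fC in_components_connected[OF f(1)] by blast
        then show ?thesis using inside_same_component that by metis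
      qed
      have "f \<subseteq> ?In \<union> ?Out" unfolding InOut(4) by (rule fC)
      then have "f \<subseteq> ?Out" if "\<not> (\<exists>x\<in>f. x \<in> ?In)" using that by blast
      moreover have "f \<subseteq> ?In" if "\<exists>x\<in>f. x \<in> ?In" using that all_in by blast
      ultimately show "f \<subseteq> ?In \<or> f \<subseteq> ?Out" by metis
    qed
    have inner: "\<exists>Z I. (Z, I) \<in> cycle_span ?G \<and> I - ?K = gs \<inter> ?In"
    proof -
      define GG where "GG = {g \<in> components (- img H). g \<noteq> gs \<and> g \<subseteq> ?In}"
      have "finite GG" using fin by (simp add: GG_def)
      moreover have "disjoint GG"
        unfolding disjoint_def GG_def using components_eq by blast
      moreover have "\<exists>Z I. (Z, I) \<in> cycle_span H \<and> I - img H = g \<and> True" if "g \<in> GG" for g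
        using span[of g] that bounded_subset[OF Jordan_cycle(3)[OF cyc CG(2)], of g] by (auto simp: GG_def)
      ultimately obtain Z I where ZI: "(Z, I) \<in> cycle_span H" "I - img H = \<Union>GG"
        using span_of_union[of GG H "img H" "\<lambda>_. True"] by blast
      have "(sym_diff C Z, sym_diff ?In I) \<in> cycle_span ?G"
        using cycle_span_sym_diff[OF cycle_span_cycle[OF cyc CG(1)] cycle_span_mono[OF ZI(1)]] by blast
      moreover have "sym_diff ?In I - ?K = gs \<inter> ?In"
      proof -
        have K: "?K = img H \<union> im e" by auto
        have GGe: "\<Union>GG \<inter> im e = {}" using off(1) by (auto simp: GG_def)
        have "I - ?K = (I - img H) - im e" unfolding K by (rule set_eqI) (simp only: Diff_iff Un_iff de_Morgan_disj conj_assoc)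
        then have IK: "I - ?K = \<Union>GG" unfolding ZI(2) using GGe by blast
        have InK: "?In - ?K = (gs \<inter> ?In) \<union> \<Union>GG"
        proof
          show "?In - ?K \<subseteq> (gs \<inter> ?In) \<union> \<Union>GG"
          proof
            fix x assume x: "x \<in> ?In - ?K"
            then have "x \<in> \<Union>(components (- img H))" using KH by (simp add: Union_components[symmetric])
            then obtain g where g: "g \<in> components (- img H)" "x \<in> g" by blast
            show "x \<in> (gs \<inter> ?In) \<union> \<Union>GG"
            proof (cases "g = gs")
              case False
              then have "g \<subseteq> ?In" using off(2)[OF g(1) False] x g(2) InOut(3) by blast
              then show ?thesis using g False by (auto simp: GG_def)
            qed (use x g in blast)
          qed
          have "gs \<inter> img H = {}" using in_components_subset[OF gs(1)] by blast
          moreover have "?In \<inter> im e = {}" using InOut(1) imgC(2) by blast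
          ultimately have "gs \<inter> ?In \<inter> ?K = {}" unfolding K by blast
          moreover have "\<Union>GG \<subseteq> ?In" "\<Union>GG \<inter> ?K = {}" using \<open>I - ?K = \<Union>GG\<close> by (auto simp: GG_def)
          ultimately show "(gs \<inter> ?In) \<union> \<Union>GG \<subseteq> ?In - ?K" by blast
        qed
        have disj: "(gs \<inter> ?In) \<inter> \<Union>GG = {}" using components_eq[OF gs(1)] by (auto simp: GG_def)
        have sd: "sym_diff P Q - R = X" if "Q - R = Y" "P - R = X \<union> Y" "X \<inter> Y = {}" for P Q R X Y :: "complex set"
          using that by blast
        show ?thesis by (rule sd[OF IK InK disj])
      qed
      ultimately show ?thesis by blast
    qed
    have "\<exists>Z I. (Z, I) \<in> cycle_span ?G \<and> I - ?K = f'" if f': "f' \<in> components (- ?K)" "bounded f'" for f'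
    proof -
      obtain f where f: "f \<in> components (- img H)" "f' = f \<inter> ?In \<or> f' = f \<inter> ?Out" using face[OF f'(1)] by blast
      have ne: "f' \<noteq> {}" using in_components_nonempty[OF f'(1)] .
      show ?thesis
      proof (cases "f = gs")
        case False
        have "f' = f" using off(2)[OF f(1) False] f(2) ne InOut(3) by blast
        then obtain Z I where ZI: "(Z, I) \<in> cycle_span H" "I - img H = f" using span f f'(2) by blast
        have "I - ?K = f'" using ZI(2) \<open>f' = f\<close> off(1)[OF f(1) False] by auto
        then show ?thesis using cycle_span_mono[OF ZI(1), of ?G] by blast
      next
        case True
        show ?thesis
        proof (cases "f' = f \<inter> ?In")
          case False
          then have fo: "f' = gs \<inter> ?Out" using f True by simp
          \<comment> \<open>If the outer part is bounded, so is the whole of \<open>gs\<close>,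
            because the rest of it lies in \<open>?In\<close> or on \<open>img C\<close>; hence the
            induction hypothesis covers \<open>gs\<close>.\<close>
          have "bounded (f' \<union> ?In \<union> img C)"
            using f'(2) Jordan_cycle(3)[OF cyc CG(2)] compact_img[OF CG(2)] compact_imp_bounded by simp
          moreover have "gs \<subseteq> f' \<union> ?In \<union> img C" using fo InOut(4) by blast
          ultimately have "bounded gs" using bounded_subset by blast
          then obtain Z I where ZI: "(Z, I) \<in> cycle_span H" "I - img H = gs" using span gs by blast
          obtain Z' I' where ZI': "(Z', I') \<in> cycle_span ?G" "I' - ?K = gs \<inter> ?In" using inner by blast
          have "(sym_diff Z Z', sym_diff I I') \<in> cycle_span ?G"
            using cycle_span_sym_diff[OF cycle_span_mono[OF ZI(1)] ZI'(1)] by blast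
          moreover have "sym_diff I I' - ?K = f'"
          proof -
            have K: "?K = img H \<union> im e" by auto
            have "I - ?K = (I - img H) - im e" unfolding K by (rule set_eqI) (simp only: Diff_iff Un_iff de_Morgan_disj conj_assoc)
            then have "I - ?K = gs - im e" unfolding ZI(2) .
            also have "\<dots> = (gs \<inter> ?In) \<union> (gs \<inter> ?Out)"
            proof
              have CeH: "img C \<subseteq> im e \<union> img H" using PH uv by (auto simp: C_def)
              have gsH: "gs \<inter> img H = {}" using in_components_subset[OF gs(1)] by blast
              have "P - Q \<subseteq> P \<inter> - R" if "R \<subseteq> Q \<union> N" "P \<inter> N = {}" for P Q R N :: "complex set"
                using that by blast
              from this[OF CeH gsH] have "gs - im e \<subseteq> gs \<inter> - img C" .
              then show "gs - im e \<subseteq> (gs \<inter> ?In) \<union> (gs \<inter> ?Out)" unfolding Int_Un_distrib[symmetric] InOut(4) .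
              have dj: "P \<inter> Q = {}" if "P \<inter> R = {}" "Q \<subseteq> R" for P Q R :: "complex set"
                using that by blast
              show "(gs \<inter> ?In) \<union> (gs \<inter> ?Out) \<subseteq> gs - im e"
                using dj[OF InOut(1) imgC(2)] dj[OF InOut(2) imgC(2)] by blast
            qed
            finally have IK: "I - ?K = (gs \<inter> ?In) \<union> (gs \<inter> ?Out)" .
            have disj: "(gs \<inter> ?In) \<inter> (gs \<inter> ?Out) = {}" using InOut(3) by blast
            have sd: "sym_diff P Q - R = Y" if "P - R = X \<union> Y" "Q - R = X" "X \<inter> Y = {}" for P Q R X Y :: "complex set"
              using that by blast
            show ?thesis unfolding fo by (rule sd[OF IK ZI'(2) disj])
          qed
          ultimately show ?thesis by metis
        qed (use inner True in blast)
      qed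
    qed
    then show ?thesis using finK by blast
  qed
qed


section \<open>The cycles on the boundaries of the bounded faces\<close>

text \<open>The sum of a family of edge sets in the cycle space.\<close>

definition modsum :: "'a set set set \<Rightarrow> 'a set set" where
  "modsum D = {e. odd (card {C \<in> D. e \<in> C})}"

lemma modsum_sym_diff:
  assumes "finite D" "finite D'"
  shows "modsum (sym_diff D D') = sym_diff (modsum D) (modsum D')"
proof -
  have "even (card {C \<in> sym_diff D D'. e \<in> C}) \<longleftrightarrow> (even (card {C \<in> D. e \<in> C}) \<longleftrightarrow> even (card {C \<in> D'. e \<in> C}))" for e
  proof -
    have "{C \<in> sym_diff D D'. e \<in> C} = sym_diff {C \<in> D. e \<in> C} {C \<in> D'. e \<in> C}" by auto
    then show ?thesis using card_even_sym_diff[of "{C \<in> D. e \<in> C}" "{C \<in> D'. e \<in> C}"] assms by simp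
  qed
  then show ?thesis unfolding modsum_def by auto
qed

lemma modsum_disjoint:
  assumes "disjoint D"
  shows "modsum D = \<Union>D"
proof -
  have "odd (card {C \<in> D. e \<in> C}) \<longleftrightarrow> (\<exists>C\<in>D. e \<in> C)" for e
  proof (cases "\<exists>C\<in>D. e \<in> C")
    case True
    then obtain C where "C \<in> D" "e \<in> C" by blast
    then have "{C \<in> D. e \<in> C} = {C}" using assms by (auto simp: disjoint_def)
    then have "card {C \<in> D. e \<in> C} = 1" by simp
    then show ?thesis using True by simp
  next
    case False
    then have "{C \<in> D. e \<in> C} = {}" by blast
    then have "card {C \<in> D. e \<in> C} = 0" by (simp only: card.empty)
    then show ?thesis using False by simp
  qed
  then show ?thesis unfolding modsum_def by auto
qed

text \<open>
  Decomposing the boundaries of the bounded faces into cycles gives a family that generates all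
  even sets, and there are at least \<open>2 ^ (card E + 1 - card U)\<close> of these.
\<close>

theorem facial_cycles:
  assumes U: "finite U" "\<Union>E \<subseteq> U" "U \<noteq> {}"
  shows "\<exists>CC. finite CC \<and> (\<forall>C\<in>CC. is_cycle C \<and> C \<subseteq> E) \<and> (\<forall>e\<in>E. card {C \<in> CC. e \<in> C} \<le> 2) \<and>
    card E + 1 \<le> card U + card CC"
proof -
  define F where "F = {f \<in> components (- img E). bounded f}"
  have finF: "finite F" using faces_in_span[of E] by (simp add: F_def)
  have disjF: "disjoint F" unfolding disjoint_def F_def using components_eq by blast
  have "\<forall>f\<in>F. \<exists>Z. \<exists>I. (Z, I) \<in> cycle_span E \<and> I - img E = f"
    using faces_in_span[of E] by (simp add: F_def)
  from bchoice[OF this] obtain Z where "\<forall>f\<in>F. \<exists>I. (Z f, I) \<in> cycle_span E \<and> I - img E = f" ..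
  from bchoice[OF this] obtain I where "\<forall>f\<in>F. (Z f, I f) \<in> cycle_span E \<and> I f - img E = f" ..
  then have ZI: "(Z f, I f) \<in> cycle_span E" "I f - img E = f" if "f \<in> F" for f using that by simp_all
  have Zf: "Z f \<subseteq> E" "finite (Z f)" "even_degrees (Z f)" if "f \<in> F" for f
    using cycle_span_edges[OF ZI(1)[OF that]] by auto
  have "\<forall>f\<in>F. \<exists>D. (\<forall>C\<in>D. is_cycle C) \<and> \<Union>D = Z f \<and> disjoint D"
  proof
    fix f assume f: "f \<in> F"
    show "\<exists>D. (\<forall>C\<in>D. is_cycle C) \<and> \<Union>D = Z f \<and> disjoint D"
      using Zf[OF f] two by (intro even_degrees_decompose) auto
  qed
  from bchoice[OF this] obtain D where D': "\<forall>f\<in>F. (\<forall>C\<in>D f. is_cycle C) \<and> \<Union>(D f) = Z f \<and> disjoint (D f)" ..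
  have D: "is_cycle C" if "f \<in> F" "C \<in> D f" for f C using D' that by simp
  have DZ: "\<Union>(D f) = Z f" "disjoint (D f)" if "f \<in> F" for f using D' that by simp_all
  have finD: "finite (D f)" if "f \<in> F" for f using DZ(1)[OF that] Zf(2)[OF that] finite_UnionD by metis
  define CC where "CC = (\<Union>f\<in>F. D f)"
  have finCC: "finite CC" using finF finD by (simp add: CC_def)
  have cyc: "is_cycle C \<and> C \<subseteq> E" if C: "C \<in> CC" for C
  proof -
    obtain f where f: "f \<in> F" "C \<in> D f" using C by (auto simp: CC_def)
    then show ?thesis using D[OF f] DZ(1)[OF f(1)] Zf(1)[OF f(1)] by blast
  qed
  have two_faces: "card {C \<in> CC. e \<in> C} \<le> 2" for e
  proof (cases "\<exists>C\<in>CC. e \<in> C")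
    case True
    then obtain C0 where "is_cycle C0" "C0 \<subseteq> E" "e \<in> C0" using cyc by blast
    from jump[OF this] obtain z1 z2 where z: "z1 \<notin> img E" "z2 \<notin> img E"
      "\<And>Z I. (Z, I) \<in> cycle_span E \<Longrightarrow> e \<in> Z \<longleftrightarrow> (z1 \<in> I) \<noteq> (z2 \<in> I)" by blast
    \<comment> \<open>If \<open>e\<close> is in the boundary \<open>Z f\<close>, then
      \<open>f\<close> contains one of \<open>z1\<close>, \<open>z2\<close>, so it is the face of
      that point. As \<open>D f\<close> is disjoint, each of these two faces contributes at most one
      cycle through \<open>e\<close>, namely \<open>c z1\<close> or \<open>c z2\<close>.\<close>
    define c where "c z = (THE C. C \<in> D (connected_component_set (- img E) z) \<and> e \<in> C)" for z
    have "{C \<in> CC. e \<in> C} \<subseteq> {c z1, c z2}"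
    proof
      fix C assume "C \<in> {C \<in> CC. e \<in> C}"
      then obtain f where f: "f \<in> F" "C \<in> D f" "e \<in> C" by (auto simp: CC_def)
      then have "e \<in> Z f" using DZ(1)[OF f(1)] by blast
      then have "z1 \<in> I f \<or> z2 \<in> I f" using z(3)[OF ZI(1)[OF f(1)]] by blast
      then obtain z where zz: "z = z1 \<or> z = z2" "z \<in> f" using ZI(2)[OF f(1)] z(1,2) by blast
      have "f = connected_component_set (- img E) z" using component_of[OF _ zz(2)] f(1) by (simp add: F_def)
      moreover have "(THE C. C \<in> D f \<and> e \<in> C) = C"
        using f DZ(2)[OF f(1)] by (intro the_equality) (auto simp: disjoint_def)
      ultimately have "c z = C" by (simp add: c_def)
      then show "C \<in> {c z1, c z2}" using zz(1) by blast
    qed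
    then have "card {C \<in> CC. e \<in> C} \<le> card {c z1, c z2}" by (intro card_mono) auto
    also have "\<dots> \<le> 2" by (simp add: card_insert_if)
    finally show ?thesis .
  next
    case False
    then have "{C \<in> CC. e \<in> C} = {}" by blast
    then have "card {C \<in> CC. e \<in> C} = 0" by (simp only: card.empty)
    then show ?thesis by simp
  qed
  have gen: "B \<in> modsum ` Pow CC" if B: "B \<subseteq> E" "even_degrees B" for B
  proof -
    obtain J where J: "(B, J) \<in> cycle_span E" using even_degrees_in_span[OF B(1) order_refl B(2)] by blast
    have bJ: "bounded J" using cycle_span_edges[OF J] by blast
    \<comment> \<open>Off \<open>img E\<close> the set \<open>J\<close> is the union of these faces,
      so the sum of their boundaries encloses the same points as \<open>B\<close> does.\<close>
    define A where "A = {f \<in> F. f \<subseteq> J}"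
    have "\<exists>Z I. (Z, I) \<in> cycle_span E \<and> I - img E = \<Union>A \<and> Z \<in> modsum ` Pow CC"
    proof (rule span_of_union)
      show "finite A" "disjoint A" using finF disjF by (auto simp: A_def disjoint_def)
      show "\<exists>Z I. (Z, I) \<in> cycle_span E \<and> I - img E = f \<and> Z \<in> modsum ` Pow CC" if "f \<in> A" for f
      proof -
        have f: "f \<in> F" using that by (simp add: A_def)
        have "Z f = modsum (D f)" using modsum_disjoint[OF DZ(2)[OF f]] DZ(1)[OF f] by simp
        moreover have "D f \<subseteq> CC" using f by (auto simp: CC_def)
        ultimately show ?thesis using ZI[OF f] by blast
      qed
      show "{} \<in> modsum ` Pow CC" by (rule image_eqI[of _ _ "{}"]) (simp_all add: modsum_def)
      show "sym_diff Z Z' \<in> modsum ` Pow CC" if Z: "Z \<in> modsum ` Pow CC" "Z' \<in> modsum ` Pow CC" for Z Z'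
      proof -
        obtain X X' where X: "X \<subseteq> CC" "Z = modsum X" "X' \<subseteq> CC" "Z' = modsum X'" using Z by blast
        then have "modsum (sym_diff X X') = sym_diff Z Z'" using modsum_sym_diff finCC finite_subset by metis
        moreover have "sym_diff X X' \<subseteq> CC" using X by blast
        ultimately show ?thesis by (metis PowI imageI)
      qed
    qed
    then obtain Y J' where Y: "(Y, J') \<in> cycle_span E" "J' - img E = \<Union>A" "Y \<in> modsum ` Pow CC" by blast
    have "J - img E = \<Union>A"
    proof (intro equalityI subsetI)
      fix x assume x: "x \<in> J - img E"
      let ?f = "connected_component_set (- img E) x"
      have "?f \<subseteq> J" using cycle_span_component[OF J] x by blast
      moreover have "?f \<in> components (- img E)" "x \<in> ?f" using x by (auto simp: components_def)
      ultimately show "x \<in> \<Union>A" using bounded_subset[OF bJ] by (auto simp: A_def F_def)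
    next
      fix x assume "x \<in> \<Union>A"
      then obtain f where f: "x \<in> f" "f \<in> components (- img E)" "f \<subseteq> J" by (auto simp: A_def F_def)
      then show "x \<in> J - img E" using in_components_subset[OF f(2)] by blast
    qed
    then have nd: "x \<in> J \<longleftrightarrow> x \<in> J'" if "x \<notin> img E" for x using Y(2) that by blast
    define X K where "X = sym_diff B Y" and "K = sym_diff J J'"
    have sp: "(X, K) \<in> cycle_span E" using cycle_span_sym_diff[OF J Y(1)] by (simp only: X_def K_def)
    have KE: "x \<notin> K" if "x \<notin> img E" for x using nd[OF that] by (auto simp: K_def)
    \<comment> \<open>An edge in the difference would have two points beside it of which exactly one
      is enclosed, but off \<open>img E\<close> nothing is enclosed by \<open>K\<close>.\<close>
    have "X = {}"
    proof (rule ccontr)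
      assume "X \<noteq> {}"
      then obtain e where e: "e \<in> X" by blast
      then obtain C where "is_cycle C" "C \<subseteq> E" "e \<in> C" using cycle_span_edges[OF sp] by blast
      from jump[OF this] obtain z1 z2 where z: "z1 \<notin> img E" "z2 \<notin> img E"
        "\<And>Z I. (Z, I) \<in> cycle_span E \<Longrightarrow> e \<in> Z \<longleftrightarrow> (z1 \<in> I) \<noteq> (z2 \<in> I)" by blast
      show False using z(3)[OF sp] e KE[OF z(1)] KE[OF z(2)] by blast
    qed
    then have "sym_diff B Y = {}" by (simp only: X_def)
    then have "B = Y" by blast
    then show ?thesis using Y(3) by simp
  qed
  have "card {B. B \<subseteq> E \<and> even_degrees B} \<le> card (modsum ` Pow CC)"
    using gen finCC by (intro card_mono) auto
  also have "\<dots> \<le> card (Pow CC)" using finCC by (intro card_image_le) simp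
  finally have "card {B. B \<subseteq> E \<and> even_degrees B} \<le> 2 ^ card CC" using finCC by (simp add: card_Pow)
  then have "2 ^ card U * card {B. B \<subseteq> E \<and> even_degrees B} \<le> 2 ^ card U * 2 ^ card CC" by simp
  then have "2 ^ (card E + 1) \<le> (2::nat) ^ (card U + card CC)"
    using even_degrees_count[OF finE two U] unfolding power_add[symmetric] by (rule order_trans[rotated])
  then have "card E + 1 \<le> card U + card CC" by (simp only: power_increasing_iff one_less_numeral_iff semiring_norm(76))
  then show ?thesis using finCC cyc two_faces by blast
qed


text \<open>Allows \<open>facial_cycles\<close> to be applied to every edge subset, as
  \<open>density\<close> demands.\<close>

lemma plane_subgraph:
  assumes "S \<subseteq> E"
  shows "plane_graph S p im"
proof
  show "finite S" using assms finE finite_subset by blast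
  show "card e = 2" if "e \<in> S" for e using that assms two by blast
  show "inj_on p (\<Union>S)" using inj_p by (rule inj_on_subset) (use assms in blast)
  show "\<exists>g. arc g \<and> pathstart g = p u \<and> pathfinish g = p v \<and> path_image g = im {u, v}" if "{u, v} \<in> S" "u \<noteq> v" for u v
    using that assms edge_arc by blast
  show "im e \<inter> p ` \<Union>S = p ` e" if "e \<in> S" for e
  proof -
    have "p ` \<Union>S \<subseteq> p ` \<Union>E" "p ` e \<subseteq> p ` \<Union>S" using that assms by auto
    then show ?thesis using im_vertices[of e] that assms by blast
  qed
  show "im e \<inter> im f \<subseteq> p ` \<Union>S" if "e \<in> S" "f \<in> S" "e \<noteq> f" for e f
  proof -
    have "im e \<inter> im f \<subseteq> p ` (e \<inter> f)" using that assms by (intro im_Int_subset) auto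
    moreover have "p ` (e \<inter> f) \<subseteq> p ` \<Union>S" using that by auto
    ultimately show ?thesis by blast
  qed
qed

end

section \<open>Planar graphs\<close>

definition edge_set :: "('a, 'b) pre_digraph \<Rightarrow> 'a set set" where
  "edge_set G = (\<lambda>e. {tail G e, head G e}) ` arcs G"

lemma plane_graph_of_planar:
  fixes G :: "('a, 'b) pre_digraph"
  assumes "graph G" "planar G"
  shows "\<exists>p im. plane_graph (edge_set G) p im"
proof -
  interpret graph G by fact
  obtain p \<gamma> where dr: "plane_drawing G p \<gamma>" using assms(2) by (auto simp: planar_def)
  have inj: "inj_on p (verts G)" using dr by (simp add: plane_drawing_def)
  have arcs: "Path_Connected.arc (\<gamma> e)" "pathstart (\<gamma> e) = p (tail G e)" "pathfinish (\<gamma> e) = p (head G e)"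
    "path_image (\<gamma> e) \<inter> p ` verts G = {p (tail G e), p (head G e)}" if "e \<in> arcs G" for e
    using dr that unfolding plane_drawing_def by blast+
  have same: "path_image (\<gamma> e) = path_image (\<gamma> f)" if "e \<in> arcs G" "f \<in> arcs G" "{tail G e, head G e} = {tail G f, head G f}" for e f
  proof -
    have "if {tail G e, head G e} = {tail G f, head G f} then path_image (\<gamma> e) = path_image (\<gamma> f)
        else path_image (\<gamma> e) \<inter> path_image (\<gamma> f) \<subseteq> p ` verts G"
      using dr that(1,2) unfolding plane_drawing_def by blast
    then show ?thesis using that(3) by simp
  qed
  have diff: "path_image (\<gamma> e) \<inter> path_image (\<gamma> f) \<subseteq> p ` verts G" if "e \<in> arcs G" "f \<in> arcs G" "{tail G e, head G e} \<noteq> {tail G f, head G f}" for e f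
  proof -
    have "if {tail G e, head G e} = {tail G f, head G f} then path_image (\<gamma> e) = path_image (\<gamma> f)
        else path_image (\<gamma> e) \<inter> path_image (\<gamma> f) \<subseteq> p ` verts G"
      using dr that(1,2) unfolding plane_drawing_def by blast
    then show ?thesis using that(3) by simp
  qed
  \<comment> \<open>Both arcs of an edge are drawn as the same point set, so either may represent
    it; its curve is reversed where the other direction is asked for.\<close>
  define rep where "rep s = (SOME e. e \<in> arcs G \<and> {tail G e, head G e} = s)" for s
  define im where "im s = path_image (\<gamma> (rep s))" for s
  have rep: "rep s \<in> arcs G" "{tail G (rep s), head G (rep s)} = s" if "s \<in> edge_set G" for s
    using that someI_ex[of "\<lambda>e. e \<in> arcs G \<and> {tail G e, head G e} = s"] by (auto simp: rep_def edge_set_def)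
  have UV: "\<Union>(edge_set G) \<subseteq> verts G" by (auto simp: edge_set_def)
  have imV: "im s \<inter> p ` verts G = p ` s" if "s \<in> edge_set G" for s
  proof -
    have "p ` {tail G (rep s), head G (rep s)} = {p (tail G (rep s)), p (head G (rep s))}" by simp
    then have "p ` s = {p (tail G (rep s)), p (head G (rep s))}" unfolding rep(2)[OF that] .
    then show ?thesis using arcs(4)[OF rep(1)[OF that]] by (simp only: im_def)
  qed
  have "plane_graph (edge_set G) p im"
  proof
    show "finite (edge_set G)" by (simp add: edge_set_def)
    show "card s = 2" if "s \<in> edge_set G" for s using that no_loops by (auto simp: edge_set_def)
    show "inj_on p (\<Union>(edge_set G))" using inj UV by (rule inj_on_subset)
    show "\<exists>g. Path_Connected.arc g \<and> pathstart g = p u \<and> pathfinish g = p v \<and> path_image g = im {u, v}" if "{u, v} \<in> edge_set G" "u \<noteq> v" for u v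
    proof -
      let ?e = "rep {u, v}"
      note r = rep[OF that(1)]
      consider "tail G ?e = u" "head G ?e = v" | "tail G ?e = v" "head G ?e = u"
        using r(2) by (auto simp: doubleton_eq_iff)
      then show ?thesis
      proof cases
        case 1
        then show ?thesis using arcs[OF r(1)] by (intro exI[of _ "\<gamma> ?e"]) (simp add: im_def)
      next
        case 2
        then show ?thesis using arcs[OF r(1)] by (intro exI[of _ "reversepath (\<gamma> ?e)"]) (simp add: im_def arc_reversepath)
      qed
    qed
    show "im s \<inter> p ` \<Union>(edge_set G) = p ` s" if "s \<in> edge_set G" for s
    proof -
      have "p ` \<Union>(edge_set G) \<subseteq> p ` verts G" "p ` s \<subseteq> p ` \<Union>(edge_set G)" using UV that by auto
      then show ?thesis using imV[OF that] by blast
    qed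
    show "im s \<inter> im s' \<subseteq> p ` \<Union>(edge_set G)" if "s \<in> edge_set G" "s' \<in> edge_set G" "s \<noteq> s'" for s s'
    proof -
      have "im s \<inter> im s' \<subseteq> p ` verts G"
        unfolding im_def using that rep by (intro diff) auto
      then have "im s \<inter> im s' \<subseteq> p ` s" using imV[OF that(1)] by blast
      moreover have "p ` s \<subseteq> p ` \<Union>(edge_set G)" using that by auto
      ultimately show ?thesis by blast
    qed
  qed
  then show ?thesis by blast
qed

lemma edge_set_arc:
  assumes "graph G" "{x, y} \<in> edge_set G"
  shows "\<exists>a\<in>arcs G. tail G a = x \<and> head G a = y"
proof -
  interpret graph G by fact
  obtain a where a: "a \<in> arcs G" "{tail G a, head G a} = {x, y}" using assms(2) by (auto simp: edge_set_def)
  obtain b where "b \<in> arcs G" "tail G a = head G b" "head G a = tail G b"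
    using sym_arcs a(1) unfolding symmetric_conv by blast
  then show ?thesis using a by (auto simp: doubleton_eq_iff)
qed

lemma awalk_of_path:
  assumes "graph G" "xs \<noteq> []" "set xs \<subseteq> verts G" "path_edges xs \<subseteq> edge_set G"
  shows "\<exists>q. pre_digraph.awalk G (hd xs) q (last xs) \<and> pre_digraph.awalk_verts G (hd xs) q = xs"
proof -
  interpret graph G by fact
  show ?thesis using assms(2-4)
  proof (induction xs rule: path_edges.induct)
    case (1 x y zs)
    then obtain q where q: "awalk y q (last (y # zs))" "awalk_verts y q = y # zs" by auto
    have "{x, y} \<in> edge_set G" using 1 by simp
    then obtain a where "a \<in> arcs G" "tail G a = x" "head G a = y" using edge_set_arc[OF assms(1)] by blast
    then show ?case using q by (intro exI[of _ "a # q"]) (simp add: awalk_Cons_iff)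
  next
    case ("2_2" x)
    then show ?case by (intro exI[of _ "[]"]) (simp add: awalk_Nil_iff)
  qed simp
qed

text \<open>Transfers the girth and the excluded lengths from closed arc walks to cycles as edge
  sets.\<close>

lemma cycle_to_ucycle:
  assumes "graph G" "is_cycle C" "C \<subseteq> edge_set G"
  shows "\<exists>c. ucycle G c \<and> length c = card C"
proof -
  interpret graph G by fact
  obtain xs where xs: "distinct xs" "3 \<le> length xs" "C = cycle_edges xs" using assms(2) by (auto simp: is_cycle_def)
  have ne: "xs \<noteq> []" using xs(2) by auto
  have "set xs \<subseteq> verts G"
  proof -
    have "set xs \<subseteq> \<Union>(edge_set G)"
      using Union_path_edges[of xs] xs assms(3) by (auto simp: cycle_edges_def)
    then show ?thesis by (auto simp: edge_set_def)
  qed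
  then obtain q where q: "awalk (hd xs) q (last xs)" "awalk_verts (hd xs) q = xs"
    using awalk_of_path[OF assms(1) ne] xs assms(3) by (auto simp: cycle_edges_def)
  obtain a where a: "a \<in> arcs G" "tail G a = last xs" "head G a = hd xs"
    using edge_set_arc[OF assms(1), of "last xs" "hd xs"] xs assms(3) by (auto simp: cycle_edges_def)
  have len: "length (a # q) = length xs" using length_awalk_verts[of "hd xs" q] q(2) by simp
  have "cycle (a # q)"
    unfolding cycle_def using q a xs(1) by (intro exI[of _ "last xs"]) (simp add: awalk_Cons_iff)
  then show ?thesis using len xs card_cycle_edges[OF xs(1,2)] unfolding ucycle_def by (intro exI[of _ "a # q"]) simp
qed

lemma short_cycles_disjoint:
  assumes E: "finite E" "\<And>e. e \<in> E \<Longrightarrow> card e = 2" and k: "odd k"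
    and len: "\<And>C. is_cycle C \<Longrightarrow> C \<subseteq> E \<Longrightarrow> card C = k \<or> 2 * k \<le> card C"
    and C: "is_cycle C" "C \<subseteq> E" "card C = k" and C': "is_cycle C'" "C' \<subseteq> E" "card C' = k" and ne: "C \<noteq> C'"
  shows "C \<inter> C' = {}"
proof (rule ccontr)
  assume int: "C \<inter> C' \<noteq> {}"
  define B where "B = sym_diff C C'"
  have fin: "finite C" "finite C'" using C C' is_cycle_finite by auto
  have cB: "card B + 2 * card (C \<inter> C') = 2 * k"
  proof -
    have "card B = card (C - C') + card (C' - C)" unfolding B_def using fin by (intro card_Un_disjoint) auto
    then show ?thesis using card_Int_Diff[OF fin(1), of C'] card_Int_Diff[OF fin(2), of C] C(3) C'(3) by (simp add: Int_commute)
  qed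
  have "0 < card (C \<inter> C')" using int fin by (simp add: card_gt_0_iff)
  have B: "finite B" "B \<subseteq> E" "even_degrees B" "B \<noteq> {}"
    unfolding B_def using fin C C' even_degrees_sym_diff[OF fin even_degrees_cycle even_degrees_cycle] ne by auto
  have sub: "card K = k" if "is_cycle K" "K \<subseteq> B" for K
  proof -
    have "card K \<le> card B" using that B by (intro card_mono) auto
    moreover have "card K = k \<or> 2 * k \<le> card K" using len that B(2) by blast
    ultimately show ?thesis using cB \<open>0 < card (C \<inter> C')\<close> by linarith
  qed
  obtain K where K: "K \<subseteq> B" "is_cycle K" using even_degrees_contains_cycle[OF B(1,4) _ B(3)] B(2) E(2) by blast
  have fK: "finite K" using K is_cycle_finite by auto
  have "sym_diff B K = B - K" using K by auto
  then have ev: "even_degrees (B - K)" using even_degrees_sym_diff[OF B(1) fK B(3) even_degrees_cycle[OF K(2)]] by simp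
  have cBK: "card (B - K) = card B - k" using K fK sub by (simp add: card_Diff_subset)
  \<comment> \<open>A further cycle disjoint from \<open>K\<close> would bring \<open>B\<close> to
    \<open>2 * k\<close> edges, but the common edges of \<open>C\<close> and \<open>C'\<close> keep
    it below.\<close>
  have "B - K = {}"
  proof (rule ccontr)
    assume "B - K \<noteq> {}"
    then obtain K' where K': "K' \<subseteq> B - K" "is_cycle K'" using even_degrees_contains_cycle[of "B - K"] ev B E(2) by blast
    then have "card K' = k" using sub by blast
    moreover have "card K' \<le> card (B - K)" using K' B by (intro card_mono) auto
    ultimately show False using cBK cB \<open>0 < card (C \<inter> C')\<close> by linarith
  qed
  then have "B = K" using K by blast
  then have "card B = k" using sub[OF K(2,1)] by simp
  then have "even (k + 2 * card (C \<inter> C'))" using cB by simp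
  then show False using k by simp
qed

lemma dist_ok_1:
  assumes "dist_ok t 1 (card (A - B))" "finite A" "card A = t"
  shows "A \<inter> B = {}"
proof -
  have "card A \<le> card (A - B)" using assms(1,3) by (simp add: dist_ok_def)
  then have "A - B = A" using assms(2) by (intro card_subset_eq) (auto simp: card_mono le_antisym)
  then show ?thesis by blast
qed

text \<open>Let \<open>facial_cycles\<close> give \<open>n\<close> cycles, \<open>c\<close> of them
  of length \<open>k\<close>. Their total length is at most \<open>2 * card S\<close>, so the others
  satisfy \<open>22 * k * (n - c) \<le> 3 * (2 * card S - k * c)\<close>. This is the origin of the
  coefficients 6 and \<open>19 = 22 - 3\<close>.\<close>

lemma sparse_network_of_plane_graph:
  assumes pl: "plane_graph E p im" and V: "finite V" "\<Union>E \<subseteq> V" and k: "odd k"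
    and len: "\<And>C. is_cycle C \<Longrightarrow> C \<subseteq> E \<Longrightarrow> card C = k \<or> 22 * k < 3 * card C"
    and ep: "\<And>e. e \<in> E \<Longrightarrow> e = {fst (ep e), snd (ep e)}"
  shows "sparse_network k V E ep (\<lambda>_. 1) {C. is_cycle C \<and> C \<subseteq> E \<and> card C = k}"
proof -
  interpret plane_graph E p im by fact
  let ?KK = "{C. is_cycle C \<and> C \<subseteq> E \<and> card C = k}"
  have inc: "incid ep e w = of_bool (w \<in> e)" if "e \<in> E" for e w
  proof -
    obtain a b where ab: "ep e = (a, b)" by (cases "ep e")
    then have e: "e = {a, b}" using ep[OF that] by simp
    then have "a \<noteq> b" using two[OF that] by auto
    then show ?thesis using ab e by (auto simp: incid_def)
  qed
  show ?thesis
  proof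
    show "finite V" "finite E" by (fact V finE)+
    show "fst (ep e) \<in> V \<and> snd (ep e) \<in> V" if "e \<in> E" for e using ep[OF that] V that by blast
    show "K \<subseteq> E" if "K \<in> ?KK" for K using that by simp
    show "K \<noteq> {}" if "K \<in> ?KK" for K using that k by auto
    show "sum (\<lambda>_. 1) K = k" if "K \<in> ?KK" for K using that by simp
    show "degree_in ep K w \<in> {0, 2}" if K: "K \<in> ?KK" for K w
    proof -
      have fK: "finite K" using K is_cycle_finite by auto
      have "degree_in ep K w = (\<Sum>e\<in>K. of_bool (w \<in> e))" unfolding degree_in_def using K inc by (intro sum.cong) auto
      also have "\<dots> = card {e \<in> K. w \<in> e}" using fK by (simp add: Int_def)
      finally show ?thesis using cycle_degree[of K w] K by simp
    qed
    show "K \<inter> K' = {}" if "K \<in> ?KK" "K' \<in> ?KK" "K \<noteq> K'" for K K'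
    proof (rule short_cycles_disjoint[OF finE two k])
      show "card C = k \<or> 2 * k \<le> card C" if "is_cycle C" "C \<subseteq> E" for C using len[OF that] by linarith
    qed (use that in auto)
    fix S U assume S: "S \<subseteq> E" and U: "U \<subseteq> V" "U \<noteq> {}" and ends: "\<And>e. e \<in> S \<Longrightarrow> fst (ep e) \<in> U \<and> snd (ep e) \<in> U"
    interpret sub: plane_graph S p im using plane_subgraph[OF S] .
    have finU: "finite U" using finite_subset[OF U(1) V(1)] .
    have SU: "\<Union>S \<subseteq> U"
    proof
      fix x assume "x \<in> \<Union>S"
      then obtain e where e: "e \<in> S" "x \<in> e" by blast
      then have "x = fst (ep e) \<or> x = snd (ep e)" using ep[of e] S by auto
      then show "x \<in> U" using ends[OF e(1)] by auto
    qed
    from sub.facial_cycles[OF finU SU U(2)] obtain CC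
      where CC': "finite CC \<and> (\<forall>C\<in>CC. is_cycle C \<and> C \<subseteq> S) \<and> (\<forall>e\<in>S. card {C \<in> CC. e \<in> C} \<le> 2) \<and>
        card S + 1 \<le> card U + card CC" ..
    have CC: "finite CC" "\<And>C. C \<in> CC \<Longrightarrow> is_cycle C \<and> C \<subseteq> S" "\<And>e. e \<in> S \<Longrightarrow> card {C \<in> CC. e \<in> C} \<le> 2"
      "card S + 1 \<le> card U + card CC"
      using CC' by simp_all
    define N where "N = card {K \<in> ?KK. K \<subseteq> S}"
    define CK where "CK = {C \<in> CC. card C = k}"
    have "CK \<subseteq> {K \<in> ?KK. K \<subseteq> S}" using CC(2) S by (auto simp: CK_def)
    moreover have "finite {K \<in> ?KK. K \<subseteq> S}" using finE by (auto intro: finite_subset[of _ "Pow E"])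
    ultimately have nN: "card CK \<le> N" unfolding N_def by (intro card_mono)
    have "(\<Sum>C\<in>CC. card C) = (\<Sum>C\<in>CC. card {e \<in> S. e \<in> C})"
    proof (rule sum.cong)
      fix C assume "C \<in> CC"
      then have "{e \<in> S. e \<in> C} = C" using CC(2) by blast
      then show "card C = card {e \<in> S. e \<in> C}" by simp
    qed simp
    also have "\<dots> = (\<Sum>e\<in>S. card {C \<in> CC. e \<in> C})"
      using sum.swap_restrict[OF CC(1) sub.finE, of "\<lambda>_ _. 1 :: nat" "\<lambda>C e. e \<in> C"] by simp
    also have "\<dots> \<le> (\<Sum>e\<in>S. 2)" using CC(3) by (intro sum_mono)
    finally have total: "(\<Sum>C\<in>CC. card C) \<le> 2 * card S" by simp
    have "(\<Sum>C\<in>CC. card C) = (\<Sum>C\<in>CC - CK. card C) + (\<Sum>C\<in>CK. card C)"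
      using CC(1) by (intro sum.subset_diff) (auto simp: CK_def)
    moreover have "(\<Sum>C\<in>CK. card C) = k * card CK" by (simp add: CK_def)
    moreover have "card (CC - CK) * (22 * k) \<le> 3 * (\<Sum>C\<in>CC - CK. card C)"
    proof -
      have "22 * k \<le> 3 * card C" if "C \<in> CC - CK" for C
        using len[of C] CC(2)[of C] that S by (force simp: CK_def)
      then show ?thesis using sum_bounded_below[of "CC - CK" "22 * k" "\<lambda>C. 3 * card C"] by (simp add: sum_distrib_left)
    qed
    moreover have "card CC = card (CC - CK) + card CK"
      using CC(1) card_Int_Diff[of CC CK] by (simp add: CK_def Int_def conj_commute)
    ultimately have "22 * k * card CC + 3 * k * card CK \<le> 6 * card S + 22 * k * card CK"
      using total by (simp add: algebra_simps)
    then have a: "22 * k * card CC \<le> 6 * card S + 19 * k * card CK" by simp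
    have "22 * k * (card S + 1) \<le> 22 * k * (card U + card CC)" using CC(4) by (rule mult_le_mono2)
    also have "\<dots> \<le> 22 * k * card U + (6 * card S + 19 * k * card CK)" using a by (simp add: algebra_simps)
    also have "\<dots> \<le> 22 * k * card U + (6 * card S + 19 * k * N)" using nN by simp
    finally show "22 * k * (card S + 1) \<le> 22 * k * card U + 6 * sum (\<lambda>_. 1) S + 19 * k * card {K \<in> ?KK. K \<subseteq> S}"
      by (simp add: N_def)
  qed
qed

theorem theorem1p6:
  fixes G :: "('a, 'b) pre_digraph" and k :: nat
  assumes "odd k" and "5 \<le> k"
    and "graph G" and "planar G" and "girth G = enat k"
    and "\<And>l. k + 1 \<le> l \<Longrightarrow> int l \<le> \<lfloor>22 * real k / 3\<rfloor> \<Longrightarrow> \<not> (\<exists>c. ucycle G c \<and> length c = l)"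
  shows "\<exists>\<phi>. fractional_coloring G k ((k - 1) div 2) \<phi>"
proof -
  interpret graph G by fact
  obtain t where t: "k = 2 * t + 1" using assms(1) by (elim oddE)
  obtain p im where pl: "plane_graph (edge_set G) p im" using plane_graph_of_planar[OF assms(3,4)] by blast
  have len: "card C = k \<or> 22 * k < 3 * card C" if C: "is_cycle C" "C \<subseteq> edge_set G" for C
  proof -
    obtain c where c: "ucycle G c" "length c = card C" using cycle_to_ucycle[OF assms(3) C] by blast
    have "girth G \<le> enat (length c)" unfolding girth_def using c(1) by (intro INF_lower) simp
    then have "k \<le> card C" using assms(5) c(2) by simp
    \<comment> \<open>The excluded lengths start at \<open>k + 1\<close>, so a cycle longer than the
      girth exceeds the floor and, its length being an integer, also \<open>22 * k / 3\<close>
      itself.\<close>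
    moreover have "22 * k < 3 * card C" if "k + 1 \<le> card C"
    proof -
      have "\<not> int (card C) \<le> \<lfloor>22 * real k / 3\<rfloor>" using assms(6)[OF that] c by blast
      then have "22 * real k / 3 < real (card C)" by (simp add: le_floor_iff)
      then have "real (22 * k) < real (3 * card C)" by simp
      then show ?thesis by (simp only: of_nat_less_iff)
    qed
    ultimately show ?thesis by linarith
  qed
  have UV: "\<Union>(edge_set G) \<subseteq> verts G" by (auto simp: edge_set_def)
  have "\<forall>e\<in>edge_set G. \<exists>uv. e = {fst uv, snd uv}" by (auto simp: edge_set_def)
  then obtain ep where ep: "\<And>e. e \<in> edge_set G \<Longrightarrow> e = {fst (ep e), snd (ep e)}" by metis
  have "sparse_network (2 * t + 1) (verts G) (edge_set G) ep (\<lambda>_. 1) {C. is_cycle C \<and> C \<subseteq> edge_set G \<and> card C = k}"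
    using sparse_network_of_plane_graph[OF pl finite_verts UV assms(1) len ep] t by simp
  from network_colorable[OF this] obtain \<phi> where \<phi>: "link_coloring t (verts G) (edge_set G) ep (\<lambda>_. 1) \<phi>"
    using t assms(2) by auto
  have "\<phi> u \<inter> \<phi> v = {}" if uv: "(u, v) \<in> arcs_ends G" for u v
  proof -
    have e: "{u, v} \<in> edge_set G" using uv by (auto simp: edge_set_def arcs_ends_conv)
    have V: "u \<in> verts G" "v \<in> verts G" using adj_in_verts[OF uv] by auto
    have "joins ep {u, v} u v" using ep[OF e] by (auto simp: joins_def doubleton_eq_iff prod_eq_iff)
    \<comment> \<open>A link of length 1 admits only the distance \<open>t\<close>, that is,
      disjoint sets.\<close>
    from link_coloring_joins[OF \<phi> e this V] show ?thesis
      using link_coloring_vertex[OF \<phi> V(1)] by (intro dist_ok_1) auto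
  qed
  then show ?thesis using \<phi> t assms(2) unfolding fractional_coloring_def link_coloring_def by (intro exI[of _ \<phi>]) auto
qed

end
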